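(* Let $\mathfrak g$ be a Kac--Moody algebra. Fix $\lambda\in\mathfrak h^*$ and a subset $\mathring I\subset I_\lambda$. Every highest weight $\mathfrak g$-module $V$ of highest weight $\lambda$ and integrability $I_V=\mathring I$ has the same set of weights $\operatorname{wt}V$ if and only if $I_\lambda\setminus\mathring I$ is complete, i.e. $$\langle\check\alpha_i,\alpha_j\rangle\neq0\quad\text{for all } i,j\in I_\lambda\setminus\mathring I.$$
   Context: Let $I$ be a finite set, $A=(a_{ij})_{i,j\in I}$ a generalized Cartan matrix, and $(\mathfrak h,\{\alpha_i\},\{\check\alpha_i\})$ a realization over $\mathbb C$, i.e. $\dim\mathfrak h=2|I|-\operatorname{rk}A$, with linearly independent simple roots $\alpha_i\in\mathfrak h^*$ and linearly independent simple coroots $\check\alpha_i\in\mathfrak h$ with $\langle\check\alpha_i,\alpha_j\rangle=a_{ij}$. $\mathfrak g=\mathfrak g(A)$ is the Lie algebra generated by $\mathfrak h$ and $e_i,f_i$ ($i\in I$) with relations $[\mathfrak h,\mathfrak h]=0$, $[h,e_i]=\langle h,\alpha_i\rangle e_i$, $[h,f_i]=-\langle h,\alpha_i\rangle f_i$, $[e_i,f_j]=\delta_{ij}\check\alpha_i$ and the Serre relations $(\operatorname{ad}e_i)^{1-a_{ij}}e_j=0=(\operatorname{ad}f_i)^{1-a_{ij}}f_j$ for $i\ne j$. For an $\mathfrak h$-module $M$, $M_\mu=\{m: hm=\langle h,\mu\rangle m\ \forall h\in\mathfrak h\}$ and $\operatorname{wt}M=\{\mu: M_\mu\neq0\}$.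 $I_\lambda=\{i\in I:\langle\check\alpha_i,\lambda\rangle\in\mathbb Z^{\geqslant0}\}$. The integrability of a highest weight module $V$ is $I_V=\{i\in I: f_i\text{ acts locally nilpotently on }V\}$. *)

theory Defs
  imports Complex_Main "HOL-Library.Function_Algebras" "HOL-Algebra.Module"
begin

section \<open>Lie algebras and their modules\<close>

text \<open>A Lie algebra record extends the module record; the ring fields \<open>mult\<close> and \<open>one\<close>
  that every module record carries along are ignored, as in \<open>Module.module\<close>.\<close>

record ('a, 'b) lie_algebra = "('a, 'b) module" +
  lie_bracket :: "'b \<Rightarrow> 'b \<Rightarrow> 'b"

locale lie_algebra = R?: cring R + L?: Module.module R L
  for R :: "('k, 'r) ring_scheme" and L :: "('k, 'l, 'm) lie_algebra_scheme" +
  assumes bracket_closed: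
      "x \<in> carrier L \<Longrightarrow> y \<in> carrier L \<Longrightarrow> lie_bracket L x y \<in> carrier L"
    and bracket_add_left:
      "x \<in> carrier L \<Longrightarrow> y \<in> carrier L \<Longrightarrow> z \<in> carrier L \<Longrightarrow>
        lie_bracket L (x \<oplus>\<^bsub>L\<^esub> y) z = lie_bracket L x z \<oplus>\<^bsub>L\<^esub> lie_bracket L y z"
    and bracket_add_right:
      "x \<in> carrier L \<Longrightarrow> y \<in> carrier L \<Longrightarrow> z \<in> carrier L \<Longrightarrow>
        lie_bracket L x (y \<oplus>\<^bsub>L\<^esub> z) = lie_bracket L x y \<oplus>\<^bsub>L\<^esub> lie_bracket L x z"
    and bracket_smult_left:
      "c \<in> carrier R \<Longrightarrow> x \<in> carrier L \<Longrightarrow> y \<in> carrier L \<Longrightarrow>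
        lie_bracket L (c \<odot>\<^bsub>L\<^esub> x) y = c \<odot>\<^bsub>L\<^esub> lie_bracket L x y"
    and bracket_smult_right:
      "c \<in> carrier R \<Longrightarrow> x \<in> carrier L \<Longrightarrow> y \<in> carrier L \<Longrightarrow>
        lie_bracket L x (c \<odot>\<^bsub>L\<^esub> y) = c \<odot>\<^bsub>L\<^esub> lie_bracket L x y"
    and bracket_self:
      "x \<in> carrier L \<Longrightarrow> lie_bracket L x x = \<zero>\<^bsub>L\<^esub>"
    and jacobi:
      "x \<in> carrier L \<Longrightarrow> y \<in> carrier L \<Longrightarrow> z \<in> carrier L \<Longrightarrow>
        lie_bracket L x (lie_bracket L y z) \<oplus>\<^bsub>L\<^esub> lie_bracket L y (lie_bracket L z x)
          \<oplus>\<^bsub>L\<^esub> lie_bracket L z (lie_bracket L x y) = \<zero>\<^bsub>L\<^esub>"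

locale lie_module = L?: lie_algebra R L + V?: Module.module R V
  for R :: "('k, 'r) ring_scheme" and L :: "('k, 'l, 'm) lie_algebra_scheme"
    and V :: "('k, 'v, 'n) module_scheme" +
  fixes act :: "'l \<Rightarrow> 'v \<Rightarrow> 'v"
  assumes act_closed:
      "x \<in> carrier L \<Longrightarrow> v \<in> carrier V \<Longrightarrow> act x v \<in> carrier V"
    and act_add_left:
      "x \<in> carrier L \<Longrightarrow> y \<in> carrier L \<Longrightarrow> v \<in> carrier V \<Longrightarrow>
        act (x \<oplus>\<^bsub>L\<^esub> y) v = act x v \<oplus>\<^bsub>V\<^esub> act y v"
    and act_smult_left:
      "c \<in> carrier R \<Longrightarrow> x \<in> carrier L \<Longrightarrow> v \<in> carrier V \<Longrightarrow>
        act (c \<odot>\<^bsub>L\<^esub> x) v = c \<odot>\<^bsub>V\<^esub> act x v"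
    and act_add_right:
      "x \<in> carrier L \<Longrightarrow> v \<in> carrier V \<Longrightarrow> w \<in> carrier V \<Longrightarrow>
        act x (v \<oplus>\<^bsub>V\<^esub> w) = act x v \<oplus>\<^bsub>V\<^esub> act x w"
    and act_smult_right:
      "c \<in> carrier R \<Longrightarrow> x \<in> carrier L \<Longrightarrow> v \<in> carrier V \<Longrightarrow>
        act x (c \<odot>\<^bsub>V\<^esub> v) = c \<odot>\<^bsub>V\<^esub> act x v"
    and act_bracket:
      "x \<in> carrier L \<Longrightarrow> y \<in> carrier L \<Longrightarrow> v \<in> carrier V \<Longrightarrow>
        act (lie_bracket L x y) v = act x (act y v) \<ominus>\<^bsub>V\<^esub> act y (act x v)"

definition lie_submodule ::
  "('k, 'r) ring_scheme \<Rightarrow> ('k, 'l, 'm) lie_algebra_scheme \<Rightarrow> ('k, 'v, 'n) module_scheme \<Rightarrow>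
    ('l \<Rightarrow> 'v \<Rightarrow> 'v) \<Rightarrow> 'v set \<Rightarrow> bool"
where
  "lie_submodule R L V act N \<longleftrightarrow>
    submodule N R V \<and> (\<forall>x\<in>carrier L. \<forall>v\<in>N. act x v \<in> N)"


section \<open>Complex Lie algebras given by generators and relations\<close>

definition complex_field :: "complex ring" where
  "complex_field = \<lparr>carrier = UNIV, mult = (*), one = 1, zero = 0, add = (+)\<rparr>"

datatype 'x lie_term =
    Gen 'x
  | Zero
  | Add "'x lie_term" "'x lie_term"
  | Scale complex "'x lie_term"
  | Brk "'x lie_term" "'x lie_term"

text \<open>The least congruence on terms that contains the relations \<open>R\<close> and the axioms of a complex
  Lie algebra.\<close>

inductive lie_eq :: "('x lie_term \<times> 'x lie_term) set \<Rightarrow> 'x lie_term \<Rightarrow> 'x lie_term \<Rightarrow> bool"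
  for R where
  rel: "(s, t) \<in> R \<Longrightarrow> lie_eq R s t"
| refl: "lie_eq R t t"
| sym: "lie_eq R s t \<Longrightarrow> lie_eq R t s"
| trans: "lie_eq R s t \<Longrightarrow> lie_eq R t u \<Longrightarrow> lie_eq R s u"
| cong_Add: "lie_eq R s s' \<Longrightarrow> lie_eq R t t' \<Longrightarrow> lie_eq R (Add s t) (Add s' t')"
| cong_Scale: "lie_eq R t t' \<Longrightarrow> lie_eq R (Scale c t) (Scale c t')"
| cong_Brk: "lie_eq R s s' \<Longrightarrow> lie_eq R t t' \<Longrightarrow> lie_eq R (Brk s t) (Brk s' t')"
| Add_assoc: "lie_eq R (Add (Add s t) u) (Add s (Add t u))"
| Add_comm: "lie_eq R (Add s t) (Add t s)"
| Add_Zero: "lie_eq R (Add Zero t) t"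
| Add_neg: "lie_eq R (Add (Scale (- 1) t) t) Zero"
| Scale_Add: "lie_eq R (Scale c (Add s t)) (Add (Scale c s) (Scale c t))"
| Scale_add: "lie_eq R (Scale (c + d) t) (Add (Scale c t) (Scale d t))"
| Scale_Scale: "lie_eq R (Scale c (Scale d t)) (Scale (c * d) t)"
| Scale_one: "lie_eq R (Scale 1 t) t"
| Brk_Add_left: "lie_eq R (Brk (Add s t) u) (Add (Brk s u) (Brk t u))"
| Brk_Add_right: "lie_eq R (Brk s (Add t u)) (Add (Brk s t) (Brk s u))"
| Brk_Scale_left: "lie_eq R (Brk (Scale c s) t) (Scale c (Brk s t))"
| Brk_Scale_right: "lie_eq R (Brk s (Scale c t)) (Scale c (Brk s t))"
| Brk_self: "lie_eq R (Brk t t) Zero"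
| Brk_jacobi: "lie_eq R (Add (Add (Brk s (Brk t u)) (Brk t (Brk u s))) (Brk u (Brk s t))) Zero"

text \<open>The Lie algebra generated by \<open>X\<close> with relations \<open>R\<close>, where \<open>R\<close> relates terms over \<open>X\<close>.
  A derivation of \<open>lie_eq R\<close> may pass through generators outside \<open>X\<close>, but sending these to
  \<open>Zero\<close> turns it into a derivation over \<open>X\<close>, so no additional identification arises.\<close>

definition lie_class ::
  "'x set \<Rightarrow> ('x lie_term \<times> 'x lie_term) set \<Rightarrow> 'x lie_term \<Rightarrow> 'x lie_term set"
where
  "lie_class X R t = {s. set_lie_term s \<subseteq> X \<and> lie_eq R s t}"

definition presented_lie_algebra ::
  "'x set \<Rightarrow> ('x lie_term \<times> 'x lie_term) set \<Rightarrow> (complex, 'x lie_term set) lie_algebra"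
where
  "presented_lie_algebra X R =
    \<lparr>carrier = lie_class X R ` {t. set_lie_term t \<subseteq> X},
     mult = undefined, one = undefined,
     zero = lie_class X R Zero,
     add = (\<lambda>a b. \<Union>s\<in>a. \<Union>t\<in>b. lie_class X R (Add s t)),
     smult = (\<lambda>c a. \<Union>s\<in>a. lie_class X R (Scale c s)),
     lie_bracket = (\<lambda>a b. \<Union>s\<in>a. \<Union>t\<in>b. lie_class X R (Brk s t))\<rparr>"

lemma cring_complex_field: "cring complex_field"
proof (intro cringI abelian_groupI comm_monoidI)
  fix x :: complex
  show "\<exists>y\<in>carrier complex_field. y \<oplus>\<^bsub>complex_field\<^esub> x = \<zero>\<^bsub>complex_field\<^esub>"
    by (rule bexI[of _ "- x"]) (auto simp: complex_field_def)
qed (auto simp: complex_field_def algebra_simps)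

context
  fixes X :: "'x set" and R :: "('x lie_term \<times> 'x lie_term) set"
begin

private lemma class_eqI: "lie_eq R s t \<Longrightarrow> lie_class X R s = lie_class X R t"
  unfolding lie_class_def by (blast intro: lie_eq.sym lie_eq.trans)

private lemma class_Zero: "\<zero>\<^bsub>presented_lie_algebra X R\<^esub> = lie_class X R Zero"
  by (simp add: presented_lie_algebra_def)

private lemma class_add:
  assumes "set_lie_term s \<subseteq> X" "set_lie_term t \<subseteq> X"
  shows "lie_class X R s \<oplus>\<^bsub>presented_lie_algebra X R\<^esub> lie_class X R t = lie_class X R (Add s t)"
  using assms unfolding presented_lie_algebra_def
  by (auto simp: lie_class_def intro: lie_eq.trans lie_eq.cong_Add lie_eq.refl)

private lemma class_smult:
  assumes "set_lie_term t \<subseteq> X"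
  shows "c \<odot>\<^bsub>presented_lie_algebra X R\<^esub> lie_class X R t = lie_class X R (Scale c t)"
  using assms unfolding presented_lie_algebra_def
  by (auto simp: lie_class_def intro: lie_eq.trans lie_eq.cong_Scale lie_eq.refl)

private lemma class_bracket:
  assumes "set_lie_term s \<subseteq> X" "set_lie_term t \<subseteq> X"
  shows "lie_bracket (presented_lie_algebra X R) (lie_class X R s) (lie_class X R t) =
    lie_class X R (Brk s t)"
  using assms unfolding presented_lie_algebra_def
  by (auto simp: lie_class_def intro: lie_eq.trans lie_eq.cong_Brk lie_eq.refl)

private lemma class_carrier:
  "set_lie_term t \<subseteq> X \<Longrightarrow> lie_class X R t \<in> carrier (presented_lie_algebra X R)"
  by (simp add: presented_lie_algebra_def)

private lemma carrierE:
  assumes "a \<in> carrier (presented_lie_algebra X R)"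
  obtains t where "a = lie_class X R t" "set_lie_term t \<subseteq> X"
  using assms by (auto simp: presented_lie_algebra_def)

private lemmas class_simps =
  class_Zero class_add class_smult class_bracket class_carrier

private lemmas class_axioms =
  lie_eq.Add_Zero[THEN class_eqI] lie_eq.Add_neg[THEN class_eqI] lie_eq.Scale_Add[THEN class_eqI]
  lie_eq.Scale_add[THEN class_eqI] lie_eq.Scale_Scale[THEN class_eqI]
  lie_eq.Scale_one[THEN class_eqI] lie_eq.Brk_Add_left[THEN class_eqI]
  lie_eq.Brk_Add_right[THEN class_eqI] lie_eq.Brk_Scale_left[THEN class_eqI]
  lie_eq.Brk_Scale_right[THEN class_eqI] lie_eq.Brk_self[THEN class_eqI]
  lie_eq.Brk_jacobi[THEN class_eqI]

lemma lie_algebra_presented: "lie_algebra complex_field (presented_lie_algebra X R)"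
proof -
  have ab: "abelian_group (presented_lie_algebra X R)"
  proof (rule abelian_groupI)
    fix x assume "x \<in> carrier (presented_lie_algebra X R)"
    then obtain t where t: "x = lie_class X R t" "set_lie_term t \<subseteq> X" by (rule carrierE)
    then show "\<exists>y\<in>carrier (presented_lie_algebra X R).
        y \<oplus>\<^bsub>presented_lie_algebra X R\<^esub> x = \<zero>\<^bsub>presented_lie_algebra X R\<^esub>"
      by (intro bexI[of _ "lie_class X R (Scale (- 1) t)"])
        (auto simp: class_simps class_axioms)
  next
    fix x y
    assume "x \<in> carrier (presented_lie_algebra X R)" "y \<in> carrier (presented_lie_algebra X R)"
    then show "x \<oplus>\<^bsub>presented_lie_algebra X R\<^esub> y = y \<oplus>\<^bsub>presented_lie_algebra X R\<^esub> x"
      by (elim carrierE) (simp add: class_simps class_eqI[OF lie_eq.Add_comm])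
  qed (auto elim!: carrierE simp: class_simps class_axioms lie_eq.Add_assoc[THEN class_eqI])
  have md: "Module.module complex_field (presented_lie_algebra X R)"
    by (rule Module.moduleI[OF cring_complex_field ab])
      (auto elim!: carrierE simp: class_simps class_axioms complex_field_def)
  show ?thesis
    by (intro lie_algebra.intro lie_algebra_axioms.intro md cring_complex_field)
      (auto elim!: carrierE simp: class_simps class_axioms)
qed

end


section \<open>Kac--Moody algebras\<close>

abbreviation fun_scale :: "complex \<Rightarrow> ('x \<Rightarrow> complex) \<Rightarrow> 'x \<Rightarrow> complex" where
  "fun_scale \<equiv> (\<lambda>c f x. c * f x)"

definition gen_cartan_matrix :: "'i set \<Rightarrow> ('i \<Rightarrow> 'i \<Rightarrow> int) \<Rightarrow> bool" where
  "gen_cartan_matrix I A \<longleftrightarrow>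
    (\<forall>i\<in>I. A i i = 2) \<and>
    (\<forall>i\<in>I. \<forall>j\<in>I. i \<noteq> j \<longrightarrow> A i j \<le> 0) \<and>
    (\<forall>i\<in>I. \<forall>j\<in>I. A i j = 0 \<longleftrightarrow> A j i = 0)"

text \<open>Row rank over the complex numbers; the rows are extended by zero outside \<open>I\<close>.\<close>

definition matrix_rank :: "'i set \<Rightarrow> ('i \<Rightarrow> 'i \<Rightarrow> int) \<Rightarrow> nat" where
  "matrix_rank I A =
    vector_space.dim fun_scale ((\<lambda>i j. if j \<in> I then complex_of_int (A i j) else 0) ` I)"

text \<open>A generalized Cartan matrix \<open>A\<close> on \<open>I\<close>, and a realization whose Cartan subalgebra is the
  whole type \<open>'h\<close> with scalar multiplication \<open>hscale\<close>.\<close>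

record ('i, 'h) km_data =
  ind :: "'i set"
  gcm :: "'i \<Rightarrow> 'i \<Rightarrow> int"
  hscale :: "complex \<Rightarrow> 'h \<Rightarrow> 'h"
  coroot :: "'i \<Rightarrow> 'h"
  root :: "'i \<Rightarrow> 'h \<Rightarrow> complex"

definition hdual :: "('i, 'h::ab_group_add) km_data \<Rightarrow> ('h \<Rightarrow> complex) set" where
  "hdual D = {\<mu>. Vector_Spaces.linear (hscale D) (*) \<mu>}"

locale kac_moody =
  fixes D :: "('i, 'h::ab_group_add) km_data"
  assumes finite_ind: "finite (ind D)"
    and gcm: "gen_cartan_matrix (ind D) (gcm D)"
    and vector_space_h: "vector_space (hscale D)"
    and finite_dim_h: "\<exists>B. finite B \<and> Modules.module.span (hscale D) B = UNIV"
    and dim_h: "vector_space.dim (hscale D) UNIV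
                  = 2 * card (ind D) - matrix_rank (ind D) (gcm D)"
    and root_dual: "root D ` ind D \<subseteq> hdual D"
    and inj_root: "inj_on (root D) (ind D)"
    and independent_root: "\<not> Modules.module.dependent fun_scale (root D ` ind D)"
    and inj_coroot: "inj_on (coroot D) (ind D)"
    and independent_coroot: "\<not> Modules.module.dependent (hscale D) (coroot D ` ind D)"
    and pairing: "\<forall>i\<in>ind D. \<forall>j\<in>ind D. root D j (coroot D i) = of_int (gcm D i j)"

datatype ('i, 'h) km_gen = H 'h | E 'i | F 'i

definition km_gens :: "('i, 'h) km_data \<Rightarrow> ('i, 'h) km_gen set" where
  "km_gens D = range H \<union> E ` ind D \<union> F ` ind D"

text \<open>The first two families say that \<open>H\<close> embeds the generators from \<open>'h\<close> linearly.\<close>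

definition km_rels ::
  "('i, 'h::ab_group_add) km_data \<Rightarrow>
    (('i, 'h) km_gen lie_term \<times> ('i, 'h) km_gen lie_term) set"
where
  "km_rels D =
      {(Gen (H (h + k)), Add (Gen (H h)) (Gen (H k))) | h k. True}
    \<union> {(Gen (H (hscale D c h)), Scale c (Gen (H h))) | c h. True}
    \<union> {(Brk (Gen (H h)) (Gen (H k)), Zero) | h k. True}
    \<union> {(Brk (Gen (H h)) (Gen (E i)), Scale (root D i h) (Gen (E i))) | h i. i \<in> ind D}
    \<union> {(Brk (Gen (H h)) (Gen (F i)), Scale (- root D i h) (Gen (F i))) | h i. i \<in> ind D}
    \<union> {(Brk (Gen (E i)) (Gen (F j)), if i = j then Gen (H (coroot D i)) else Zero) | i j.
          i \<in> ind D \<and> j \<in> ind D}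
    \<union> {((Brk (Gen (E i)) ^^ nat (1 - gcm D i j)) (Gen (E j)), Zero) | i j.
          i \<in> ind D \<and> j \<in> ind D \<and> i \<noteq> j}
    \<union> {((Brk (Gen (F i)) ^^ nat (1 - gcm D i j)) (Gen (F j)), Zero) | i j.
          i \<in> ind D \<and> j \<in> ind D \<and> i \<noteq> j}"

type_synonym ('i, 'h) km_elt = "('i, 'h) km_gen lie_term set"

definition km_algebra ::
  "('i, 'h::ab_group_add) km_data \<Rightarrow> (complex, ('i, 'h) km_elt) lie_algebra"
where
  "km_algebra D = presented_lie_algebra (km_gens D) (km_rels D)"

definition km_elem :: "('i, 'h::ab_group_add) km_data \<Rightarrow> ('i, 'h) km_gen \<Rightarrow> ('i, 'h) km_elt" where
  "km_elem D x = lie_class (km_gens D) (km_rels D) (Gen x)"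


section \<open>Weights, highest weight modules, integrability\<close>

definition weight_space ::
  "('i, 'h::ab_group_add) km_data \<Rightarrow> (complex, 'v) module \<Rightarrow> (('i, 'h) km_elt \<Rightarrow> 'v \<Rightarrow> 'v) \<Rightarrow>
    ('h \<Rightarrow> complex) \<Rightarrow> 'v set"
where
  "weight_space D V act \<mu> =
    {m \<in> carrier V. \<forall>h. act (km_elem D (H h)) m = \<mu> h \<odot>\<^bsub>V\<^esub> m}"

definition weights ::
  "('i, 'h::ab_group_add) km_data \<Rightarrow> (complex, 'v) module \<Rightarrow> (('i, 'h) km_elt \<Rightarrow> 'v \<Rightarrow> 'v) \<Rightarrow>
    ('h \<Rightarrow> complex) set"
where
  "weights D V act = {\<mu> \<in> hdual D. weight_space D V act \<mu> \<noteq> {\<zero>\<^bsub>V\<^esub>}}"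

definition highest_weight_module ::
  "('i, 'h::ab_group_add) km_data \<Rightarrow> ('h \<Rightarrow> complex) \<Rightarrow> (complex, 'v) module \<Rightarrow>
    (('i, 'h) km_elt \<Rightarrow> 'v \<Rightarrow> 'v) \<Rightarrow> bool"
where
  "highest_weight_module D \<Lambda> V act \<longleftrightarrow>
    lie_module complex_field (km_algebra D) V act \<and>
    (\<exists>v. v \<noteq> \<zero>\<^bsub>V\<^esub> \<and> v \<in> weight_space D V act \<Lambda> \<and>
      (\<forall>i\<in>ind D. act (km_elem D (E i)) v = \<zero>\<^bsub>V\<^esub>) \<and>
      (\<forall>N. lie_submodule complex_field (km_algebra D) V act N \<and> v \<in> N \<longrightarrow> N = carrier V))"

definition integrability ::
  "('i, 'h::ab_group_add) km_data \<Rightarrow> (complex, 'v) module \<Rightarrow> (('i, 'h) km_elt \<Rightarrow> 'v \<Rightarrow> 'v) \<Rightarrow> 'i set"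
where
  "integrability D V act =
    {i \<in> ind D. \<forall>v\<in>carrier V. \<exists>n. (act (km_elem D (F i)) ^^ n) v = \<zero>\<^bsub>V\<^esub>}"

definition dominant_ind :: "('i, 'h) km_data \<Rightarrow> ('h \<Rightarrow> complex) \<Rightarrow> 'i set" where
  "dominant_ind D \<Lambda> = {i \<in> ind D. \<Lambda> (coroot D i) \<in> \<nat>}"

text \<open>Modules are quantified over with carriers inside a type \<open>'v\<close>, and the following condition
  makes \<open>'v\<close> large enough for this to mean all highest weight modules. Every such module is
  spanned by words in the countably many (or finitely many) products of the \<open>f\<^sub>i\<close> applied to its
  highest weight vector, so it has at most the cardinality of the continuum and has an isomorphic
  copy inside \<open>'v\<close>. Two modules on different types can both be copied into the sum of these types.\<close>

definition large_type :: "'v itself \<Rightarrow> bool" where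
  "large_type _ \<longleftrightarrow> (\<exists>\<iota> :: complex \<Rightarrow> 'v. inj \<iota>)"

end

theory Submission
  imports Defs "HOL-Library.Poly_Mapping" "HOL-Library.Multiset" "HOL-Analysis.Abstract_Topology_2"
begin

text \<open>A highest weight module is the quotient of the free module on words in the \<open>f\<^sub>i\<close> by a subspace
  \<open>N\<close>, and its weights are the \<open>\<lambda> - \<Sum>i\<in>#M. \<alpha>\<^sub>i\<close> for the contents \<open>M\<close> of words outside \<open>N\<close>.

  Let \<open>I\<^sub>\<lambda> - J\<close> be complete. Weights in \<open>\<lambda> - \<Sum>i\<notin>J. \<nat> \<alpha>\<^sub>i\<close> all occur: apply powers of the \<open>f\<^sub>i\<close> with
  \<open>i \<in> I\<^sub>\<lambda> - J\<close> in order of decreasing exponents, so that each \<open>\<alpha>\<^sub>i\<close>-string is long enough. A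
  \<open>J\<close>-dominant weight \<open>\<lambda> - \<alpha>\<close> of one module is a weight of the other one: take \<open>\<beta> \<le> \<alpha>\<close> maximal with
  \<open>\<lambda> - \<beta>\<close> a weight of the latter and with the same coefficients as \<open>\<alpha>\<close> outside \<open>J\<close>. If \<open>\<beta> \<noteq> \<alpha>\<close>, comparing
  \<open>\<beta>\<close> with \<open>\<alpha> - \<beta>\<close> on the support of \<open>\<alpha> - \<beta>\<close> yields a set \<open>Z \<subseteq> J\<close> orthogonal to \<open>\<lambda>\<close> and to the rest
  of the support of \<open>\<alpha>\<close>; moving letters of \<open>Z\<close> to the right shows
  that every word of content \<open>\<alpha>\<close> vanishes, a contradiction. Reflections in \<open>J\<close> reduce the general
  case to this one.

  If \<open>a\<close> and \<open>b\<close> in \<open>I\<^sub>\<lambda> - J\<close> are orthogonal, then \<open>f\<^sub>a\<close> and \<open>f\<^sub>b\<close> commute. The parabolic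
  Verma module of \<open>J\<close> and its quotient by the singular vector \<open>f\<^sub>a\<^bsup>m\<^esup> f\<^sub>b\<^bsup>n\<^esup> v\<close>, where \<open>m = \<langle>\<alpha>\<^sub>a\<^sup>\<or>, \<lambda>\<rangle> + 1\<close> and \<open>n = \<langle>\<alpha>\<^sub>b\<^sup>\<or>, \<lambda>\<rangle> + 1\<close>, have integrability \<open>J\<close>, and the
  weight of that vector occurs in the first one only.\<close>


section \<open>The free Verma module\<close>

abbreviation "lookup \<equiv> Poly_Mapping.lookup"
abbreviation "keys \<equiv> Poly_Mapping.keys"

section \<open>Finitely supported functions as a vector space with a basis, and linear
  extension\<close>

definition scl :: "complex \<Rightarrow> ('a \<Rightarrow>\<^sub>0 complex) \<Rightarrow> ('a \<Rightarrow>\<^sub>0 complex)" where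
  "scl c = Poly_Mapping.map ((*) c)"

lemma lookup_scl: "lookup (scl c x) w = c * lookup x w"
  by (simp add: scl_def map.rep_eq when_def)

interpretation pm: vector_space "scl :: complex \<Rightarrow> ('a \<Rightarrow>\<^sub>0 complex) \<Rightarrow> _"
  by unfold_locales (auto intro!: poly_mapping_eqI simp: lookup_scl lookup_add algebra_simps)

lemma keys_scl: "keys (scl c x) \<subseteq> keys x"
  by (auto simp: in_keys_iff lookup_scl)

abbreviation word :: "'a \<Rightarrow> 'a \<Rightarrow>\<^sub>0 complex" where
  "word w \<equiv> Poly_Mapping.single w 1"

lemma scl_word: "scl c (word w) = Poly_Mapping.single w c"
  by (rule poly_mapping_eqI) (simp add: lookup_scl lookup_single when_def)

lemma expand_words: "x = (\<Sum>w\<in>keys x. scl (lookup x w) (word w))"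
  by (rule poly_mapping_eqI)
    (simp add: scl_word lookup_sum lookup_single when_def in_keys_iff)

lemma words_induct [case_names word scl add]:
  assumes "\<And>w. P (word w)" "\<And>c x. P x \<Longrightarrow> P (scl c x)" "\<And>x y. P x \<Longrightarrow> P y \<Longrightarrow> P (x + y)"
  shows "P x"
proof -
  have 0: "P 0" using assms(2)[of _ 0] assms(1) by force
  have "P (\<Sum>w\<in>S. scl (lookup x w) (word w))" if "finite S" for S
    using that by induction (auto intro: assms 0)
  then show ?thesis using expand_words[of x] by (metis finite_keys)
qed

definition lin :: "('a \<Rightarrow> 'b \<Rightarrow>\<^sub>0 complex) \<Rightarrow> ('a \<Rightarrow>\<^sub>0 complex) \<Rightarrow> ('b \<Rightarrow>\<^sub>0 complex)" where
  "lin \<phi> x = (\<Sum>w\<in>keys x. scl (lookup x w) (\<phi> w))"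

lemma lin_superset:
  assumes "finite S" "keys x \<subseteq> S"
  shows "lin \<phi> x = (\<Sum>w\<in>S. scl (lookup x w) (\<phi> w))"
  unfolding lin_def using assms by (intro sum.mono_neutral_left) (auto simp: in_keys_iff)

lemma lin_add: "lin \<phi> (x + y) = lin \<phi> x + lin \<phi> y"
proof -
  let ?S = "keys x \<union> keys y"
  have "keys (x + y) \<subseteq> ?S" by (rule keys_add)
  then show ?thesis
    by (simp add: lin_superset[of ?S] lookup_add pm.scale_left_distrib sum.distrib)
qed

lemma lin_scl: "lin \<phi> (scl c x) = scl c (lin \<phi> x)"
  using keys_scl[of c x]
  by (simp add: lin_superset[of "keys x"] lookup_scl pm.scale_sum_right)

lemma lin_word: "lin \<phi> (word w) = \<phi> w"
  by (simp add: lin_def)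

text \<open>A word stands for a product of the \<open>f_i\<close> applied to the highest weight
  vector, its leftmost letter acting last.\<close>

definition fop :: "'i \<Rightarrow> ('i list \<Rightarrow>\<^sub>0 complex) \<Rightarrow> ('i list \<Rightarrow>\<^sub>0 complex)" where
  "fop i = lin (\<lambda>w. word (i # w))"

text \<open>The Cartan subalgebra acts by such operators, with \<open>g\<close> depending only on
  the content of a word.\<close>

definition diag :: "('a \<Rightarrow> complex) \<Rightarrow> ('a \<Rightarrow>\<^sub>0 complex) \<Rightarrow> ('a \<Rightarrow>\<^sub>0 complex)" where
  "diag g = lin (\<lambda>w. scl (g w) (word w))"

lemma fop_simps [simp]:
  "fop i (x + y) = fop i x + fop i y" "fop i (scl c x) = scl c (fop i x)"
  "fop i (word w) = word (i # w)"
  by (simp_all add: fop_def lin_add lin_scl lin_word)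

lemma diag_simps [simp]:
  "diag g (x + y) = diag g x + diag g y" "diag g (scl c x) = scl c (diag g x)"
  "diag g (word w) = scl (g w) (word w)"
  by (simp_all add: diag_def lin_add lin_scl lin_word)

lemma lookup_diag: "lookup (diag g x) w = g w * lookup x w"
  by (induction x rule: words_induct)
    (simp_all add: lookup_scl lookup_add lookup_single when_def algebra_simps)

lemma additive_zero_diff:
  fixes g :: "('a \<Rightarrow>\<^sub>0 complex) \<Rightarrow> ('b \<Rightarrow>\<^sub>0 complex)"
  assumes "\<And>x y. g (x + y) = g x + g y"
  shows "g 0 = 0" "g (- x) = - g x" "g (x - y) = g x - g y"
proof -
  show z: "g 0 = 0" using assms[of 0 0] by simp
  show m: "g (- x) = - g x" for x using assms[of x "- x"] z by (simp add: minus_unique)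
  show "g (x - y) = g x - g y" using assms[of x "- y"] m by simp
qed

lemmas fop_zero_diff [simp] = additive_zero_diff[of "fop i" for i, OF fop_simps(1)]
lemmas diag_zero_diff [simp] = additive_zero_diff[of "diag g" for g, OF diag_simps(1)]

text \<open>The space of weight \<open>\<lambda> - \<Sum>i\<in>#M. \<alpha>\<^sub>i\<close>.\<close>

definition cspace :: "'i multiset \<Rightarrow> ('i list \<Rightarrow>\<^sub>0 complex) set" where
  "cspace M = {x. \<forall>w\<in>keys x. mset w = M}"

lemma subspace_cspace: "pm.subspace (cspace M)"
  unfolding pm.subspace_def cspace_def using keys_add keys_scl by fastforce

lemma cspace_zero [simp, intro]: "0 \<in> cspace M"
  and cspace_add [intro]: "x \<in> cspace M \<Longrightarrow> y \<in> cspace M \<Longrightarrow> x + y \<in> cspace M"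
  and cspace_scl [intro]: "x \<in> cspace M \<Longrightarrow> scl c x \<in> cspace M"
  using subspace_cspace[of M] by (auto simp: pm.subspace_def)

lemma word_cspace [simp]: "word w \<in> cspace M \<longleftrightarrow> mset w = M"
  by (simp add: cspace_def)

lemma cspace_induct [consumes 1, case_names zero word scl add]:
  assumes "x \<in> cspace M" "P 0" "\<And>w. mset w = M \<Longrightarrow> P (word w)"
    "\<And>c x. P x \<Longrightarrow> P (scl c x)" "\<And>x y. P x \<Longrightarrow> P y \<Longrightarrow> P (x + y)"
  shows "P x"
proof -
  have "P (\<Sum>w\<in>S. scl (lookup x w) (word w))" if "finite S" "S \<subseteq> keys x" for S
    using that by induction (use assms in \<open>auto simp: cspace_def\<close>)
  then show ?thesis using expand_words[of x] by (metis finite_keys order_refl)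
qed

lemma diag_cspace: "x \<in> cspace M \<Longrightarrow> diag (\<lambda>w. \<phi> (mset w)) x = scl (\<phi> M) x"
  by (induction rule: cspace_induct) (auto simp: pm.scale_right_distrib mult.commute)

lemma fop_cspace: "x \<in> cspace M \<Longrightarrow> fop i x \<in> cspace (add_mset i M)"
  by (induction rule: cspace_induct) auto

lemma fop_pow_cspace: "x \<in> cspace M \<Longrightarrow> (fop i ^^ n) x \<in> cspace (M + replicate_mset n i)"
  by (induction n) (auto dest: fop_cspace)

lemma fop_pow_word: "(fop i ^^ n) (word w) = word (replicate n i @ w)"
  by (induction n) auto

text \<open>Verma module of the Lie algebra with the relations of a Kac--Moody algebra other than the
  Serre relations; \<open>l i\<close> stands for \<open>\<langle>\<alpha>\<^sub>i\<^sup>\<or>, \<lambda>\<rangle>\<close>.\<close>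

locale free_verma =
  fixes A :: "'i \<Rightarrow> 'i \<Rightarrow> int" and l :: "'i \<Rightarrow> complex"
begin

text \<open>The value of the weight \<open>\<lambda> - \<Sum>k\<in>#M. \<alpha>_k\<close> on the
  \<open>i\<close>-th simple coroot.\<close>

definition cw :: "'i \<Rightarrow> 'i multiset \<Rightarrow> complex" where
  "cw i M = l i - (\<Sum>k\<in>#M. of_int (A i k))"

lemma cw_simps [simp]:
  "cw i {#} = l i" "cw i (add_mset j M) = cw i M - of_int (A i j)"
  by (simp_all add: cw_def)

lemma cw_plus: "cw i (M + M') = cw i M - (\<Sum>k\<in>#M'. of_int (A i k))"
  by (simp add: cw_def)

abbreviation hop :: "'i \<Rightarrow> ('i list \<Rightarrow>\<^sub>0 complex) \<Rightarrow> ('i list \<Rightarrow>\<^sub>0 complex)" where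
  "hop i \<equiv> diag (\<lambda>w. cw i (mset w))"

text \<open>The recursion is forced by \<open>[e_i, f_j] = \<delta>_ij h_i\<close> and by
  \<open>e_i\<close> killing the highest weight vector.\<close>

primrec ew :: "'i \<Rightarrow> 'i list \<Rightarrow> ('i list \<Rightarrow>\<^sub>0 complex)" where
  "ew i [] = 0"
| "ew i (j # w) = fop j (ew i w) + (if i = j then hop i (word w) else 0)"

definition eop :: "'i \<Rightarrow> ('i list \<Rightarrow>\<^sub>0 complex) \<Rightarrow> ('i list \<Rightarrow>\<^sub>0 complex)" where
  "eop i = lin (ew i)"

lemma eop_simps [simp]:
  "eop i (x + y) = eop i x + eop i y" "eop i (scl c x) = scl c (eop i x)"
  "eop i (word w) = ew i w"
  by (simp_all add: eop_def lin_add lin_scl lin_word)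

lemmas eop_zero_diff [simp] = additive_zero_diff[of "eop i" for i, OF eop_simps(1)]

lemma eop_fop: "eop i (fop j x) = fop j (eop i x) + (if i = j then hop i x else 0)"
  by (induction x rule: words_induct) (auto simp: algebra_simps pm.scale_right_distrib)

lemma hop_fop: "hop i (fop j x) = fop j (hop i x) - scl (of_int (A i j)) (fop j x)"
proof (induction x rule: words_induct)
  case (scl c x)
  then show ?case by (simp add: pm.scale_right_diff_distrib mult.commute)
qed (simp_all add: pm.scale_left_diff_distrib pm.scale_right_distrib)

lemma hop_eop: "hop i (eop j x) = eop j (hop i x) + scl (of_int (A i j)) (eop j x)"
proof (induction x rule: words_induct)
  case (word w)
  show ?case
  proof (induction w)
    case (Cons k w)
    have "hop i (ew j (k # w)) = hop i (fop k (ew j w)) + (if j = k then scl (cw j (mset w) * cw i (mset w)) (word w) else 0)"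
      by simp
    also have "\<dots> = fop k (hop i (ew j w)) - scl (of_int (A i k)) (fop k (ew j w))
       + (if j = k then scl (cw j (mset w) * cw i (mset w)) (word w) else 0)"
      by (simp add: hop_fop)
    also have "\<dots> = fop k (scl (cw i (mset w) + of_int (A i j)) (ew j w)) - scl (of_int (A i k)) (fop k (ew j w))
       + (if j = k then scl (cw j (mset w) * cw i (mset w)) (word w) else 0)"
      using Cons.IH by (simp add: pm.scale_left_distrib)
    finally show ?case
      by (auto simp: pm.scale_left_distrib pm.scale_right_distrib algebra_simps pm.scale_left_diff_distrib)
  qed simp
next
  case (scl c x)
  then show ?case by (simp add: pm.scale_right_distrib mult.commute)
qed (simp add: pm.scale_right_distrib)

text \<open>Passing through the word, \<open>e_i\<close> can only cancel against a letter
  \<open>i\<close>. Multiset subtraction is truncated and does not record the absence of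
  \<open>i\<close>, hence the second conjunct.\<close>

lemma ew_cspace: "ew i w \<in> cspace (mset w - {#i#}) \<and> (i \<notin> set w \<longrightarrow> ew i w = 0)"
proof (induction w)
  case (Cons j w)
  show ?case
  proof (cases "i \<in> set w")
    case True
    then have "fop j (ew i w) \<in> cspace (mset (j # w) - {#i#})"
      using Cons fop_cspace[of "ew i w" "mset w - {#i#}" j] by (simp add: add_mset_diff_bothsides)
    moreover have "hop i (word w) \<in> cspace (mset (j # w) - {#i#})" if "i = j"
      using that by (auto intro!: cspace_scl)
    ultimately show ?thesis using True by auto
  next
    case False
    then show ?thesis using Cons by auto
  qed
qed (simp add: cspace_def)

lemma eop_cspace: "x \<in> cspace M \<Longrightarrow> eop i x \<in> cspace (M - {#i#})"
  by (induction rule: cspace_induct)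
    (use ew_cspace in auto)

lemma eop_cspace_zero: "x \<in> cspace M \<Longrightarrow> i \<notin># M \<Longrightarrow> eop i x = 0"
  by (induction rule: cspace_induct) (use ew_cspace in auto)

lemma eop_pow_cspace: "x \<in> cspace M \<Longrightarrow> (eop i ^^ n) x \<in> cspace (M - replicate_mset n i)"
proof (induction n)
  case (Suc n)
  then show ?case using eop_cspace[of "(eop i ^^ n) x" "M - replicate_mset n i" i]
    by (simp add: diff_diff_add_mset)
qed simp

text \<open>Each application of \<open>e_i\<close> uses up one letter \<open>i\<close>.\<close>

lemma eop_pow_cspace_zero:
  assumes "x \<in> cspace M" "count M i < n"
  shows "(eop i ^^ n) x = 0"
proof -
  obtain m where n: "n = m + Suc (count M i)" using assms(2)
    by (metis add.commute less_iff_Suc_add add_Suc_right)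
  have "i \<notin># M - replicate_mset (count M i) i" by (simp add: not_in_iff)
  then have "(eop i ^^ Suc (count M i)) x = 0"
    using eop_cspace_zero[OF eop_pow_cspace[OF assms(1)]] by simp
  moreover have "(eop i ^^ m) 0 = 0" for m by (induction m) auto
  ultimately show ?thesis unfolding n funpow_add o_def by (simp only:)
qed

lemma pow_linear [simp]:
  "(fop i ^^ n) (scl c x) = scl c ((fop i ^^ n) x)" "(fop i ^^ n) (x + y) = (fop i ^^ n) x + (fop i ^^ n) y"
  "(eop i ^^ n) (scl c x) = scl c ((eop i ^^ n) x)" "(eop i ^^ n) (x + y) = (eop i ^^ n) x + (eop i ^^ n) y"
  by (induction n) auto

section \<open>Commutation formulas of \<open>sl_2\<close> for powers of \<open>e_i\<close> and
  \<open>f_i\<close>\<close>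

lemma hop_fop_pow:
  assumes "A i i = 2" "hop i x = scl c x"
  shows "hop i ((fop i ^^ n) x) = scl (c - 2 * of_nat n) ((fop i ^^ n) x)"
proof (induction n)
  case (Suc n)
  then have "hop i ((fop i ^^ Suc n) x) =
    scl (c - 2 * of_nat n) ((fop i ^^ Suc n) x) - scl 2 ((fop i ^^ Suc n) x)"
    using assms by (simp add: hop_fop)
  also have "\<dots> = scl (c - 2 * of_nat (Suc n)) ((fop i ^^ Suc n) x)"
    unfolding pm.scale_left_diff_distrib[symmetric] by (rule arg_cong2[of _ _ _ _ scl]) auto
  finally show ?case .
qed (use assms in simp)

lemma hop_eop_pow:
  assumes "A i i = 2" "hop i x = scl c x"
  shows "hop i ((eop i ^^ n) x) = scl (c + 2 * of_nat n) ((eop i ^^ n) x)"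
proof (induction n)
  case (Suc n)
  then have "hop i ((eop i ^^ Suc n) x) =
    scl (c + 2 * of_nat n) ((eop i ^^ Suc n) x) + scl 2 ((eop i ^^ Suc n) x)"
    using assms by (simp add: hop_eop)
  also have "\<dots> = scl (c + 2 * of_nat (Suc n)) ((eop i ^^ Suc n) x)"
    unfolding pm.scale_left_distrib[symmetric] by (rule arg_cong2[of _ _ _ _ scl]) auto
  finally show ?case .
qed (use assms in simp)

text \<open>The identity \<open>[e, f^(n+1)] = (n+1) f^n (h - n)\<close> on an eigenvector of
  \<open>h\<close>. Zeros of the coefficient mark the ends of strings.\<close>

lemma eop_fop_pow:
  assumes "A i i = 2" "hop i x = scl c x"
  shows "eop i ((fop i ^^ Suc n) x) =
    (fop i ^^ Suc n) (eop i x) + scl (of_nat (Suc n) * (c - of_nat n)) ((fop i ^^ n) x)"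
proof (induction n)
  case 0
  then show ?case using assms by (simp add: eop_fop)
next
  case (Suc n)
  have "eop i ((fop i ^^ Suc (Suc n)) x) =
    fop i (eop i ((fop i ^^ Suc n) x)) + hop i ((fop i ^^ Suc n) x)"
    by (simp add: eop_fop)
  also have "\<dots> = (fop i ^^ Suc (Suc n)) (eop i x)
    + (scl (of_nat (Suc n) * (c - of_nat n)) ((fop i ^^ Suc n) x)
    + scl (c - 2 * of_nat (Suc n)) ((fop i ^^ Suc n) x))"
    unfolding Suc.IH hop_fop_pow[OF assms] by simp
  also have "\<dots> = (fop i ^^ Suc (Suc n)) (eop i x)
    + scl (of_nat (Suc (Suc n)) * (c - of_nat (Suc n))) ((fop i ^^ Suc n) x)"
    unfolding pm.scale_left_distrib[symmetric] by (simp add: algebra_simps)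
  finally show ?case .
qed

text \<open>The mirror image of \<open>eop_fop_pow\<close>, for climbing instead of
  descending.\<close>

lemma fop_eop_pow:
  assumes "A i i = 2" "hop i x = scl c x"
  shows "fop i ((eop i ^^ Suc n) x) =
    (eop i ^^ Suc n) (fop i x) - scl (of_nat (Suc n) * (c + of_nat n)) ((eop i ^^ n) x)"
proof (induction n)
  case 0
  then show ?case using assms by (simp add: eop_fop)
next
  case (Suc n)
  have "fop i ((eop i ^^ Suc (Suc n)) x) =
    eop i (fop i ((eop i ^^ Suc n) x)) - hop i ((eop i ^^ Suc n) x)"
    by (simp add: eop_fop)
  also have "\<dots> = (eop i ^^ Suc (Suc n)) (fop i x)
    - (scl (of_nat (Suc n) * (c + of_nat n)) ((eop i ^^ Suc n) x)
    + scl (c + 2 * of_nat (Suc n)) ((eop i ^^ Suc n) x))"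
    unfolding Suc.IH hop_eop_pow[OF assms] by simp
  also have "\<dots> = (eop i ^^ Suc (Suc n)) (fop i x)
    - scl (of_nat (Suc (Suc n)) * (c + of_nat (Suc n))) ((eop i ^^ Suc n) x)"
    unfolding pm.scale_left_distrib[symmetric] by (simp add: algebra_simps)
  finally show ?case .
qed

text \<open>The operator \<open>(ad f_i)^n f_j\<close>.\<close>

primrec serre :: "nat \<Rightarrow> 'i \<Rightarrow> 'i \<Rightarrow> ('i list \<Rightarrow>\<^sub>0 complex) \<Rightarrow> ('i list \<Rightarrow>\<^sub>0 complex)" where
  "serre 0 i j x = fop j x"
| "serre (Suc n) i j x = fop i (serre n i j x) - serre n i j (fop i x)"

lemma serre_linear [simp]:
  "serre n i j (x + y) = serre n i j x + serre n i j y"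
  "serre n i j (scl c x) = scl c (serre n i j x)"
  by (induction n arbitrary: x y) (simp_all add: pm.scale_right_diff_distrib)

lemmas serre_zero_diff [simp] = additive_zero_diff[of "serre n i j" for n i j, OF serre_linear(1)]

end

section \<open>Ideals of the free Verma module\<close>

text \<open>Finds the end of a string: \<open>g\<close> will be \<open>e_i\<close> or
  \<open>f_i\<close>, and \<open>S\<close> an ideal.\<close>

lemma last_power_outside:
  assumes "x \<notin> S" "(g ^^ m) x \<in> S"
  obtains k where "k < m" "(g ^^ k) x \<notin> S" "(g ^^ Suc k) x \<in> S"
proof -
  have "\<exists>k<m. (g ^^ k) x \<notin> S \<and> (g ^^ Suc k) x \<in> S"
    using assms(2)
  proof (induction m)
    case (Suc m)
    then show ?case by (cases "(g ^^ m) x \<in> S") (auto intro: less_SucI)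
  qed (use assms(1) in auto)
  then show thesis using that by blast
qed

lemma foldr_fop_linear [simp]:
  "foldr fop u (x + y) = foldr fop u x + foldr fop u y"
  "foldr fop u (scl c x) = scl c (foldr fop u x)"
  by (induction u) auto

lemmas foldr_fop_zero_diff [simp] = additive_zero_diff[of "foldr fop u" for u, OF foldr_fop_linear(1)]

lemma foldr_fop_word: "foldr fop u (word w) = word (u @ w)"
  by (induction u) auto

lemma sum_mset_count:
  assumes "finite S" "set_mset M \<subseteq> S"
  shows "(\<Sum>k\<in>#M. f k) = (\<Sum>k\<in>S. of_nat (count M k) * (f k :: 'b :: comm_semiring_1))"
  using assms(2)
proof (induction M)
  case (add x M)
  have "(\<Sum>k\<in>S. of_nat (count (add_mset x M) k) * f k)
      = (\<Sum>k\<in>S. of_nat (count M k) * f k + (if k = x then f k else 0))"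
    by (intro sum.cong) (auto simp: algebra_simps)
  with add assms(1) show ?case by (simp add: sum.distrib add.commute)
qed simp

locale km_matrix = free_verma A l
  for A :: "'i \<Rightarrow> 'i \<Rightarrow> int" and l :: "'i \<Rightarrow> complex" +
  fixes I :: "'i set"
  assumes A_diag: "i \<in> I \<Longrightarrow> A i i = 2"
    and A_off: "i \<in> I \<Longrightarrow> j \<in> I \<Longrightarrow> i \<noteq> j \<Longrightarrow> A i j \<le> 0"
    and A_zero_sym: "i \<in> I \<Longrightarrow> j \<in> I \<Longrightarrow> A i j = 0 \<Longrightarrow> A j i = 0"
begin

lemma cw_int: "cw i M = l i - of_int (\<Sum>k\<in>#M. A i k)"
  by (induction M) auto

text \<open>\<open>Z\<close> is the set where \<open>u / w\<close> attains its minimum.\<close>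

lemma zero_block:
  fixes u w :: "'i \<Rightarrow> real"
  assumes T: "finite T" "T \<noteq> {}" "T \<subseteq> I"
    and w: "\<And>k. k \<in> T \<Longrightarrow> w k > 0"
    and Aw: "\<And>i. i \<in> T \<Longrightarrow> (\<Sum>k\<in>T. of_int (A i k) * w k) \<le> 0"
    and u: "\<And>k. k \<in> T \<Longrightarrow> u k \<ge> 0"
    and Au: "\<And>i. i \<in> T \<Longrightarrow> (\<Sum>k\<in>T. of_int (A i k) * u k) \<ge> 0"
  obtains Z
    where "Z \<subseteq> T" "Z \<noteq> {}" "\<And>i k. i \<in> Z \<Longrightarrow> k \<in> T - Z \<Longrightarrow> A i k = 0"
    "\<And>i. i \<in> Z \<Longrightarrow> (\<Sum>k\<in>T. of_int (A i k) * u k) = 0"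
proof -
  define t where "t = Min ((\<lambda>k. u k / w k) ` T)"
  define Z where "Z = {k \<in> T. u k = t * w k}"
  have le: "t * w k \<le> u k" if "k \<in> T" for k
  proof -
    have "t \<le> u k / w k" unfolding t_def using T that by (intro Min_le) auto
    then show ?thesis using w[OF that] by (simp add: pos_le_divide_eq)
  qed
  have "t \<in> (\<lambda>k. u k / w k) ` T" unfolding t_def using T by (intro Min_in) auto
  then obtain k0 where k0: "k0 \<in> T" "t = u k0 / w k0" by auto
  have "Z \<noteq> {}" using k0 w[of k0] by (auto simp: Z_def)
  have t0: "t \<ge> 0" using k0 w[of k0] u[of k0] by simp
  have main: "(\<forall>k\<in>T - Z. A i k = 0) \<and> (\<Sum>k\<in>T. of_int (A i k) * u k) = 0"
    if i: "i \<in> Z" for i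
  proof -
    have iT: "i \<in> T" using i by (auto simp: Z_def)
    \<comment> \<open>The vector \<open>x = u - t w\<close> vanishes on \<open>Z\<close> and is
      positive on the rest of \<open>T\<close>. Hence each row of \<open>A\<close> in
      \<open>Z\<close> has only nonpositive terms against it, while \<open>Au\<close>,
      \<open>Aw\<close> and \<open>t \<ge> 0\<close> make their sum nonnegative.\<close>
    define x where "x k = u k - t * w k" for k
    have e: "(\<Sum>k\<in>T. of_int (A i k) * x k)
        = (\<Sum>k\<in>T. of_int (A i k) * u k) - t * (\<Sum>k\<in>T. of_int (A i k) * w k)"
      by (simp add: x_def algebra_simps sum_subtractf sum_distrib_left)
    have neg: "of_int (A i k) * x k \<le> 0" if "k \<in> T" for k
    proof (cases "k = i")
      case True
      then show ?thesis using i by (simp add: x_def Z_def)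
    next
      case False
      then have "A i k \<le> 0" using A_off iT T that by auto
      moreover have "x k \<ge> 0" using le[OF that] by (simp add: x_def)
      ultimately show ?thesis by (simp add: mult_le_0_iff)
    qed
    have le0: "(\<Sum>k\<in>T. of_int (A i k) * x k) \<le> 0" by (intro sum_nonpos neg)
    have tw: "t * (\<Sum>k\<in>T. of_int (A i k) * w k) \<le> 0" using t0 Aw[OF iT]
      by (simp add: mult_le_0_iff)
    have s0: "(\<Sum>k\<in>T. of_int (A i k) * x k) = 0"
      and u0: "(\<Sum>k\<in>T. of_int (A i k) * u k) = 0"
      using e le0 tw Au[OF iT] by linarith+
    have "of_int (A i k) * x k = 0" if "k \<in> T" for k
    proof -
      have "(\<Sum>k\<in>T. - (of_int (A i k) * x k)) = 0" using s0 by (simp add: sum_negf)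
      then have "- (of_int (A i k) * x k) = 0"
        using neg T(1) that by (subst (asm) sum_nonneg_eq_0_iff) auto
      then show ?thesis by simp
    qed
    then have "A i k = 0" if "k \<in> T - Z" for k
      using that by (auto simp: Z_def x_def)
    then show ?thesis using u0 by blast
  qed
  show thesis
    by (rule that[of Z]) (use main \<open>Z \<noteq> {}\<close> in \<open>auto simp: Z_def\<close>)
qed

end

text \<open>The properties shared by the kernels of the maps from the free Verma module onto highest
  weight modules. Words range over the whole type, and \<open>bad_N\<close> discards those with
  letters outside \<open>I\<close>.\<close>

locale verma_ideal = km_matrix A l I
  for A :: "'i \<Rightarrow> 'i \<Rightarrow> int" and l :: "'i \<Rightarrow> complex"
    and I :: "'i set" +
  fixes N :: "('i list \<Rightarrow>\<^sub>0 complex) set"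
  assumes subspace_N: "pm.subspace N"
    and fop_N: "x \<in> N \<Longrightarrow> fop i x \<in> N"
    and eop_N: "i \<in> I \<Longrightarrow> x \<in> N \<Longrightarrow> eop i x \<in> N"
    and one_N: "word [] \<notin> N"
    and bad_N: "i \<notin> I \<Longrightarrow> fop i x \<in> N"
    and serre_N: "i \<in> I \<Longrightarrow> j \<in> I \<Longrightarrow> i \<noteq> j \<Longrightarrow> serre (nat (1 - A i j)) i j x \<in> N"
begin

definition wts :: "'i multiset set" where
  "wts = {mset w | w. word w \<notin> N}"

definition integ :: "'i set" where
  "integ = {i \<in> I. \<forall>x. \<exists>n. (fop i ^^ n) x \<in> N}"

lemmas N_zero [simp] = pm.subspace_0[OF subspace_N]
  and N_add = pm.subspace_add[OF subspace_N]
  and N_diff = pm.subspace_diff[OF subspace_N]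
  and N_scl = pm.subspace_scale[OF subspace_N]

lemma N_scl_iff: "c \<noteq> 0 \<Longrightarrow> scl c x \<in> N \<longleftrightarrow> x \<in> N"
  using N_scl[of "scl c x" "inverse c"] N_scl[of x c] by auto

lemma wtsI: "x \<in> cspace M \<Longrightarrow> x \<notin> N \<Longrightarrow> M \<in> wts"
proof (rule ccontr)
  assume a: "x \<in> cspace M" "x \<notin> N" "M \<notin> wts"
  from a(1) have "x \<in> N"
    by (induction rule: cspace_induct) (use a(3) N_add N_scl in \<open>auto simp: wts_def\<close>)
  with a(2) show False by simp
qed

lemma word_wts: "word w \<notin> N \<Longrightarrow> mset w \<in> wts"
  by (auto simp: wts_def)

lemma fop_pow_N: "x \<in> N \<Longrightarrow> (fop i ^^ n) x \<in> N"
  by (induction n) (auto intro: fop_N)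

lemma fop_pow_N_mono: "(fop i ^^ p) x \<in> N \<Longrightarrow> p \<le> r \<Longrightarrow> (fop i ^^ r) x \<in> N"
  using fop_pow_N[of "(fop i ^^ p) x" "r - p" i]
    by (simp flip: funpow_add[THEN fun_cong, unfolded o_apply])

lemma eop_pow_N: "i \<in> I \<Longrightarrow> x \<in> N \<Longrightarrow> (eop i ^^ n) x \<in> N"
  by (induction n) (auto intro: eop_N)

lemma word_bad_N: "\<not> set w \<subseteq> I \<Longrightarrow> word w \<in> N"
proof (induction w)
  case (Cons i w)
  then show ?case using fop_N[of "word w" i] bad_N[of i "word w"] by auto
qed simp

lemma wts_subset: "M \<in> wts \<Longrightarrow> set_mset M \<subseteq> I"
  using word_bad_N by (force simp: wts_def)

section \<open>Strings of weights in the direction of a simple root\<close>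

lemma string_top:
  assumes "i \<in> I" "word w \<notin> N"
  obtains k
    where "k \<le> count (mset w) i" "(eop i ^^ k) (word w) \<notin> N" "(eop i ^^ Suc k) (word w) \<in> N"
proof -
  have "(eop i ^^ Suc (count (mset w) i)) (word w) = 0"
    by (rule eop_pow_cspace_zero[where M = "mset w"]) simp_all
  then have "(eop i ^^ Suc (count (mset w) i)) (word w) \<in> N" by (simp only: N_zero)
  then show thesis using last_power_outside[OF assms(2)] that by (metis less_Suc_eq_le)
qed

text \<open>Climb from a word to the top \<open>y\<close> of its string, \<open>k\<close> steps up,
  where \<open>h_i\<close> has eigenvalue \<open>n + 2k\<close>. By \<open>eop_fop_pow\<close> the
  powers of \<open>f_i\<close> up to \<open>n + 2k\<close> keep \<open>y\<close> outside
  \<open>N\<close>, and this covers \<open>k + j\<close> steps.\<close>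

lemma down_string:
  assumes i: "i \<in> I" and M: "M \<in> wts" and c: "cw i M = of_nat n" and j: "j \<le> n"
  shows "M + replicate_mset j i \<in> wts"
proof -
  obtain w where w: "mset w = M" "word w \<notin> N" using M by (auto simp: wts_def)
  obtain k where k: "k \<le> count M i" "(eop i ^^ k) (word w) \<notin> N" "(eop i ^^ Suc k) (word w) \<in> N"
    using string_top[OF i w(2)] w(1) by metis
  define y where "y = (eop i ^^ k) (word w)"
  have y: "y \<notin> N" "eop i y \<in> N" using k by (auto simp: y_def)
  have hy: "hop i y = scl (of_nat (n + 2 * k)) y"
    unfolding y_def using hop_eop_pow[OF A_diag[OF i], of "word w" "of_nat n" k] w c by simp
  have nz: "(fop i ^^ m) y \<notin> N" if "m \<le> n + 2 * k" for m
    using that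
  proof (induction m)
    case (Suc m)
    show ?case
    proof
      assume "(fop i ^^ Suc m) y \<in> N"
      then have "eop i ((fop i ^^ Suc m) y) - (fop i ^^ Suc m) (eop i y) \<in> N"
        using eop_N[OF i] fop_pow_N[OF y(2)] N_diff by blast
      then have "scl (of_nat (Suc m) * (of_nat (n + 2 * k) - of_nat m)) ((fop i ^^ m) y) \<in> N"
        unfolding eop_fop_pow[OF A_diag[OF i] hy] by (simp only: add_diff_cancel_left')
      moreover have "of_nat (Suc m) * (of_nat (n + 2 * k) - of_nat m) \<noteq> (0 :: complex)"
        using Suc.prems unfolding mult_eq_0_iff right_minus_eq of_nat_eq_iff of_nat_eq_0_iff by simp
      ultimately have "(fop i ^^ m) y \<in> N" using N_scl_iff by blast
      then show False using Suc by simp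
    qed
  qed (use y in simp)
  have "y \<in> cspace (M - replicate_mset k i)" unfolding y_def using w
    by (intro eop_pow_cspace) simp
  then have "(fop i ^^ (k + j)) y \<in> cspace (M - replicate_mset k i + replicate_mset (k + j) i)"
    by (rule fop_pow_cspace)
  moreover have "M - replicate_mset k i + replicate_mset (k + j) i = M + replicate_mset j i"
    using k(1) by (intro multiset_eqI) auto
  ultimately show ?thesis using nz[of "k + j"] j wtsI by auto
qed

text \<open>The argument of \<open>down_string\<close> with \<open>e_i\<close> and
  \<open>f_i\<close> exchanged; integrability provides the bottom of the string.\<close>

lemma up_string:
  assumes i: "i \<in> integ" and M: "M \<in> wts" and c: "cw i M = - of_nat n" and j: "j \<le> n"
  shows "j \<le> count M i \<and> M - replicate_mset j i \<in> wts"
proof -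
  have iI: "i \<in> I" using i by (simp add: integ_def)
  obtain w where w: "mset w = M" "word w \<notin> N" using M by (auto simp: wts_def)
  obtain m where "(fop i ^^ m) (word w) \<in> N" using i by (auto simp: integ_def)
  then obtain k where k: "(fop i ^^ k) (word w) \<notin> N" "(fop i ^^ Suc k) (word w) \<in> N"
    using last_power_outside[OF w(2)] by metis
  define y where "y = (fop i ^^ k) (word w)"
  have y: "y \<notin> N" "fop i y \<in> N" using k by (auto simp: y_def)
  have hy: "hop i y = scl (- of_nat (n + 2 * k)) y"
    unfolding y_def using hop_fop_pow[OF A_diag[OF iI], of "word w" "- of_nat n" k] w c by simp
  have nz: "(eop i ^^ m) y \<notin> N" if "m \<le> n + 2 * k" for m
    using that
  proof (induction m)
    case (Suc m)
    show ?case
    proof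
      assume "(eop i ^^ Suc m) y \<in> N"
      then have "(eop i ^^ Suc m) (fop i y) - fop i ((eop i ^^ Suc m) y) \<in> N"
        using fop_N eop_pow_N[OF iI y(2)] N_diff by blast
      then have "scl (of_nat (Suc m) * (- of_nat (n + 2 * k) + of_nat m)) ((eop i ^^ m) y) \<in> N"
        unfolding fop_eop_pow[OF A_diag[OF iI] hy] by simp
      moreover have "of_nat (Suc m) * (- of_nat (n + 2 * k) + of_nat m) \<noteq> (0 :: complex)"
        using Suc.prems
        unfolding mult_eq_0_iff neg_eq_iff_add_eq_0[symmetric] minus_minus of_nat_eq_iff of_nat_eq_0_iff
        by simp
      ultimately have "(eop i ^^ m) y \<in> N" using N_scl_iff by blast
      then show False using Suc by simp
    qed
  qed (use y in simp)
  have "y \<in> cspace (M + replicate_mset k i)" unfolding y_def using w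
    by (intro fop_pow_cspace) simp
  \<comment> \<open>Truncated subtraction could hide a lack of letters \<open>i\<close>. In that
    case the power of \<open>e_i\<close> would be zero, contrary to \<open>nz\<close>; this yields
    \<open>j \<le> count M i\<close>.\<close>
  then have e: "(eop i ^^ (k + j)) y \<in> cspace (M + replicate_mset k i - replicate_mset (k + j) i)"
    and "count (M + replicate_mset k i) i < k + j \<Longrightarrow> (eop i ^^ (k + j)) y = 0"
    by (rule eop_pow_cspace, rule eop_pow_cspace_zero)
  moreover have "M + replicate_mset k i - replicate_mset (k + j) i = M - replicate_mset j i"
    by (intro multiset_eqI) auto
  moreover have "(eop i ^^ (k + j)) y \<notin> N" using nz[of "k + j"] j by simp
  ultimately show ?thesis using wtsI by (fastforce simp: not_less)
qed

text \<open>Here \<open>f_i\<close> sends a word of content \<open>M\<close> into \<open>N\<close>,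
  and \<open>e_i^(k+1)\<close> does so too for a suitable \<open>k\<close>. Then
  \<open>fop_eop_pow\<close> forces the coefficient \<open>(k+1) (cw i M + k)\<close> to
  vanish.\<close>

lemma string_end:
  assumes i: "i \<in> I" and M: "M \<in> wts" "add_mset i M \<notin> wts"
  obtains n where "cw i M = - of_nat n"
proof -
  obtain w where w: "mset w = M" "word w \<notin> N" using M by (auto simp: wts_def)
  obtain k where k: "(eop i ^^ k) (word w) \<notin> N" "(eop i ^^ Suc k) (word w) \<in> N"
    using string_top[OF i w(2)] w(1) by metis
  have f: "fop i (word w) \<in> N"
    using wtsI[of "fop i (word w)" "add_mset i M"] M(2) w(1) by auto
  have h: "hop i (word w) = scl (cw i M) (word w)" using w by simp
  have "(eop i ^^ Suc k) (fop i (word w)) - fop i ((eop i ^^ Suc k) (word w)) \<in> N"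
    using eop_pow_N[OF i f] fop_N[OF k(2)] by (rule N_diff)
  then have "scl (of_nat (Suc k) * (cw i M + of_nat k)) ((eop i ^^ k) (word w)) \<in> N"
    unfolding fop_eop_pow[OF A_diag[OF i] h] by simp
  then have "of_nat (Suc k) * (cw i M + of_nat k) = 0" using k(1) N_scl_iff by blast
  then have "cw i M = - of_nat k"
    by (metis add_eq_0_iff2 mult_eq_0_iff of_nat_neq_0)
  then show thesis by (rule that)
qed

text \<open>At the step where the powers of \<open>f_i\<close> enter \<open>N\<close>, applying
  \<open>e_i\<close> gives \<open>(k+1) (l i - k) = 0\<close>.\<close>

lemma vacuum_power:
  assumes i: "i \<in> I" and m: "(fop i ^^ m) (word []) \<in> N"
  obtains k where "l i = of_nat k" "(fop i ^^ Suc k) (word []) \<in> N"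
proof -
  obtain k where k: "(fop i ^^ k) (word []) \<notin> N" "(fop i ^^ Suc k) (word []) \<in> N"
    using last_power_outside[OF one_N m] by metis
  have "eop i ((fop i ^^ Suc k) (word [])) - (fop i ^^ Suc k) (eop i (word [])) \<in> N"
    using eop_N[OF i k(2)] by (intro N_diff fop_pow_N) auto
  moreover have h: "hop i (word []) = scl (l i) (word [])" by simp
  ultimately have "scl (of_nat (Suc k) * (l i - of_nat k)) ((fop i ^^ k) (word [])) \<in> N"
    unfolding eop_fop_pow[OF A_diag[OF i] h] by (simp only: add_diff_cancel_left')
  then have "of_nat (Suc k) * (l i - of_nat k) = 0" using k(1) N_scl_iff by blast
  then have "l i = of_nat k"
    by (metis eq_iff_diff_eq_0 mult_eq_0_iff of_nat_neq_0)
  then show thesis using k by (intro that)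
qed

section \<open>Integrability is decided at the highest weight vector\<close>

lemma serre_fop_N: "x \<in> N \<Longrightarrow> serre n i j x \<in> N"
  by (induction n arbitrary: x) (auto intro: fop_N N_diff)

text \<open>Local nilpotency of \<open>f\<^sub>i\<close> propagates because \<open>ad f\<^sub>i\<close> is locally nilpotent by the Serre
  relations.\<close>

lemma nilpotent_serre:
  assumes ij: "i \<in> I" "j \<in> I" "i \<noteq> j"
    and "d \<le> nat (1 - A i j)" "(fop i ^^ n) x \<in> N"
  shows "\<exists>p. (fop i ^^ p) (serre (nat (1 - A i j) - d) i j x) \<in> N"
  using assms(4,5)
\<comment> \<open>Downward induction on the number of commutators, starting from the Serre relation.
  Writing \<open>S_k\<close> for \<open>serre k i j\<close>, the inner induction on \<open>n\<close>
  uses \<open>f_i (S_k x) = S_(k+1) x + S_k (f_i x)\<close>.\<close>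
proof (induction d arbitrary: n x)
  case 0
  then show ?case using serre_N[OF ij, of x] by (intro exI[of _ 0]) simp
next
  case (Suc d)
  let ?k = "nat (1 - A i j) - Suc d"
  have k: "nat (1 - A i j) - d = Suc ?k" using Suc.prems by simp
  note outer = Suc.IH and d = Suc.prems(1)
  from Suc.prems(2) show ?case
  proof (induction n arbitrary: x)
    case 0
    then show ?case by (intro exI[of _ 0]) (simp add: serre_fop_N)
  next
    case (Suc n)
    have "(fop i ^^ n) (fop i x) \<in> N" using Suc.prems by (simp add: funpow_swap1)
    then obtain p where p: "(fop i ^^ p) (serre ?k i j (fop i x)) \<in> N" using Suc.IH by blast
    obtain q where q: "(fop i ^^ q) (serre (Suc ?k) i j x) \<in> N"
      using outer[OF _ Suc.prems] d k by auto
    have "(fop i ^^ (p + q)) (serre (Suc ?k) i j x) \<in> N" "(fop i ^^ (p + q)) (serre ?k i j (fop i x)) \<in> N"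
      using fop_pow_N_mono[OF q] fop_pow_N_mono[OF p] by simp_all
    then have "(fop i ^^ (p + q)) (serre (Suc ?k) i j x) + (fop i ^^ (p + q)) (serre ?k i j (fop i x)) \<in> N"
      by (rule N_add)
    then have "(fop i ^^ (p + q)) (serre (Suc ?k) i j x + serre ?k i j (fop i x)) \<in> N"
      by (simp only: pow_linear)
    then have "(fop i ^^ Suc (p + q)) (serre ?k i j x) \<in> N" by (simp add: funpow_swap1)
    then show ?case by blast
  qed
qed

text \<open>Nilpotency spreads from the highest weight vector by induction on words. Prepending a
  letter \<open>j \<noteq> i\<close> of \<open>I\<close> is the case
  \<open>d = nat (1 - A i j)\<close> of \<open>nilpotent_serre\<close>, where the Serre operator is
  \<open>f_j\<close> itself.\<close>

lemma integ_iff_vacuum: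
  assumes i: "i \<in> I"
  shows "i \<in> integ \<longleftrightarrow> (\<exists>n. (fop i ^^ n) (word []) \<in> N)"
proof
  assume v: "\<exists>n. (fop i ^^ n) (word []) \<in> N"
  have st: "\<exists>n. (fop i ^^ n) (fop j x) \<in> N" if nil: "\<exists>n. (fop i ^^ n) x \<in> N"
    for j x
  proof -
    from nil obtain n where n: "(fop i ^^ n) x \<in> N" ..
    consider "j = i" | "j \<notin> I" | "j \<in> I" "j \<noteq> i" by blast
    then show ?thesis
    proof cases
      case 1
      then show ?thesis using fop_N[OF n, of i] by (intro exI[of _ n]) (simp add: funpow_swap1)
    next
      case 2
      then show ?thesis using bad_N by (intro exI[of _ 0]) simp
    next
      case 3
      then show ?thesis using nilpotent_serre[OF i, of j "nat (1 - A i j)" n x] n by auto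
    qed
  qed
  have "\<exists>n. (fop i ^^ n) x \<in> N" for x
  proof (induction x rule: words_induct)
    case (word w)
    show ?case
    proof (induction w)
      case (Cons j w)
      then show ?case using st[of "word w" j] by simp
    qed (rule v)
  next
    case (scl c x)
    then show ?case using N_scl by auto
  next
    case (add x y)
    then obtain p q where p: "(fop i ^^ p) x \<in> N" and q: "(fop i ^^ q) y \<in> N" by blast
    have "(fop i ^^ (p + q)) x \<in> N" "(fop i ^^ (p + q)) y \<in> N"
      using fop_pow_N_mono[OF p] fop_pow_N_mono[OF q] by simp_all
    then show ?case by (intro exI[of _ "p + q"]) (simp add: N_add)
  qed
  then show "i \<in> integ" using i by (simp add: integ_def)
qed (auto simp: integ_def)

lemma integ_dominant:
  assumes "i \<in> integ"
  shows "l i \<in> \<nat>"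
proof -
  have i: "i \<in> I" using assms by (simp add: integ_def)
  obtain n where "(fop i ^^ n) (word []) \<in> N" using assms integ_iff_vacuum[OF i] by blast
  then show ?thesis using vacuum_power[OF i] by (metis of_nat_in_Nats)
qed

lemma integ_zero:
  assumes "i \<in> integ" "l i = 0"
  shows "word [i] \<in> N"
proof -
  have iI: "i \<in> I" using assms by (simp add: integ_def)
  obtain n where "(fop i ^^ n) (word []) \<in> N" using assms integ_iff_vacuum[OF iI] by blast
  then obtain k where "l i = of_nat k" "(fop i ^^ Suc k) (word []) \<in> N"
    using vacuum_power[OF iI] by metis
  then show ?thesis using assms by simp
qed

section \<open>Words that vanish by orthogonality, and contents avoiding the integrable
  letters\<close>

lemma commute_N:
  assumes "i \<in> I" "j \<in> I" "i \<noteq> j" "A i j = 0"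
  shows "fop i (fop j x) - fop j (fop i x) \<in> N"
  \<comment> \<open>The Serre relation has exponent 1 here, so it is a plain commutator.\<close>
  using serre_N[OF assms(1-3), of x] assms(4) by simp

lemma commute_word_N:
  assumes "i \<in> I" "j \<in> I" "i \<noteq> j" "A i j = 0" "word (j # i # w) \<in> N"
  shows "word (i # j # w) \<in> N"
  using N_add[OF commute_N[OF assms(1-4), of "word w"] assms(5)] by simp

text \<open>The rightmost letter from \<open>Z\<close> commutes with all letters to its right, so it
  can be moved to the highest weight vector, which it kills by \<open>integ_zero\<close>.\<close>

lemma vanishing_word:
  assumes "Z \<subseteq> integ" "\<And>i. i \<in> Z \<Longrightarrow> l i = 0" "set w \<inter> Z \<noteq> {}"
    "\<And>i k. i \<in> Z \<Longrightarrow> k \<in> set w - Z \<Longrightarrow> A i k = 0"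
  shows "word w \<in> N"
  using assms(3,4)
proof (induction w)
  case (Cons i w)
  show ?case
  proof (cases "set w \<inter> Z = {}")
    case False
    then have "word w \<in> N" using Cons by simp
    then show ?thesis using fop_N[of "word w" i] by simp
  next
    case True
    then have iZ: "i \<in> Z" using Cons.prems by auto
    have iI: "i \<in> I" using iZ assms(1) by (auto simp: integ_def)
    have "word (i # v) \<in> N" if "set v \<subseteq> set w" for v
      using that
    proof (induction v)
      case Nil
      then show ?case using integ_zero assms(1,2) iZ by auto
    next
      case (Cons j v)
      then have j: "A i j = 0" "i \<noteq> j"
        using \<open>\<And>i k. i \<in> Z \<Longrightarrow> k \<in> set (_ # w) - Z \<Longrightarrow> A i k = 0\<close>[OF iZ, of j] True iZ by auto
      show ?case
      proof (cases "j \<in> I")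
        case True
        have "word (j # i # v) \<in> N" using fop_N[of "word (i # v)" j] Cons by simp
        then show ?thesis using commute_word_N[OF iI True j(2,1)] by simp
      qed (auto intro: word_bad_N)
    qed
    then show ?thesis by simp
  qed
qed simp

lemma eop_foldr_fop: "i \<notin> set u \<Longrightarrow> eop i (foldr fop u x) = foldr fop u (eop i x)"
  by (induction u) (auto simp: eop_fop)

text \<open>Since \<open>i\<close> does not occur in \<open>u\<close>, \<open>e_i\<close> passes
  through \<open>u\<close> and strips one letter \<open>i\<close> from the end, with the factor
  \<open>(k+1) (l i - k)\<close>, which is nonzero for \<open>l i \<notin> \<nat>\<close>.\<close>

lemma append_nondominant:
  assumes i: "i \<in> I" "l i \<notin> \<nat>" "i \<notin> set u" and u: "word u \<notin> N"
  shows "word (u @ replicate k i) \<notin> N"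
proof (induction k)
  case (Suc k)
  show ?case
  proof
    assume "word (u @ replicate (Suc k) i) \<in> N"
    then have "foldr fop u ((fop i ^^ Suc k) (word [])) \<in> N"
      by (simp only: fop_pow_word foldr_fop_word append_Nil2)
    then have "eop i (foldr fop u ((fop i ^^ Suc k) (word []))) \<in> N" by (rule eop_N[OF i(1)])
    moreover have h: "hop i (word []) = scl (l i) (word [])" by simp
    have "eop i (foldr fop u ((fop i ^^ Suc k) (word []))) =
      foldr fop u (scl (of_nat (Suc k) * (l i - of_nat k)) ((fop i ^^ k) (word [])))"
      unfolding eop_foldr_fop[OF i(3)] eop_fop_pow[OF A_diag[OF i(1)] h]
      using pow_linear(1)[of "Suc k" i 0 0] by simp
    moreover have "\<dots> = scl (of_nat (Suc k) * (l i - of_nat k)) (word (u @ replicate k i))"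
      by (simp only: fop_pow_word foldr_fop_word append_Nil2 foldr_fop_linear)
    ultimately have "scl (of_nat (Suc k) * (l i - of_nat k)) (word (u @ replicate k i)) \<in> N"
      by (simp only:)
    moreover have "of_nat (Suc k) * (l i - of_nat k) \<noteq> 0"
      using i(2) by (metis eq_iff_diff_eq_0 mult_eq_0_iff of_nat_in_Nats of_nat_neq_0)
    ultimately show False using Suc N_scl_iff by blast
  qed
qed (use u in simp)

text \<open>Letters \<open>i\<close> with \<open>l i \<notin> \<nat>\<close> are appended on the right; the others are prepended in order of
  decreasing multiplicity, so that completeness makes each string long enough.\<close>

lemma complete_wts:
  assumes complete: "\<And>i j. i \<in> I - integ \<Longrightarrow> j \<in> I - integ \<Longrightarrow> l i \<in> \<nat> \<Longrightarrow> l j \<in> \<nat> \<Longrightarrow> A i j \<noteq> 0"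
    and "set_mset M \<subseteq> I - integ"
  shows "M \<in> wts"
  using assms(2)
\<comment> \<open>Induction on the number of distinct letters; one letter is split off with its
  whole multiplicity.\<close>
proof (induction M rule: measure_induct_rule[of "\<lambda>M. card (set_mset M)"])
  case (less M)
  show ?case
  proof (cases "M = {#}")
    case True
    then show ?thesis using one_N by (auto simp: wts_def)
  next
    case False
    have split: "filter_mset (\<lambda>k. k \<noteq> i) M + replicate_mset (count M i) i = M" for i
      by (intro multiset_eqI) auto
    have IH: "filter_mset (\<lambda>k. k \<noteq> i) M \<in> wts" if "i \<in># M" for i
      using that less.prems by (intro less.IH) (auto intro!: psubset_card_mono)
    show ?thesis
    proof (cases "\<exists>i\<in>#M. l i \<notin> \<nat>")
      case True
      then obtain i where i: "i \<in># M" "l i \<notin> \<nat>" by blast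
      obtain u where u: "mset u = filter_mset (\<lambda>k. k \<noteq> i) M" "word u \<notin> N"
        using IH[OF i(1)] unfolding wts_def by force
      have "i \<notin> set u" using u(1) by (simp flip: set_mset_mset)
      then have "word (u @ replicate (count M i) i) \<notin> N"
        using append_nondominant[of i u "count M i"] u i less.prems by auto
      moreover have "mset (u @ replicate (count M i) i) = M" using u split[of i] by simp
      ultimately show ?thesis using word_wts by metis
    next
      case dom: False
      \<comment> \<open>A letter of least multiplicity is prepended last.\<close>
      define i where "i = (ARG_MIN (count M) i. i \<in># M)"
      have i: "i \<in># M" "\<And>k. k \<in># M \<Longrightarrow> count M i \<le> count M k"
        using arg_min_nat_lemma[of "\<lambda>i. i \<in># M" _ "count M"] False unfolding i_def
          by auto
      define M' where "M' = filter_mset (\<lambda>k. k \<noteq> i) M"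
      have M': "M' \<in> wts" unfolding M'_def by (rule IH[OF i(1)])
      have iI: "i \<in> I" "i \<notin> integ" using i(1) less.prems by auto
      obtain m where m: "l i = of_nat m" using dom i(1) by (auto elim: Nats_cases)
      show ?thesis
      proof (cases "M' = {#}")
        case True
        then have M: "M = replicate_mset (count M i) i" using split[of i]
          by (simp only: M'_def add_0)
        \<comment> \<open>No other letter lengthens the string here; the powers survive because
          \<open>i\<close> is not integrable.\<close>
        have "(fop i ^^ count M i) (word []) \<notin> N" using iI integ_iff_vacuum by blast
        moreover have "(fop i ^^ count M i) (word []) \<in> cspace M"
          using fop_pow_cspace[of "word []" "{#}" "count M i" i] M by simp
        ultimately show ?thesis using wtsI by blast
      next
        case False
        then obtain j where j: "j \<in># M'" by blast
        have neg: "A i k \<le> -1" if "k \<in># M'" for k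
        proof -
          have k: "k \<in># M" "k \<noteq> i" using that by (auto simp: M'_def)
          then have "A i k \<noteq> 0" using complete[of i k] i(1) less.prems dom by blast
          moreover have "A i k \<le> 0" using A_off[of i k] k i(1) less.prems by auto
          ultimately show ?thesis by simp
        qed
        have bound: "(\<Sum>k\<in>#R. A i k) \<le> - int (size R)" if "R \<subseteq># M'" for R
          using that
        proof (induction R)
          case (add x R)
          have "x \<in># M'" using add.prems by (metis insert_subset_eq_iff)
          moreover have "R \<subseteq># M'" using add.prems
            by (metis mset_subset_eq_insertD subset_mset.less_imp_le)
          ultimately show ?case using add.IH neg[of x] by simp
        qed simp
        \<comment> \<open>The value \<open>n\<close> of the weight on the coroot is at least
          \<open>size M'\<close>, because every letter of \<open>M'\<close> contributes at least 1
          by completeness. So it is at least the multiplicity of \<open>j\<close>, which is at least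
          that of \<open>i\<close>.\<close>
        define n where "n = nat (int m - (\<Sum>k\<in>#M'. A i k))"
        have "count M i \<le> count M' j" using i(2)[of j] j by (auto simp: M'_def)
        also have "\<dots> \<le> size M'" by (rule count_le_size)
        finally have n: "count M i \<le> n" "int n = int m - (\<Sum>k\<in>#M'. A i k)"
          using bound[of M'] unfolding n_def by auto
        have "cw i M' = of_int (int m - (\<Sum>k\<in>#M'. A i k))"
          by (simp add: cw_int m)
        then have "cw i M' = of_nat n" unfolding n(2)[symmetric] by simp
        then have "M' + replicate_mset (count M i) i \<in> wts" using down_string iI(1) M' n(1)
          by blast
        then show ?thesis using split[of i] by (simp add: M'_def)
      qed
    qed
  qed
qed

end

section \<open>Comparison of the weights of two ideals\<close>

locale verma_ideal_pair =
  verma_ideal A l I N + N': verma_ideal A l I N'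
  for A :: "'i \<Rightarrow> 'i \<Rightarrow> int" and l :: "'i \<Rightarrow> complex" and I N N' +
  assumes integ_eq: "N'.integ = integ"
    and complete: "\<And>i j. i \<in> I - integ \<Longrightarrow> j \<in> I - integ \<Longrightarrow> l i \<in> \<nat> \<Longrightarrow> l j \<in> \<nat> \<Longrightarrow> A i j \<noteq> 0"
begin

text \<open>The argument for weights of integrable modules (Kac, Infinite dimensional Lie algebras,
  Proposition 11.2).\<close>

lemma dominant_wts:
  assumes \<alpha>: "\<alpha> \<in> wts"
    and dom: "\<And>i. i \<in> integ \<Longrightarrow> cw i \<alpha> \<in> \<nat>"
  shows "\<alpha> \<in> N'.wts"
proof (rule ccontr)
  assume not: "\<alpha> \<notin> N'.wts"
  have \<alpha>I: "set_mset \<alpha> \<subseteq> I" using wts_subset[OF \<alpha>] .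
  \<comment> \<open>Contents between \<open>\<alpha>0\<close> and \<open>\<alpha>\<close> differ
    from \<open>\<alpha>\<close> only in integrable letters. Completeness makes
    \<open>\<alpha>0\<close> itself a weight of the second module.\<close>
  define \<alpha>0 where "\<alpha>0 = filter_mset (\<lambda>k. k \<notin> integ) \<alpha>"
  have "\<alpha>0 \<in> N'.wts"
    using complete \<alpha>I by (intro N'.complete_wts) (auto simp: integ_eq \<alpha>0_def)
  then have "\<exists>\<beta>. (\<beta> \<in> N'.wts \<and> \<alpha>0 \<subseteq># \<beta> \<and> \<beta> \<subseteq># \<alpha>) \<and>
      (\<forall>\<gamma>. \<gamma> \<in> N'.wts \<and> \<alpha>0 \<subseteq># \<gamma> \<and> \<gamma> \<subseteq># \<alpha> \<longrightarrow> size \<gamma> \<le> size \<beta>)"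
    by (intro ex_has_greatest_nat[of _ \<alpha>0 _ "Suc (size \<alpha>)"]) (auto simp: \<alpha>0_def less_Suc_eq_le size_mset_mono)
  then obtain \<beta>
    where \<beta>: "\<beta> \<in> N'.wts" "\<alpha>0 \<subseteq># \<beta>" "\<beta> \<subseteq># \<alpha>"
    and max: "\<And>\<gamma>. \<gamma> \<in> N'.wts \<Longrightarrow> \<alpha>0 \<subseteq># \<gamma> \<Longrightarrow> \<gamma> \<subseteq># \<alpha> \<Longrightarrow> size \<gamma> \<le> size \<beta>"
    by blast
  have le: "count \<beta> k \<le> count \<alpha> k" for k using \<beta>(3)
    by (simp add: mset_subset_eq_count)
  define T where "T = {i. count \<beta> i < count \<alpha> i}"
  have T\<alpha>: "T \<subseteq> set_mset \<alpha>"
    by (auto simp: T_def simp flip: count_greater_zero_iff)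
  then have fT: "finite T" by (rule finite_subset) simp
  have TI: "T \<subseteq> I" using T\<alpha> \<alpha>I by blast
  have Tne: "T \<noteq> {}"
  proof
    assume "T = {}"
    then have "\<alpha> = \<beta>" using le
      by (intro multiset_eqI) (auto simp: T_def not_less intro: antisym)
    then show False using \<beta>(1) not by simp
  qed
  have Tint: "T \<subseteq> integ"
  proof
    fix i assume i: "i \<in> T"
    show "i \<in> integ"
    proof (rule ccontr)
      assume "i \<notin> integ"
      then have "count \<alpha>0 i = count \<alpha> i" by (simp add: \<alpha>0_def)
      moreover have "count \<alpha>0 i \<le> count \<beta> i" using \<beta>(2)
        by (simp add: mset_subset_eq_count)
      ultimately show False using i by (simp add: T_def)
    qed
  qed
  define s where "s i M = (\<Sum>k\<in>#M. A i k)" for i M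
  have cw: "cw i M = l i - of_int (s i M)" for i M
    by (simp add: cw_int s_def)
  \<comment> \<open>By maximality of \<open>\<beta>\<close>, adding a letter \<open>i\<close> leaves
    the weights of the second module, so a string ends at \<open>\<beta>\<close>.\<close>
  have end_\<beta>: "\<exists>n. cw i \<beta> = - of_nat n" if i: "i \<in> T" for i
  proof -
    have "add_mset i \<beta> \<subseteq># \<alpha>"
      using le i by (intro mset_subset_eqI) (auto simp: T_def)
    moreover have "\<alpha>0 \<subseteq># add_mset i \<beta>"
      using \<beta>(2)
        by (metis add_mset_add_single mset_subset_eq_add_left subset_mset.order_trans)
    ultimately have "add_mset i \<beta> \<notin> N'.wts" using max[of "add_mset i \<beta>"] by auto
    then show ?thesis using N'.string_end[of i \<beta>] i TI \<beta>(1) by blast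
  qed
  \<comment> \<open>On the coroots of \<open>T\<close> the weight \<open>\<lambda> - \<beta>\<close>
    is nonpositive by \<open>end_\<beta>\<close>, and \<open>\<lambda> - \<alpha>\<close> is
    nonnegative by dominance.\<close>
  have ints: "\<exists>m. l i = of_nat m \<and> s i \<beta> \<ge> int m \<and> s i \<alpha> \<le> int m" if i: "i \<in> T" for i
  proof -
    obtain m where m: "l i = of_nat m" using integ_dominant[of i] Tint i
      by (metis Nats_cases subsetD)
    obtain n where "cw i \<beta> = - of_nat n" using end_\<beta>[OF i] ..
    then have "(of_int (int m - s i \<beta>) :: complex) = of_int (- int n)" using m cw by simp
    then have 1: "int m - s i \<beta> = - int n" unfolding of_int_eq_iff .
    obtain n' where "cw i \<alpha> = of_nat n'" using dom[of i] Tint i by (metis Nats_cases subsetD)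
    then have "(of_int (int m - s i \<alpha>) :: complex) = of_int (int n')" using m cw by simp
    then have 2: "int m - s i \<alpha> = int n'" unfolding of_int_eq_iff .
    show ?thesis using m 1 2 by (intro exI[of _ m]) simp
  qed
  define S where "S = set_mset \<alpha> - T"
  have split: "s i M = (\<Sum>k\<in>T. A i k * int (count M k)) + (\<Sum>k\<in>S. A i k * int (count M k))"
    if "M \<subseteq># \<alpha>" for i M
  proof -
    have "s i M = (\<Sum>k\<in>set_mset \<alpha>. int (count M k) * A i k)"
      unfolding s_def using that by (intro sum_mset_count) (auto dest: set_mset_mono)
    also have "set_mset \<alpha> = T \<union> S" using T\<alpha> by (auto simp: S_def)
    finally show ?thesis using fT
      by (subst (asm) sum.union_disjoint) (auto simp: S_def mult.commute)
  qed
  have eqS: "count \<alpha> k = count \<beta> k" if "k \<in> S" for k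
    using that le[of k] by (auto simp: S_def T_def)
  have nonposS: "A i k \<le> 0" if "i \<in> T" "k \<in> S" for i k
    using that A_off[of i k] TI \<alpha>I by (auto simp: S_def)
  have sumS: "(\<Sum>k\<in>S. A i k * int (count \<beta> k)) \<le> 0" if "i \<in> T" for i
    using nonposS[OF that] by (intro sum_nonpos) (simp add: mult_le_0_iff)
  \<comment> \<open>\<open>zero_block\<close> is applied to \<open>\<beta>\<close> and
    \<open>\<alpha> - \<beta>\<close> on \<open>T\<close>, where the latter is positive.\<close>
  define u where "u k = real (count \<beta> k)" for k
  define w where "w k = real (count \<alpha> k) - real (count \<beta> k)" for k
  have Au_eq: "(\<Sum>k\<in>T. of_int (A i k) * u k) = of_int (s i \<beta> - (\<Sum>k\<in>S. A i k * int (count \<beta> k)))" for i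
    unfolding split[OF \<beta>(3)] u_def by simp
  \<comment> \<open>Off \<open>T\<close> the contents \<open>\<alpha>\<close> and
    \<open>\<beta>\<close> agree, so the sum over \<open>T\<close> is the full difference.\<close>
  have Aw: "(\<Sum>k\<in>T. of_int (A i k) * w k) \<le> 0" if i: "i \<in> T" for i
  proof -
    have "(\<Sum>k\<in>T. of_int (A i k) * w k) = of_int (s i \<alpha> - s i \<beta>)"
      unfolding split[OF \<beta>(3)] split[OF subset_mset.order_refl] w_def
      by (simp add: eqS algebra_simps sum_subtractf)
    moreover have "s i \<alpha> - s i \<beta> \<le> 0" using ints[OF i] by force
    ultimately show ?thesis by simp
  qed
  have Au: "(\<Sum>k\<in>T. of_int (A i k) * u k) \<ge> 0" if i: "i \<in> T" for i
  proof -
    have "s i \<beta> - (\<Sum>k\<in>S. A i k * int (count \<beta> k)) \<ge> 0"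
      using ints[OF i] sumS[OF i] by force
    then show ?thesis unfolding Au_eq by (simp only: of_int_0_le_iff)
  qed
  obtain Z where Z: "Z \<subseteq> T" "Z \<noteq> {}" "\<And>i k. i \<in> Z \<Longrightarrow> k \<in> T - Z \<Longrightarrow> A i k = 0"
    and Z0: "\<And>i. i \<in> Z \<Longrightarrow> (\<Sum>k\<in>T. of_int (A i k) * u k) = 0"
    by (rule zero_block[of T w u]) (use fT Tne TI Aw Au in \<open>auto simp: w_def u_def T_def\<close>)
  \<comment> \<open>The vanishing sum is \<open>s i \<beta>\<close>, which is at least
    \<open>m \<ge> 0\<close>, minus a nonpositive sum over \<open>S\<close>. So \<open>m = 0\<close>
    and every term over \<open>S\<close> is zero; since \<open>\<beta>\<close> is positive on
    \<open>S\<close>, the matrix entries vanish.\<close>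
  have ZS: "l i = 0 \<and> (\<forall>k\<in>S. A i k = 0)" if i: "i \<in> Z" for i
  proof -
    have iT: "i \<in> T" using i Z by blast
    obtain m where m: "l i = of_nat m" "s i \<beta> \<ge> int m" using ints[OF iT] by blast
    have "s i \<beta> - (\<Sum>k\<in>S. A i k * int (count \<beta> k)) = 0" using Z0[OF i]
      unfolding Au_eq by (simp only: of_int_eq_0_iff)
    then have "m = 0" and z: "(\<Sum>k\<in>S. A i k * int (count \<beta> k)) = 0"
      using m sumS[OF iT] by linarith+
    have "A i k = 0" if k: "k \<in> S" for k
    proof -
      have "(\<Sum>k\<in>S. - (A i k * int (count \<beta> k))) = 0" using z by (simp add: sum_negf)
      then have "- (A i k * int (count \<beta> k)) = 0"
        using nonposS[OF iT] k by (subst (asm) sum_nonneg_eq_0_iff) (auto simp: S_def mult_le_0_iff)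
      moreover have "count \<beta> k > 0" using k eqS[OF k] unfolding S_def
        by (metis DiffD1 count_greater_zero_iff)
      ultimately show ?thesis by simp
    qed
    then show ?thesis using m \<open>m = 0\<close> by simp
  qed
  obtain v where v: "mset v = \<alpha>" "word v \<notin> N" using \<alpha> by (auto simp: wts_def)
  have sv: "set v = set_mset \<alpha>" using v(1) by auto
  have "word v \<in> N"
  proof (rule vanishing_word[of Z])
    show "set v \<inter> Z \<noteq> {}" using Z(1,2) T\<alpha> sv by blast
    show "A i k = 0" if "i \<in> Z" "k \<in> set v - Z" for i k
      using that Z(3) ZS sv by (auto simp: S_def)
  qed (use Z(1) Tint ZS in auto)
  with v(2) show False by simp
qed

text \<open>If \<open>\<alpha>\<close> is not dominant at an integrable \<open>i\<close>, its
  reflection has a smaller content. \<open>up_string\<close> reflects in the first module, the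
  induction hypothesis passes to the second one, and \<open>down_string\<close> reflects
  back.\<close>

lemma wts_le: "\<alpha> \<in> wts \<Longrightarrow> \<alpha> \<in> N'.wts"
proof (induction "size \<alpha>" arbitrary: \<alpha> rule: less_induct)
  case less
  show ?case
  proof (cases "\<forall>i\<in>integ. cw i \<alpha> \<in> \<nat>")
    case True
    then show ?thesis using dominant_wts less.prems by blast
  next
    case False
    then obtain i where i: "i \<in> integ" "cw i \<alpha> \<notin> \<nat>" by blast
    obtain m where "l i = of_nat m" using integ_dominant[OF i(1)] by (metis Nats_cases)
    then have c: "cw i \<alpha> = of_int (int m - (\<Sum>k\<in>#\<alpha>. A i k))"
      by (simp add: cw_int)
    define n where "n = nat (- (int m - (\<Sum>k\<in>#\<alpha>. A i k)))"
    have "int m - (\<Sum>k\<in>#\<alpha>. A i k) < 0"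
    proof (rule ccontr)
      assume "\<not> ?thesis"
      then have "cw i \<alpha> = of_nat (nat (int m - (\<Sum>k\<in>#\<alpha>. A i k)))" unfolding c
        by simp
      then show False using i(2) by simp
    qed
    then have n: "n > 0" "cw i \<alpha> = - of_nat n" by (simp_all add: n_def c)
    have up: "n \<le> count \<alpha> i" "\<alpha> - replicate_mset n i \<in> wts"
      using up_string[OF i(1) less.prems n(2), of n] by auto
    have sub: "\<alpha> = (\<alpha> - replicate_mset n i) + replicate_mset n i"
      using up(1) by (intro multiset_eqI) auto
    have "size \<alpha> = size (\<alpha> - replicate_mset n i) + n"
      by (subst (1) sub) simp
    then have IH: "\<alpha> - replicate_mset n i \<in> N'.wts" using less.hyps up(2) n(1) by simp
    have iI: "i \<in> I" using i(1) by (simp add: integ_def)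
    have "cw i \<alpha> = cw i (\<alpha> - replicate_mset n i) - 2 * of_nat n"
      by (subst sub) (simp add: cw_plus A_diag[OF iI] mult.commute)
    then have "cw i (\<alpha> - replicate_mset n i) = of_nat n" using n(2) by simp
    then have "(\<alpha> - replicate_mset n i) + replicate_mset n i \<in> N'.wts"
      using N'.down_string[OF iI IH] by blast
    then show ?thesis using sub by simp
  qed
qed

end

section \<open>Ideals with different weights\<close>

context verma_ideal
begin

lemma commute_power_N:
  assumes "i \<in> I" "j \<in> I" "i \<noteq> j" "A i j = 0"
  shows "word (j # replicate a i @ v) - word (replicate a i @ j # v) \<in> N"
proof (induction a)
  case (Suc a)
  have "fop i (fop j (word (replicate a i @ v))) - fop j (fop i (word (replicate a i @ v))) \<in> N"
    by (rule commute_N[OF assms])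
  from N_diff[OF fop_N[OF Suc.IH, of i] this] show ?case by simp
qed simp

text \<open>The letters commute modulo \<open>N\<close>, so every word can be sorted.\<close>

lemma two_letter_word:
  assumes "i \<in> I" "j \<in> I" "i \<noteq> j" "A i j = 0"
    and "mset w = replicate_mset a i + replicate_mset b j"
  shows "word w - word (replicate a i @ replicate b j) \<in> N"
  using assms(5)
proof (induction w arbitrary: a b)
  case (Cons k w)
  have "k \<in># replicate_mset a i + replicate_mset b j" using Cons.prems
    by (metis list.set_intros(1) set_mset_mset)
  then consider a' where "k = i" "a = Suc a'" | b' where "k = j" "b = Suc b'"
    by (cases a; cases b) (auto split: if_splits)
  then show ?case
  proof cases
    case 1
    then have "word w - word (replicate a' i @ replicate b j) \<in> N" using Cons by simp
    from fop_N[OF this, of i] show ?thesis using 1 by simp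
  next
    case 2
    then have "word w - word (replicate a i @ replicate b' j) \<in> N" using Cons by simp
    from N_add[OF fop_N[OF this, of j] commute_power_N[OF assms(1-4), of a "replicate b' j"]]
    show ?thesis using 2 by simp
  qed
qed simp

end

section \<open>Serre elements are singular; ideals generated by singular vectors\<close>

context km_matrix
begin

lemma hop_serre:
  assumes "A i i = 2"
  shows "hop i (serre n i j x) = serre n i j (hop i x) - scl (of_int (2 * int n + A i j)) (serre n i j x)"
proof (induction n arbitrary: x)
  case (Suc n)
  have "hop i (serre (Suc n) i j x) =
    fop i (hop i (serre n i j x)) - scl 2 (fop i (serre n i j x)) - hop i (serre n i j (fop i x))"
    using assms by (simp add: hop_fop)
  also have "\<dots> = serre (Suc n) i j (hop i x)
    - (scl (of_int (2 * int n + A i j)) (serre (Suc n) i j x) + scl 2 (serre (Suc n) i j x))"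
    unfolding Suc.IH using assms by (simp add: hop_fop pm.scale_right_diff_distrib)
  also have "\<dots> = serre (Suc n) i j (hop i x)
    - scl (of_int (2 * int (Suc n) + A i j)) (serre (Suc n) i j x)"
    unfolding pm.scale_left_distrib[symmetric] by (simp add: algebra_simps)
  finally show ?case .
qed (simp add: hop_fop)

lemma eop_serre_other:
  assumes "k \<noteq> i" "k \<noteq> j"
  shows "eop k (serre n i j x) = serre n i j (eop k x)"
  using assms by (induction n arbitrary: x) (simp_all add: eop_fop)

text \<open>\<open>e_j\<close> turns \<open>f_j\<close> into \<open>h_j\<close>, the first
  commutator with \<open>f_i\<close> gives a multiple of \<open>f_i\<close>, and the next one is
  \<open>[f_i, f_i] = 0\<close>.\<close>

lemma eop_serre_right:
  assumes "i \<noteq> j"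
  shows "eop j (serre n i j x) = serre n i j (eop j x)
    + (if n = 0 then hop j x else if n = 1 then scl (of_int (A j i)) (fop i x) else 0)"
  using assms by (induction n arbitrary: x) (auto simp: eop_fop hop_fop)

text \<open>The \<open>sl_2\<close> identity for \<open>f_j\<close> as a vector of weight
  \<open>- A i j\<close> killed by \<open>ad e_i\<close>. The coefficient vanishes at
  \<open>n = 1 - A i j\<close>.\<close>

lemma eop_serre_left:
  assumes "A i i = 2" "i \<noteq> j"
  shows "eop i (serre n i j x) = serre n i j (eop i x)
    - scl (of_int (int n * (A i j + int n - 1))) (serre (n - 1) i j x)"
proof (induction n arbitrary: x)
  case 0
  then show ?case using assms by (simp add: eop_fop)
next
  case (Suc n)
  define c where "c = (of_int (int n * (A i j + int n - 1)) :: complex)"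
  have low: "scl c (fop i (serre (n - 1) i j x)) - scl c (serre (n - 1) i j (fop i x)) = scl c (serre n i j x)"
    by (cases n) (simp_all add: c_def pm.scale_right_diff_distrib)
  have "eop i (serre (Suc n) i j x) =
    fop i (eop i (serre n i j x)) + hop i (serre n i j x) - eop i (serre n i j (fop i x))"
    by (simp add: eop_fop)
  also have "\<dots> = serre (Suc n) i j (eop i x)
    - (scl c (fop i (serre (n - 1) i j x)) - scl c (serre (n - 1) i j (fop i x)))
    - scl (of_int (2 * int n + A i j)) (serre n i j x)"
    unfolding Suc.IH hop_serre[of i, OF assms(1)] c_def[symmetric] by (simp add: eop_fop)
  also have "\<dots> = serre (Suc n) i j (eop i x)
    - (scl c (serre n i j x) + scl (of_int (2 * int n + A i j)) (serre n i j x))"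
    unfolding low by simp
  also have "\<dots> = serre (Suc n) i j (eop i x)
    - scl (of_int (int (Suc n) * (A i j + int (Suc n) - 1))) (serre (Suc n - 1) i j x)"
    unfolding pm.scale_left_distrib[symmetric] by (simp add: c_def algebra_simps)
  finally show ?case .
qed

text \<open>All correction terms vanish at this exponent. For \<open>k = j\<close> the exponent 1
  occurs only if \<open>A i j = 0\<close>, and then \<open>A j i = 0\<close> as well.\<close>

lemma eop_serre:
  assumes "i \<in> I" "j \<in> I" "i \<noteq> j"
  shows "eop k (serre (nat (1 - A i j)) i j x) = serre (nat (1 - A i j)) i j (eop k x)"
proof -
  have a: "A i j \<le> 0" using A_off assms by blast
  consider "k = i" | "k = j" "k \<noteq> i" | "k \<noteq> i" "k \<noteq> j" by blast
  then show ?thesis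
  proof cases
    case 1
    then show ?thesis using eop_serre_left[OF A_diag] assms a by simp
  next
    case 2
    then show ?thesis using eop_serre_right[of i j] assms a A_zero_sym[of i j]
      by (auto simp: nat_eq_iff)
  qed (rule eop_serre_other)
qed

lemma foldr_fop_cspace: "x \<in> cspace M \<Longrightarrow> foldr fop u x \<in> cspace (mset u + M)"
  by (induction u) (auto dest: fop_cspace)

lemma cspace_diff: "x \<in> cspace M \<Longrightarrow> y \<in> cspace M \<Longrightarrow> x - y \<in> cspace M"
  using subspace_cspace[of M] by (rule pm.subspace_diff)

lemma serre_cspace: "x \<in> cspace M \<Longrightarrow> serre n i j x \<in> cspace (replicate_mset n i + add_mset j M)"
proof (induction n arbitrary: x M)
  case (Suc n)
  then show ?case
    using fop_cspace[OF Suc.IH, of x M i] Suc.IH[OF fop_cspace, of x M i]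
      by (auto intro!: cspace_diff simp: add_mset_commute)
qed (auto dest: fop_cspace)

definition relators :: "('i list \<Rightarrow>\<^sub>0 complex) set \<Rightarrow> ('i list \<Rightarrow>\<^sub>0 complex) set" where
  "relators G = {word (i # w) | i w. i \<notin> I}
    \<union> {serre (nat (1 - A i j)) i j (word w) | i j w. i \<in> I \<and> j \<in> I \<and> i \<noteq> j} \<union> G"

text \<open>Only the \<open>f_i\<close> are applied to the relators; that the span is also stable
  under the \<open>e_k\<close> is \<open>ideal_eop\<close>.\<close>

definition ideal :: "('i list \<Rightarrow>\<^sub>0 complex) set \<Rightarrow> ('i list \<Rightarrow>\<^sub>0 complex) set" where
  "ideal G = pm.span {foldr fop u g | u g. g \<in> relators G}"

end

lemma span_linear_image:
  fixes T :: "('a \<Rightarrow>\<^sub>0 complex) \<Rightarrow> ('a \<Rightarrow>\<^sub>0 complex)"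
  assumes "x \<in> pm.span S" "\<And>x. x \<in> S \<Longrightarrow> T x \<in> pm.span S"
    "\<And>x y. T (x + y) = T x + T y" "\<And>c x. T (scl c x) = scl c (T x)"
  shows "T x \<in> pm.span S"
  using assms(1)
proof (induction rule: pm.span_induct_alt)
  case base
  have "T 0 = 0" by (rule additive_zero_diff) (rule assms(3))
  then show ?case by (simp add: pm.span_zero)
qed (auto simp: assms intro!: pm.span_add pm.span_scale)

text \<open>A linear functional that forgets the order of the letters; it separates words from
  ideals.\<close>

definition content_sum :: "'i multiset \<Rightarrow> ('i list \<Rightarrow>\<^sub>0 complex) \<Rightarrow> complex" where
  "content_sum M x = (\<Sum>w | mset w = M. lookup x w)"

lemma finite_content: "finite {w. mset w = M}"
proof (rule finite_subset)
  show "{w. mset w = M} \<subseteq> {w. set w \<subseteq> set_mset M \<and> length w = size M}"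
    by auto
qed (simp add: finite_lists_length_eq)

lemma content_sum_simps:
  "content_sum M (x + y) = content_sum M x + content_sum M y"
  "content_sum M (scl c x) = c * content_sum M x"
  "content_sum M (word w) = (if mset w = M then 1 else 0)"
  by (simp_all add: content_sum_def lookup_add lookup_scl sum.distrib sum_distrib_left
      lookup_single when_def finite_content)

lemma content_sum_cspace: "x \<in> cspace M \<Longrightarrow> M \<noteq> M' \<Longrightarrow> content_sum M' x = 0"
  by (auto simp: content_sum_def cspace_def in_keys_iff intro!: sum.neutral)

text \<open>Singularity makes the ideal stable under the \<open>e_k\<close>, homogeneity makes it
  stable under the Cartan subalgebra.\<close>

locale singular_vectors = km_matrix A l I
  for A :: "'i \<Rightarrow> 'i \<Rightarrow> int" and l :: "'i \<Rightarrow> complex"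
    and I :: "'i set" +
  fixes G :: "('i list \<Rightarrow>\<^sub>0 complex) set"
  assumes singular: "g \<in> G \<Longrightarrow> k \<in> I \<Longrightarrow> eop k g = 0"
    and homogeneous: "g \<in> G \<Longrightarrow> \<exists>M. g \<in> cspace M"
begin

lemma relators_homogeneous: "g \<in> relators G \<Longrightarrow> \<exists>M. g \<in> cspace M"
  unfolding relators_def
proof (elim UnE CollectE exE conjE)
  fix i w assume "g = word (i # w)"
  then show ?thesis using word_cspace by blast
next
  fix i j w assume "g = serre (nat (1 - A i j)) i j (word w)"
  moreover have "word w \<in> cspace (mset w)" by simp
  ultimately show ?thesis using serre_cspace by blast
qed (rule homogeneous)

lemma ideal_subspace: "pm.subspace (ideal G)"
  unfolding ideal_def by (rule pm.subspace_span)

lemma relators_ideal: "g \<in> relators G \<Longrightarrow> foldr fop u g \<in> ideal G"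
  unfolding ideal_def by (rule pm.span_base) blast

lemma ideal_closed:
  assumes "x \<in> ideal G" "\<And>u g. g \<in> relators G \<Longrightarrow> T (foldr fop u g) \<in> ideal G"
    "\<And>x y. T (x + y) = T x + T y" "\<And>c x. T (scl c x) = scl c (T x)"
  shows "T x \<in> ideal G"
  unfolding ideal_def
proof (rule span_linear_image[where T = T])
  show "x \<in> pm.span {foldr fop u g |u g. g \<in> relators G}"
    using assms(1) by (simp only: ideal_def)
  show "T y \<in> pm.span {foldr fop u g |u g. g \<in> relators G}"
    if "y \<in> {foldr fop u g |u g. g \<in> relators G}" for y
    using that assms(2) unfolding ideal_def by blast
qed (fact assms(3,4))+

lemma ideal_fop: "x \<in> ideal G \<Longrightarrow> fop i x \<in> ideal G"
  using relators_ideal[of _ "i # u" for u] by (auto intro: ideal_closed)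

lemma ideal_diag: "x \<in> ideal G \<Longrightarrow> diag (\<lambda>w. \<phi> (mset w)) x \<in> ideal G"
proof (erule ideal_closed)
  fix u g assume g: "g \<in> relators G"
  then obtain M where "g \<in> cspace M" using relators_homogeneous by blast
  then have "diag (\<lambda>w. \<phi> (mset w)) (foldr fop u g) = scl (\<phi> (mset u + M)) (foldr fop u g)"
    by (intro diag_cspace foldr_fop_cspace)
  then show "diag (\<lambda>w. \<phi> (mset w)) (foldr fop u g) \<in> ideal G"
    using relators_ideal[OF g] pm.subspace_scale[OF ideal_subspace] by simp
qed auto

lemma ideal_serre:
  assumes "i \<in> I" "j \<in> I" "i \<noteq> j"
  shows "serre (nat (1 - A i j)) i j x \<in> ideal G"
proof (induction x rule: words_induct)
  case (word w)
  have "serre (nat (1 - A i j)) i j (word w) \<in> relators G"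
    using assms by (auto simp: relators_def)
  then show ?case using relators_ideal[of _ "[]"] by simp
qed (auto intro: pm.subspace_scale[OF ideal_subspace] pm.subspace_add[OF ideal_subspace])

lemma ideal_bad: "i \<notin> I \<Longrightarrow> fop i x \<in> ideal G"
proof (induction x rule: words_induct)
  case (word w)
  then have "word (i # w) \<in> relators G" by (auto simp: relators_def)
  then show ?case using relators_ideal[of _ "[]"] by simp
qed (auto intro: pm.subspace_scale[OF ideal_subspace] pm.subspace_add[OF ideal_subspace])

text \<open>\<open>e_k\<close> sends each relator into the ideal. Moving it past a letter of
  \<open>u\<close> costs only an \<open>h_k\<close>-term, which \<open>ideal_diag\<close>
  handles.\<close>

lemma ideal_eop:
  assumes k: "k \<in> I" and x: "x \<in> ideal G"
  shows "eop k x \<in> ideal G"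
  using x
proof (rule ideal_closed)
  fix u g assume g: "g \<in> relators G"
  have "eop k g \<in> ideal G"
    using g unfolding relators_def
  proof (elim UnE CollectE exE conjE)
    fix i w assume "g = word (i # w)" "i \<notin> I"
    then have "eop k g = fop i (ew k w)" using k by auto
    then show ?thesis using ideal_bad \<open>i \<notin> I\<close> by simp
  next
    fix i j w assume "g = serre (nat (1 - A i j)) i j (word w)" "i \<in> I" "j \<in> I" "i \<noteq> j"
    then show ?thesis using eop_serre[of i j k "word w"] ideal_serre by simp
  next
    assume "g \<in> G"
    then show ?thesis using singular k pm.subspace_0[OF ideal_subspace] by simp
  qed
  then show "eop k (foldr fop u g) \<in> ideal G"
  proof (induction u)
    case (Cons i u)
    then show ?case
      using ideal_fop[of "eop k (foldr fop u g)" i] ideal_diag[OF relators_ideal[OF g]]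
      by (auto simp: eop_fop intro: pm.subspace_add[OF ideal_subspace])
  qed simp
qed auto

text \<open>\<open>content_sum (mset w)\<close> vanishes on the ideal but not on \<open>w\<close>.
  Relators whose content does not fit into \<open>mset w\<close> contribute nothing; by
  orthogonality the other Serre relators are commutators, whose two words have equal content and
  cancel.\<close>

lemma word_not_in_ideal:
  assumes "set w \<subseteq> I" "\<And>g. g \<in> G \<Longrightarrow> \<exists>M. g \<in> cspace M \<and> \<not> M \<subseteq># mset w"
    "\<And>i j. i \<in> set w \<Longrightarrow> j \<in> set w \<Longrightarrow> i \<noteq> j \<Longrightarrow> A i j = 0"
  shows "word w \<notin> ideal G"
proof
  have far: "content_sum (mset w) (foldr fop u g) = 0"
    if "g \<in> cspace M" "\<not> M \<subseteq># mset w" for u g M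
    using that
      by (intro content_sum_cspace[OF foldr_fop_cspace[of g M]]) (metis mset_subset_eq_add_right)+
  have vanish: "content_sum (mset w) (foldr fop u g) = 0" if "g \<in> relators G" for u g
    using that unfolding relators_def
  proof (elim UnE CollectE exE conjE)
    fix i v assume "g = word (i # v)" "i \<notin> I"
    moreover have "i \<notin># mset w" using assms(1) \<open>i \<notin> I\<close> by auto
    ultimately show ?thesis
      by (intro far[of _ "mset (i # v)"]) (auto dest: mset_subset_eqD)
  next
    fix i j v assume g: "g = serre (nat (1 - A i j)) i j (word v)"
      and ij: "i \<in> I" "j \<in> I" "i \<noteq> j"
    have A: "A i j \<le> 0" using A_off ij by blast
    show ?thesis
    proof (cases "i \<in> set w \<and> j \<in> set w")
      case True
      then have "A i j = 0" using assms(3) ij by blast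
      then have "foldr fop u g = word (u @ i # j # v) + scl (- 1) (word (u @ j # i # v))"
        unfolding g by (simp add: foldr_fop_word)
      then show ?thesis by (simp only: content_sum_simps) (simp add: add_mset_commute)
    next
      case False
      \<comment> \<open>\<open>A i j \<le> 0\<close> makes the exponent positive, so both
        \<open>i\<close> and \<open>j\<close> occur in the content of the relator, and one of them
        is missing in \<open>w\<close>.\<close>
      show ?thesis
        unfolding g by (rule far[OF serre_cspace[of _ "mset v"]])
          (use False A ij in \<open>auto dest: mset_subset_eqD simp: in_replicate_mset\<close>)
    qed
  next
    assume "g \<in> G"
    then show ?thesis using assms(2) far by blast
  qed
  have "content_sum (mset w) x = 0" if "x \<in> ideal G" for x
    using that unfolding ideal_def
  proof (induction rule: pm.span_induct_alt)
    case base
    then show ?case by (simp add: content_sum_def)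
  qed (auto simp: content_sum_simps vanish)
  moreover assume "word w \<in> ideal G"
  ultimately show False using content_sum_simps(3)[of "mset w" w] by force
qed

lemma verma_ideal_ideal:
  assumes "\<And>g. g \<in> G \<Longrightarrow> \<exists>M. g \<in> cspace M \<and> M \<noteq> {#}"
  shows "verma_ideal A l I (ideal G)"
proof
  show "word [] \<notin> ideal G" using word_not_in_ideal[of "[]"] assms by simp
qed (auto intro: ideal_subspace ideal_fop ideal_eop ideal_bad ideal_serre)

end

section \<open>Two ideals with equal integrability for an orthogonal pair outside
  \<open>J\<close>\<close>

locale incomplete_data = km_matrix A l I
  for A :: "'i \<Rightarrow> 'i \<Rightarrow> int" and l :: "'i \<Rightarrow> complex"
    and I :: "'i set" +
  fixes J :: "'i set" and a b :: 'i
  assumes J: "J \<subseteq> I" "\<And>j. j \<in> J \<Longrightarrow> l j \<in> \<nat>"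
    and ab: "a \<in> I - J" "b \<in> I - J" "l a \<in> \<nat>" "l b \<in> \<nat>" "A a b = 0"
begin

text \<open>The exponent \<open>l i + 1\<close> at which the power of \<open>f_i\<close> becomes
  singular; meaningful for \<open>l i \<in> \<nat>\<close>.\<close>

definition pwr :: "'i \<Rightarrow> nat" where
  "pwr i = (THE n. l i = of_nat n) + 1"

lemma pwr: "l i \<in> \<nat> \<Longrightarrow> l i = of_nat (pwr i - 1) \<and> pwr i > 0"
  unfolding pwr_def by (auto elim!: Nats_cases)

definition powers :: "('i list \<Rightarrow>\<^sub>0 complex) set" where
  "powers = (\<lambda>j. (fop j ^^ pwr j) (word [])) ` J"

definition ab_word :: "'i list" where
  "ab_word = replicate (pwr a) a @ replicate (pwr b) b"

definition ab_content :: "'i multiset" where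
  "ab_content = mset ab_word"

lemma a_neq_b: "a \<noteq> b"
  using ab A_diag by force

text \<open>For \<open>k = i\<close> the coefficient in \<open>eop_fop_pow\<close> vanishes at this
  exponent. Any singular \<open>x\<close> with the right eigenvalue is allowed, so that
  \<open>f_a\<close> can be applied on top of a power of \<open>f_b\<close>.\<close>

lemma eop_power:
  assumes "i \<in> I" "hop i x = scl (l i) x" "\<And>k. k \<in> I \<Longrightarrow> eop k x = 0" "l i \<in> \<nat>" "k \<in> I"
  shows "eop k ((fop i ^^ pwr i) x) = 0"
proof (cases "k = i")
  case True
  obtain n where n: "pwr i = Suc n" "l i = of_nat n" using pwr[OF assms(4)] by (cases "pwr i") auto
  show ?thesis
    unfolding True n eop_fop_pow[OF A_diag[OF assms(1)] assms(2)]
    using assms n pow_linear(1)[of "Suc n" i 0 0] by simp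
next
  case False
  have "eop k ((fop i ^^ n) x) = 0" for n
    by (induction n) (use False assms in \<open>auto simp: eop_fop\<close>)
  then show ?thesis .
qed

lemma eop_ab: "k \<in> I \<Longrightarrow> eop k (word ab_word) = 0"
proof -
  assume k: "k \<in> I"
  have e: "eop k ((fop b ^^ pwr b) (word [])) = 0" if "k \<in> I" for k
    using that ab by (intro eop_power) auto
  have "(fop b ^^ pwr b) (word []) \<in> cspace (replicate_mset (pwr b) b)"
    using fop_pow_cspace[of "word []" "{#}"] by simp
  \<comment> \<open>Since \<open>A a b = 0\<close>, powers of \<open>f_b\<close> do not change the
    eigenvalue of \<open>h_a\<close>.\<close>
  then have "hop a ((fop b ^^ pwr b) (word [])) = scl (l a) ((fop b ^^ pwr b) (word []))"
    using diag_cspace[of _ "replicate_mset (pwr b) b" "cw a"] ab(5) cw_int[of a "replicate_mset (pwr b) b"]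
    by simp
  then have "eop k ((fop a ^^ pwr a) ((fop b ^^ pwr b) (word []))) = 0"
    using e ab k by (intro eop_power) auto
  then show ?thesis by (simp add: fop_pow_word ab_word_def)
qed

lemma powers_cspace: "(fop j ^^ pwr j) (word []) \<in> cspace (replicate_mset (pwr j) j)"
  using fop_pow_cspace[of "word []" "{#}"] by simp

lemma not_subset_content:
  assumes "l j \<in> \<nat>" "j \<notin># M"
  shows "\<not> replicate_mset (pwr j) j \<subseteq># M"
  using pwr[OF assms(1)] assms(2) by (auto dest!: mset_subset_eqD[where x = j])

sublocale N1: singular_vectors A l I powers
proof
  show "eop k g = 0" if "g \<in> powers" "k \<in> I" for g k
    using that J by (auto simp: powers_def intro!: eop_power)
  show "\<exists>M. g \<in> cspace M" if "g \<in> powers" for g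
    using that powers_cspace by (auto simp: powers_def)
qed

sublocale N2: singular_vectors A l I "insert (word ab_word) powers"
proof
  show "eop k g = 0" if "g \<in> insert (word ab_word) powers" "k \<in> I" for g k
    using that N1.singular eop_ab by auto
  show "\<exists>M. g \<in> cspace M" if "g \<in> insert (word ab_word) powers" for g
    using that N1.homogeneous by auto
qed

abbreviation "ideal1 \<equiv> ideal powers"
abbreviation "ideal2 \<equiv> ideal (insert (word ab_word) powers)"

lemma powers_outside:
  assumes "g \<in> powers" "set_mset M \<inter> J = {}"
  shows "\<exists>M'. g \<in> cspace M' \<and> \<not> M' \<subseteq># M"
proof -
  obtain j where j: "j \<in> J" "g = (fop j ^^ pwr j) (word [])" using assms(1)
    by (auto simp: powers_def)
  then have "\<not> replicate_mset (pwr j) j \<subseteq># M" using assms(2) J(2)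
    by (intro not_subset_content) auto
  then show ?thesis using j(2) powers_cspace by blast
qed

lemma ab_outside:
  assumes "\<not> {a, b} \<subseteq> set_mset M"
  shows "\<exists>M'. word ab_word \<in> cspace M' \<and> \<not> M' \<subseteq># M"
  using assms ab pwr[of a] pwr[of b]
  by (auto simp: ab_word_def dest: mset_subset_eqD[where x = a] mset_subset_eqD[where x = b])

sublocale N1: verma_ideal A l I ideal1
  by (rule N1.verma_ideal_ideal) (use powers_outside[of _ "{#}"] in force)

sublocale N2: verma_ideal A l I ideal2
  by (rule N2.verma_ideal_ideal) (use powers_outside[of _ "{#}"] ab_outside[of "{#}"] in force)

text \<open>A power of one letter outside \<open>J\<close> contains neither letters of
  \<open>J\<close> nor both \<open>a\<close> and \<open>b\<close>, so no generator fits into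
  it.\<close>

lemma power_notin:
  assumes "i \<in> I - J"
  shows "(fop i ^^ n) (word []) \<notin> ideal1" "(fop i ^^ n) (word []) \<notin> ideal2"
proof -
  have s: "set_mset (mset (replicate n i)) \<inter> J = {}" "\<not> {a, b} \<subseteq> set_mset (mset (replicate n i))"
    using assms a_neq_b by auto
  have "word (replicate n i) \<notin> ideal1"
    by (rule N1.word_not_in_ideal) (use assms powers_outside[OF _ s(1)] in auto)
  moreover have "word (replicate n i) \<notin> ideal2"
    by (rule N2.word_not_in_ideal) (use assms powers_outside[OF _ s(1)] ab_outside[OF s(2)] in auto)
  ultimately show "(fop i ^^ n) (word []) \<notin> ideal1" "(fop i ^^ n) (word []) \<notin> ideal2"
    by (simp_all add: fop_pow_word)
qed

lemma integ1: "N1.integ = J"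
proof (intro equalityI subsetI)
  fix j assume j: "j \<in> J"
  then have "(fop j ^^ pwr j) (word []) \<in> relators powers"
    by (auto simp: relators_def powers_def)
  then have "(fop j ^^ pwr j) (word []) \<in> ideal1" using N1.relators_ideal[of _ "[]"] by simp
  then show "j \<in> N1.integ" using N1.integ_iff_vacuum j J by blast
next
  fix i assume "i \<in> N1.integ"
  moreover from this have "i \<in> I" by (simp add: N1.integ_def)
  ultimately show "i \<in> J" using N1.integ_iff_vacuum power_notin(1) by blast
qed

lemma integ2: "N2.integ = J"
proof (intro equalityI subsetI)
  fix j assume j: "j \<in> J"
  then have "(fop j ^^ pwr j) (word []) \<in> relators (insert (word ab_word) powers)"
    by (auto simp: relators_def powers_def)
  then have "(fop j ^^ pwr j) (word []) \<in> ideal2" using N2.relators_ideal[of _ "[]"] by simp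
  then show "j \<in> N2.integ" using N2.integ_iff_vacuum j J by blast
next
  fix i assume "i \<in> N2.integ"
  moreover from this have "i \<in> I" by (simp add: N2.integ_def)
  ultimately show "i \<in> J" using N2.integ_iff_vacuum power_notin(2) by blast
qed

lemma ab_content1: "ab_content \<in> N1.wts"
proof -
  have "set ab_word \<subseteq> {a, b}" by (auto simp: ab_word_def)
  moreover from this have "set ab_word \<inter> J = {}" using ab by blast
  ultimately have "word ab_word \<notin> ideal1"
    using ab A_zero_sym[of a b] powers_outside[of _ "mset ab_word"]
    by (intro N1.word_not_in_ideal) auto
  then show ?thesis using N1.word_wts by (simp add: ab_content_def)
qed

text \<open>Modulo the ideal every word of this content equals \<open>ab_word\<close>, which is a
  relator.\<close>

lemma ab_content2: "ab_content \<notin> N2.wts"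
proof
  assume "ab_content \<in> N2.wts"
  then obtain w where w: "mset w = ab_content" "word w \<notin> ideal2" by (auto simp: N2.wts_def)
  have "word w - word ab_word \<in> ideal2"
    by (rule N2.two_letter_word[of a b _ "pwr a" "pwr b", folded ab_word_def]) (use w(1) ab a_neq_b in \<open>auto simp: ab_content_def ab_word_def\<close>)
  moreover have "word ab_word \<in> relators (insert (word ab_word) powers)"
    by (simp add: relators_def)
  then have "word ab_word \<in> ideal2" using N2.relators_ideal[of _ "[]"] by simp
  ultimately have "word w \<in> ideal2" using N2.N_add by fastforce
  with w(2) show False by simp
qed

end

section \<open>Highest weight modules as quotients of the free Verma module\<close>

lemma sum_apply: "(\<Sum>k\<in>S. f k) x = (\<Sum>k\<in>S. f k x :: 'b :: comm_monoid_add)"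
  by (induction S rule: infinite_finite_induct) auto

lemmas (in abelian_monoid) finsum_mono_neutral_cong_left = add.finprod_mono_neutral_cong_left

text \<open>If \<open>t\<close> is a weight vector modulo \<open>N\<close>, a word in its support
  that lies outside \<open>N\<close> and has a different weight can be removed by adding an element
  of \<open>N\<close>. Induction on the size of the support.\<close>

lemma extract_weight:
  fixes \<phi> :: "'a \<Rightarrow> 'h \<Rightarrow> complex"
  assumes N: "pm.subspace N" "\<And>h x. x \<in> N \<Longrightarrow> diag (\<lambda>w. \<phi> w h) x \<in> N"
    and t: "t \<notin> N" "\<And>h. diag (\<lambda>w. \<phi> w h) t - scl (\<mu> h) t \<in> N"
  shows "\<exists>w. word w \<notin> N \<and> \<phi> w = \<mu>"
  using t
proof (induction "card (keys t)" arbitrary: t rule: less_induct)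
  case less
  show ?case
  proof (rule ccontr)
    assume none: "\<nexists>w. word w \<notin> N \<and> \<phi> w = \<mu>"
    have "\<exists>w\<in>keys t. word w \<notin> N"
    proof (rule ccontr)
      assume "\<not> ?thesis"
      then have "(\<Sum>w\<in>keys t. scl (lookup t w) (word w)) \<in> N"
        by (intro pm.subspace_sum[OF N(1)] pm.subspace_scale[OF N(1)]) auto
      then show False using less.prems(1) expand_words[of t] by simp
    qed
    then obtain w where w: "w \<in> keys t" "word w \<notin> N" by blast
    then obtain h where h: "\<phi> w h \<noteq> \<mu> h" using none by (metis ext)
    \<comment> \<open>This factor makes the coefficient of \<open>w\<close> in \<open>t + d\<close>
      cancel.\<close>
    define c where "c = \<mu> h - \<phi> w h"
    have c: "c \<noteq> 0" using h by (simp add: c_def)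
    define d where "d = scl (inverse c) (diag (\<lambda>w. \<phi> w h) t - scl (\<mu> h) t)"
    have d: "d \<in> N" unfolding d_def by (intro pm.subspace_scale[OF N(1)] less.prems)
    define t' where "t' = t + d"
    have t': "lookup t' v = inverse c * (\<phi> v h - \<phi> w h) * lookup t v" for v
      using c unfolding t'_def d_def
      by (simp add: lookup_add lookup_scl lookup_minus lookup_diag field_simps) (simp add: c_def algebra_simps)
    have "keys t' \<subseteq> keys t - {w}" by (auto simp: in_keys_iff t')
    then have "card (keys t') < card (keys t)" using w(1) by (intro psubset_card_mono) auto
    moreover have "t' \<notin> N"
      using pm.subspace_diff[OF N(1), of t' d] d less.prems(1) by (auto simp: t'_def)
    moreover have "diag (\<lambda>w. \<phi> w k) t' - scl (\<mu> k) t' \<in> N" for k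
    proof -
      have "diag (\<lambda>w. \<phi> w k) t' - scl (\<mu> k) t'
        = (diag (\<lambda>w. \<phi> w k) t - scl (\<mu> k) t) + (diag (\<lambda>w. \<phi> w k) d - scl (\<mu> k) d)"
        by (simp add: t'_def pm.scale_right_distrib)
      also have "\<dots> \<in> N"
        by (intro pm.subspace_add[OF N(1)] pm.subspace_diff[OF N(1)] pm.subspace_scale[OF N(1)] N(2) d less.prems)
      finally show ?thesis .
    qed
    ultimately show False using less.hyps none by blast
  qed
qed

lemma complex_field_simps [simp]:
  "carrier complex_field = UNIV" "a \<otimes>\<^bsub>complex_field\<^esub> b = a * b" "a \<oplus>\<^bsub>complex_field\<^esub> b = a + b"
  "\<one>\<^bsub>complex_field\<^esub> = 1" "\<zero>\<^bsub>complex_field\<^esub> = 0"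
  by (simp_all add: complex_field_def)

lemma lie_class_eqI: "lie_eq R s t \<Longrightarrow> lie_class X R s = lie_class X R t"
  unfolding lie_class_def by (blast intro: lie_eq.sym lie_eq.trans)

lemma lie_class_carrier: "set_lie_term t \<subseteq> X \<Longrightarrow> lie_class X R t \<in> carrier (presented_lie_algebra X R)"
  by (simp add: presented_lie_algebra_def)

lemma lie_class_ops:
  assumes "set_lie_term s \<subseteq> X" "set_lie_term t \<subseteq> X"
  shows "lie_class X R s \<oplus>\<^bsub>presented_lie_algebra X R\<^esub> lie_class X R t = lie_class X R (Add s t)"
    and "c \<odot>\<^bsub>presented_lie_algebra X R\<^esub> lie_class X R t = lie_class X R (Scale c t)"
    and "lie_bracket (presented_lie_algebra X R) (lie_class X R s) (lie_class X R t) = lie_class X R (Brk s t)"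
  using assms unfolding presented_lie_algebra_def
  by (auto simp: lie_class_def
      intro: lie_eq.trans lie_eq.cong_Add lie_eq.cong_Scale lie_eq.cong_Brk lie_eq.refl)

section \<open>Weights as functions on the Cartan subalgebra\<close>

context kac_moody
begin

lemma km_matrix_gcm: "km_matrix (gcm D) (ind D)"
  using gcm by unfold_locales (auto simp: gen_cartan_matrix_def)

definition wt :: "('h \<Rightarrow> complex) \<Rightarrow> 'i multiset \<Rightarrow> 'h \<Rightarrow> complex" where
  "wt \<Lambda> M h = \<Lambda> h - (\<Sum>k\<in>#M. root D k h)"

lemma wt_hdual:
  assumes "\<Lambda> \<in> hdual D" "set_mset M \<subseteq> ind D"
  shows "wt \<Lambda> M \<in> hdual D"
proof -
  have lin: "Vector_Spaces.linear (hscale D) (*) f \<longleftrightarrow>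
    (\<forall>x y. f (x + y) = f x + f y) \<and> (\<forall>c x. f (hscale D c x) = c * f x)" for f :: "'h \<Rightarrow> complex"
    using vector_space_h
    by (auto simp: Vector_Spaces.linear_def module_hom_def module_hom_axioms_def
        vector_space_def Modules.module_def algebra_simps)
  have r: "root D k \<in> hdual D" if "k \<in># M" for k using that assms(2) root_dual by auto
  have "(\<Sum>k\<in>#M. root D k (x + y)) = (\<Sum>k\<in>#M. root D k x) + (\<Sum>k\<in>#M. root D k y)"
    "(\<Sum>k\<in>#M. root D k (hscale D c x)) = c * (\<Sum>k\<in>#M. root D k x)" for x y c
    using r by (induction M) (auto simp: hdual_def lin algebra_simps)
  then show ?thesis using assms(1) by (auto simp: hdual_def lin wt_def algebra_simps)
qed

lemma wt_coroot:
  assumes "i \<in> ind D" "set_mset M \<subseteq> ind D"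
  shows "wt \<Lambda> M (coroot D i) = free_verma.cw (gcm D) (\<lambda>i. \<Lambda> (coroot D i)) i M"
  using assms(2) assms(1) pairing
  by (induction M) (auto simp: wt_def free_verma.cw_def)

text \<open>Linear independence of the simple roots recovers the content from the weight.\<close>

lemma wt_inj:
  assumes "set_mset M \<subseteq> ind D" "set_mset M' \<subseteq> ind D" "wt \<Lambda> M = wt \<Lambda> M'"
  shows "M = M'"
proof -
  interpret fs: vector_space "fun_scale :: complex \<Rightarrow> ('h \<Rightarrow> complex) \<Rightarrow> 'h \<Rightarrow> complex"
    by unfold_locales (auto simp: fun_eq_iff algebra_simps)
  define c where "c k = of_nat (count M k) - (of_nat (count M' k) :: complex)" for k
  have "(\<Sum>k\<in>ind D. c k * root D k h) = 0" for h
  proof -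
    have "(\<Sum>k\<in>#M. root D k h) = (\<Sum>k\<in>#M'. root D k h)"
      using fun_cong[OF assms(3), of h] by (simp add: wt_def)
    then show ?thesis
      using assms(1,2) finite_ind
      by (simp add: sum_mset_count[of "ind D"] c_def algebra_simps sum_subtractf)
  qed
  then have z: "(\<Sum>k\<in>ind D. fun_scale (c k) (root D k)) = 0"
    by (intro ext) (simp add: sum_apply)
  \<comment> \<open>Moves the coefficients from indices to roots, over which independence is
    formulated; the roots are distinct.\<close>
  define d where "d r = c (inv_into (ind D) (root D) r)" for r
  have d: "d (root D k) = c k" if "k \<in> ind D" for k
    unfolding d_def using that inj_root by (simp only: inv_into_f_f)
  have "(\<Sum>r\<in>root D ` ind D. fun_scale (d r) r) = (\<Sum>k\<in>ind D. fun_scale (d (root D k)) (root D k))"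
    using inj_root by (simp only: sum.reindex o_def)
  also have "\<dots> = 0" using z d by (simp cong: sum.cong)
  finally have "\<forall>r\<in>root D ` ind D. d r = 0"
    using independent_root unfolding fs.dependent_finite[OF finite_imageI[OF finite_ind]] by blast
  then have "c k = 0" if "k \<in> ind D" for k using that d by auto
  then have "count M k = count M' k" if "k \<in> ind D" for k using that by (simp add: c_def)
  moreover have "count M k = count M' k" if "k \<notin> ind D" for k
    using that assms(1,2) by (metis count_eq_zero_iff subsetD)
  ultimately show ?thesis by (intro multiset_eqI) blast
qed

abbreviation cls :: "('i, 'h) km_gen lie_term \<Rightarrow> ('i, 'h) km_elt" where
  "cls \<equiv> lie_class (km_gens D) (km_rels D)"

abbreviation ok :: "('i, 'h) km_gen lie_term \<Rightarrow> bool" where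
  "ok t \<equiv> set_lie_term t \<subseteq> km_gens D"

lemma mem_gens [simp]:
  "H h \<in> km_gens D" "i \<in> ind D \<Longrightarrow> E i \<in> km_gens D" "i \<in> ind D \<Longrightarrow> F i \<in> km_gens D"
  by (auto simp: km_gens_def)

lemma cls_carrier [simp]: "ok t \<Longrightarrow> cls t \<in> carrier (km_algebra D)"
  unfolding km_algebra_def by (rule lie_class_carrier)

lemma cls_ops:
  assumes "ok s" "ok t"
  shows "cls s \<oplus>\<^bsub>km_algebra D\<^esub> cls t = cls (Add s t)" "c \<odot>\<^bsub>km_algebra D\<^esub> cls t = cls (Scale c t)"
    "lie_bracket (km_algebra D) (cls s) (cls t) = cls (Brk s t)"
  using lie_class_ops[OF assms] by (simp_all add: km_algebra_def)

end

section \<open>The action of the generators on a highest weight module\<close>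

locale hw_module = kac_moody D
  for D :: "('i, 'h::ab_group_add) km_data" +
  fixes \<Lambda> :: "'h \<Rightarrow> complex" and V :: "(complex, 'v) module"
    and act :: "('i, 'h) km_elt \<Rightarrow> 'v \<Rightarrow> 'v" and v0 :: 'v
  assumes \<Lambda>_dual: "\<Lambda> \<in> hdual D"
    and lie_module: "lie_module complex_field (km_algebra D) V act"
    and v0_nonzero: "v0 \<noteq> \<zero>\<^bsub>V\<^esub>"
    and v0_weight: "v0 \<in> weight_space D V act \<Lambda>"
    and v0_E: "i \<in> ind D \<Longrightarrow> act (km_elem D (E i)) v0 = \<zero>\<^bsub>V\<^esub>"
    and v0_generates: "lie_submodule complex_field (km_algebra D) V act S \<Longrightarrow> v0 \<in> S \<Longrightarrow> S = carrier V"
begin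

sublocale M: lie_module complex_field "km_algebra D" V act
  by (rule lie_module)

lemma act_carrier [simp, intro]: "ok t \<Longrightarrow> x \<in> carrier V \<Longrightarrow> act (cls t) x \<in> carrier V"
  by (rule M.act_closed) auto

lemma act_cls:
  assumes "ok s" "ok t" "x \<in> carrier V"
  shows "act (cls (Add s t)) x = act (cls s) x \<oplus>\<^bsub>V\<^esub> act (cls t) x"
    and "act (cls (Scale c t)) x = c \<odot>\<^bsub>V\<^esub> act (cls t) x"
    and "act (cls (Brk s t)) x = act (cls s) (act (cls t) x) \<ominus>\<^bsub>V\<^esub> act (cls t) (act (cls s) x)"
  using M.act_add_left[of "cls s" "cls t" x] M.act_smult_left[of c "cls t" x]
    M.act_bracket[of "cls s" "cls t" x] assms
  by (simp_all add: cls_ops)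

lemma act_zero_right:
  assumes "ok t"
  shows "act (cls t) \<zero>\<^bsub>V\<^esub> = \<zero>\<^bsub>V\<^esub>"
  using M.act_smult_right[of 0 "cls t" "\<zero>\<^bsub>V\<^esub>"] M.V.smult_l_null assms by simp

lemma act_Zero:
  assumes "x \<in> carrier V"
  shows "act (cls Zero) x = \<zero>\<^bsub>V\<^esub>"
proof -
  \<comment> \<open>Derived from \<open>0 = - 1 + 1\<close> and the axiom for negatives.\<close>
  have "lie_eq (km_rels D) (Scale 0 Zero) Zero"
  proof -
    have "lie_eq (km_rels D) (Scale (- 1 + 1) Zero) (Add (Scale (- 1) Zero) (Scale 1 Zero))"
      by (rule lie_eq.Scale_add)
    moreover have "lie_eq (km_rels D) (Add (Scale (- 1) Zero) (Scale 1 Zero)) (Add (Scale (- 1) Zero) Zero)"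
      by (intro lie_eq.cong_Add lie_eq.refl lie_eq.Scale_one)
    ultimately have "lie_eq (km_rels D) (Scale (- 1 + 1) Zero) (Add (Scale (- 1) Zero) Zero)"
      by (rule lie_eq.trans)
    from lie_eq.trans[OF this lie_eq.Add_neg] show ?thesis by simp
  qed
  then have "cls Zero = cls (Scale 0 Zero)" by (rule lie_class_eqI[symmetric])
  then show ?thesis using act_cls(2)[of Zero Zero x 0] assms M.V.smult_l_null by simp
qed

lemma act_rel: "(s, t) \<in> km_rels D \<Longrightarrow> act (cls s) x = act (cls t) x"
  using lie_class_eqI[OF lie_eq.rel] by metis

lemma sub_add: "a \<in> carrier V \<Longrightarrow> b \<in> carrier V \<Longrightarrow> (a \<ominus>\<^bsub>V\<^esub> b) \<oplus>\<^bsub>V\<^esub> b = a"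
  by (simp add: a_minus_def M.V.M.a_assoc M.V.M.l_neg)

abbreviation "Hact h \<equiv> act (cls (Gen (H h)))"
abbreviation "Eact i \<equiv> act (cls (Gen (E i)))"
abbreviation "Fact i \<equiv> act (cls (Gen (F i)))"

lemma Hact_Fact:
  assumes "y \<in> carrier V" "j \<in> ind D" "Hact h y = c \<odot>\<^bsub>V\<^esub> y"
  shows "Hact h (Fact j y) = (c - root D j h) \<odot>\<^bsub>V\<^esub> Fact j y"
proof -
  have "(Brk (Gen (H h)) (Gen (F j)), Scale (- root D j h) (Gen (F j))) \<in> km_rels D"
    using assms(2) by (auto simp: km_rels_def)
  from act_rel[OF this, of y]
  have "Hact h (Fact j y) \<ominus>\<^bsub>V\<^esub> Fact j (Hact h y) = (- root D j h) \<odot>\<^bsub>V\<^esub> Fact j y"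
    using assms(1,2) act_cls(2)[of "Gen (F j)" "Gen (F j)"] act_cls(3)[of "Gen (H h)" "Gen (F j)"]
      by simp
  moreover have "Fact j (Hact h y) = c \<odot>\<^bsub>V\<^esub> Fact j y"
    using assms M.act_smult_right[of c "cls (Gen (F j))" y] by simp
  ultimately have "Hact h (Fact j y) = (- root D j h) \<odot>\<^bsub>V\<^esub> Fact j y \<oplus>\<^bsub>V\<^esub> c \<odot>\<^bsub>V\<^esub> Fact j y"
    using sub_add[of "Hact h (Fact j y)" "Fact j (Hact h y)"] assms by simp
  also have "\<dots> = (c - root D j h) \<odot>\<^bsub>V\<^esub> Fact j y"
    using M.V.smult_l_distr[of "- root D j h" c "Fact j y"] assms by simp
  finally show ?thesis .
qed

lemma Eact_Fact:
  assumes "y \<in> carrier V" "i \<in> ind D" "j \<in> ind D"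
  shows "Eact i (Fact j y) = Fact j (Eact i y) \<oplus>\<^bsub>V\<^esub> (if i = j then Hact (coroot D i) y else \<zero>\<^bsub>V\<^esub>)"
proof -
  have "(Brk (Gen (E i)) (Gen (F j)), if i = j then Gen (H (coroot D i)) else Zero) \<in> km_rels D"
    using assms(2,3) by (auto simp: km_rels_def)
  from act_rel[OF this, of y]
  have "Eact i (Fact j y) \<ominus>\<^bsub>V\<^esub> Fact j (Eact i y) = (if i = j then Hact (coroot D i) y else \<zero>\<^bsub>V\<^esub>)"
    using assms act_cls(3)[of "Gen (E i)" "Gen (F j)" y] by (simp add: act_Zero split: if_splits)
  then show ?thesis
    using sub_add[of "Eact i (Fact j y)" "Fact j (Eact i y)"] assms
    by (simp add: M.V.M.a_comm split: if_splits)
qed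

section \<open>Evaluation of the free Verma module at the highest weight vector\<close>

primrec evw :: "'i list \<Rightarrow> 'v" where
  "evw [] = v0"
| "evw (i # w) = (if i \<in> ind D then Fact i (evw w) else \<zero>\<^bsub>V\<^esub>)"

lemma evw_carrier [simp]: "evw w \<in> carrier V"
  using v0_weight by (induction w) (auto simp: weight_space_def)

lemma evw_bad: "\<not> set w \<subseteq> ind D \<Longrightarrow> evw w = \<zero>\<^bsub>V\<^esub>"
  by (induction w) (auto simp: act_zero_right)

lemma evw_weight: "Hact h (evw w) = wt \<Lambda> (mset w) h \<odot>\<^bsub>V\<^esub> evw w"
proof (induction w)
  case Nil
  then show ?case using v0_weight by (simp add: weight_space_def km_elem_def wt_def)
next
  case (Cons j w)
  show ?case
  proof (cases "j \<in> ind D")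
    case True
    then show ?thesis using Hact_Fact[OF _ True Cons.IH] by (simp add: wt_def algebra_simps)
  qed (simp add: act_zero_right M.V.smult_r_null)
qed

definition ev :: "('i list \<Rightarrow>\<^sub>0 complex) \<Rightarrow> 'v" where
  "ev x = finsum V (\<lambda>w. lookup x w \<odot>\<^bsub>V\<^esub> evw w) (keys x)"

lemma ev_superset:
  assumes "finite S" "keys x \<subseteq> S"
  shows "ev x = finsum V (\<lambda>w. lookup x w \<odot>\<^bsub>V\<^esub> evw w) S"
  unfolding ev_def using assms
  by (intro M.V.M.finsum_mono_neutral_cong_left) (auto simp: in_keys_iff M.V.smult_l_null[simplified])

lemma ev_carrier [simp]: "ev x \<in> carrier V"
  unfolding ev_def by (intro M.V.M.finsum_closed) auto

lemma ev_word [simp]: "ev (word w) = evw w"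
  unfolding ev_def
    using M.V.M.finsum_insert[of "{}" w "\<lambda>v. lookup (word w) v \<odot>\<^bsub>V\<^esub> evw v"]
    M.V.smult_one[simplified] by simp

lemma ev_add [simp]: "ev (x + y) = ev x \<oplus>\<^bsub>V\<^esub> ev y"
proof -
  let ?S = "keys x \<union> keys y"
  have "keys (x + y) \<subseteq> ?S" by (rule keys_add)
  then have "ev (x + y) = finsum V (\<lambda>w. lookup x w \<odot>\<^bsub>V\<^esub> evw w \<oplus>\<^bsub>V\<^esub> lookup y w \<odot>\<^bsub>V\<^esub> evw w) ?S"
    by (subst ev_superset[of ?S]) (auto simp: lookup_add M.V.smult_l_distr[simplified])
  also have "\<dots> = ev x \<oplus>\<^bsub>V\<^esub> ev y"
    by (subst M.V.M.finsum_addf) (auto simp: ev_superset[of ?S])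
  finally show ?thesis .
qed

lemma ev_scl [simp]: "ev (scl c x) = c \<odot>\<^bsub>V\<^esub> ev x"
proof -
  have "ev (scl c x) = finsum V (\<lambda>w. c \<odot>\<^bsub>V\<^esub> (lookup x w \<odot>\<^bsub>V\<^esub> evw w)) (keys x)"
    using keys_scl[of c x]
      by (subst ev_superset[of "keys x"]) (auto simp: lookup_scl M.V.smult_assoc1[simplified])
  also have "\<dots> = c \<odot>\<^bsub>V\<^esub> ev x"
    unfolding ev_def by (rule M.V.finsum_smult_ldistr[symmetric]) auto
  finally show ?thesis .
qed

lemma ev_zero [simp]: "ev 0 = \<zero>\<^bsub>V\<^esub>"
  by (simp add: ev_def)

lemma ev_diff: "ev (x - y) = ev x \<ominus>\<^bsub>V\<^esub> ev y"
proof -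
  have "ev (x - y) \<oplus>\<^bsub>V\<^esub> ev y = ev x" by (simp flip: ev_add)
  then show ?thesis
    using M.V.M.a_assoc[of "ev (x - y)" "ev y" "\<ominus>\<^bsub>V\<^esub> ev y"]
      by (simp add: a_minus_def M.V.M.r_neg)
qed

lemma act_ev_linear:
  assumes "ok t" "\<And>x y. T (x + y) = T x + T y" "\<And>c x. T (scl c x) = scl c (T x)"
    and "\<And>w. ev (T (word w)) = act (cls t) (evw w)"
  shows "ev (T x) = act (cls t) (ev x)"
proof (induction x rule: words_induct)
  case (scl c x)
  then show ?case using assms M.act_smult_right[of c "cls t" "ev x"] by simp
next
  case (add x y)
  then show ?case using assms M.act_add_right[of "cls t" "ev x" "ev y"] by simp
qed (use assms in simp)

lemma ev_fop: "i \<in> ind D \<Longrightarrow> ev (fop i x) = Fact i (ev x)"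
  by (rule act_ev_linear) simp_all

lemma ev_fop_bad: "i \<notin> ind D \<Longrightarrow> ev (fop i x) = \<zero>\<^bsub>V\<^esub>"
  by (induction x rule: words_induct) (simp_all add: M.V.smult_r_null[simplified])

lemma ev_diag: "ev (diag (\<lambda>w. wt \<Lambda> (mset w) h) x) = Hact h (ev x)"
  by (rule act_ev_linear) (simp_all add: evw_weight)

sublocale km_matrix "gcm D" "\<lambda>i. \<Lambda> (coroot D i)" "ind D"
  by (rule km_matrix_gcm)

text \<open>Both sides obey the recursion of \<open>ew\<close>, the module side by
  \<open>Eact_Fact\<close>.\<close>

lemma ev_eop: "i \<in> ind D \<Longrightarrow> ev (eop i x) = Eact i (ev x)"
proof (rule act_ev_linear)
  fix w assume i: "i \<in> ind D"
  have "ev (ew i w) = Eact i (evw w)"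
  proof (induction w)
    case Nil
    then show ?case using v0_E[OF i] by (simp add: km_elem_def)
  next
    case (Cons j w)
    show ?case
    proof (cases "j \<in> ind D")
      case True
      \<comment> \<open>\<open>wt_coroot\<close> applies to words over \<open>ind D\<close>; all
        other words evaluate to zero.\<close>
      have "cw i (mset w) \<odot>\<^bsub>V\<^esub> evw w = Hact (coroot D i) (evw w)"
      proof (cases "set w \<subseteq> ind D")
        case True
        then show ?thesis using wt_coroot[OF i, of "mset w" \<Lambda>] by (simp add: evw_weight)
      qed (simp add: evw_bad act_zero_right M.V.smult_r_null[simplified])
      then show ?thesis
        using Eact_Fact[OF _ i True, of "evw w"] True i Cons.IH by (auto simp: ev_fop)
    next
      case False
      then show ?thesis using i by (auto simp: ev_fop_bad act_zero_right)
    qed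
  qed
  then show "ev (eop i (word w)) = Eact i (evw w)" by simp
qed simp_all

lemma ok_serre: "i \<in> ind D \<Longrightarrow> j \<in> ind D \<Longrightarrow> ok ((Brk (Gen (F i)) ^^ n) (Gen (F j)))"
  by (induction n) (auto simp: km_gens_def)

lemma ev_serre_term:
  assumes "i \<in> ind D" "j \<in> ind D"
  shows "ev (serre n i j x) = act (cls ((Brk (Gen (F i)) ^^ n) (Gen (F j)))) (ev x)"
proof (induction n arbitrary: x)
  case 0
  then show ?case using assms by (simp add: ev_fop)
next
  case (Suc n)
  then show ?case using assms ok_serre[OF assms, of n] by (simp add: ev_diff ev_fop act_cls)
qed

section \<open>The kernel of evaluation, and the invariants of the module in terms of it\<close>

definition kernel :: "('i list \<Rightarrow>\<^sub>0 complex) set" where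
  "kernel = {x. ev x = \<zero>\<^bsub>V\<^esub>}"

sublocale K: verma_ideal "gcm D" "\<lambda>i. \<Lambda> (coroot D i)" "ind D" kernel
proof
  show "pm.subspace kernel"
    by (auto simp: pm.subspace_def kernel_def M.V.smult_r_null[simplified])
  show "fop i x \<in> kernel" if "x \<in> kernel" for i x
    using that ev_fop[of i x] ev_fop_bad[of i x]
      by (cases "i \<in> ind D") (auto simp: kernel_def act_zero_right)
  show "eop i x \<in> kernel" if "i \<in> ind D" "x \<in> kernel" for i x
    using that by (auto simp: kernel_def act_zero_right ev_eop)
  show "word [] \<notin> kernel" using v0_nonzero by (simp add: kernel_def)
  show "fop i x \<in> kernel" if "i \<notin> ind D" for i x
    using that ev_fop_bad by (simp add: kernel_def)
  show "serre (nat (1 - gcm D i j)) i j x \<in> kernel"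
    if "i \<in> ind D" "j \<in> ind D" "i \<noteq> j" for i j x
  proof -
    have r: "((Brk (Gen (F i)) ^^ nat (1 - gcm D i j)) (Gen (F j)), Zero) \<in> km_rels D"
      using that by (auto simp: km_rels_def)
    show ?thesis using act_rel[OF r] act_Zero ev_serre_term that by (simp add: kernel_def)
  qed
qed

text \<open>The image is a submodule containing the generator \<open>v0\<close>.\<close>

lemma range_ev: "range ev = carrier V"
proof (rule v0_generates[of "range ev"])
  show "v0 \<in> range ev" by (metis ev_word evw.simps(1) rangeI)
  have "submodule (range ev) complex_field V"
  proof (rule M.V.submoduleI)
    show "\<zero>\<^bsub>V\<^esub> \<in> range ev" by (metis ev_zero rangeI)
    show "\<ominus>\<^bsub>V\<^esub> a \<in> range ev" if "a \<in> range ev" for a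
    proof -
      from that obtain x where "a = ev x" by blast
      then have "\<ominus>\<^bsub>V\<^esub> a = ev (0 - x)"
        by (simp only: ev_diff) (simp add: a_minus_def)
      then show ?thesis by blast
    qed
    show "a \<oplus>\<^bsub>V\<^esub> b \<in> range ev" if "a \<in> range ev" "b \<in> range ev"
      for a b
      using that by (auto simp flip: ev_add)
    show "c \<odot>\<^bsub>V\<^esub> a \<in> range ev" if "a \<in> range ev" for c a
      using that by (auto simp flip: ev_scl)
  qed auto
  \<comment> \<open>Stability under the generators extends to all Lie terms, because brackets act by
    commutators.\<close>
  moreover have "act (cls t) (ev x) \<in> range ev" if "ok t" for t x
    using that
  proof (induction t arbitrary: x)
    case (Gen g)
    then consider h where "g = H h" | i where "i \<in> ind D" "g = E i" | i
      where "i \<in> ind D" "g = F i"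
      by (auto simp: km_gens_def)
    then show ?case by cases (auto simp flip: ev_diag ev_eop ev_fop)
  next
    case Zero
    then show ?case using act_Zero[of "ev x"] by (metis ev_carrier ev_zero rangeI)
  next
    case (Add s t)
    then obtain y z where "act (cls s) (ev x) = ev y" "act (cls t) (ev x) = ev z" by fastforce
    then show ?case using Add.prems by (auto simp: act_cls simp flip: ev_add)
  next
    case (Scale c t)
    then obtain y where "act (cls t) (ev x) = ev y" by fastforce
    then show ?case using Scale.prems by (auto simp: act_cls simp flip: ev_scl)
  next
    case (Brk s t)
    then obtain y z where yz: "act (cls s) (ev x) = ev y" "act (cls t) (ev x) = ev z" by fastforce
    then obtain y' z' where "act (cls s) (ev z) = ev z'" "act (cls t) (ev y) = ev y'"
      using Brk by fastforce
    then show ?case using yz Brk.prems by (auto simp: act_cls simp flip: ev_diff)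
  qed
  then have "act a v \<in> range ev" if "a \<in> carrier (km_algebra D)" "v \<in> range ev" for a v
    using that by (auto simp: km_algebra_def presented_lie_algebra_def)
  ultimately show "lie_submodule complex_field (km_algebra D) V act (range ev)"
    unfolding lie_submodule_def by blast
qed

lemma integrability_eq: "integrability D V act = K.integ"
proof -
  have p: "ev ((fop i ^^ n) x) = (Fact i ^^ n) (ev x)" if "i \<in> ind D" for i n x
    using that by (induction n) (simp_all add: ev_fop)
  show ?thesis
    unfolding integrability_def K.integ_def range_ev[symmetric] km_elem_def
    by (auto simp: kernel_def p)
qed

lemma weights_eq: "weights D V act = wt \<Lambda> ` K.wts"
proof (intro equalityI subsetI)
  fix \<mu> assume "\<mu> \<in> wt \<Lambda> ` K.wts"
  then obtain w where w: "word w \<notin> kernel" "\<mu> = wt \<Lambda> (mset w)"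
    by (auto simp: K.wts_def)
  have "set w \<subseteq> ind D" using w(1) K.word_bad_N by blast
  then have "\<mu> \<in> hdual D" using wt_hdual[OF \<Lambda>_dual, of "mset w"] w(2) by simp
  moreover have "evw w \<in> weight_space D V act \<mu>"
    using evw_weight w(2) by (simp add: weight_space_def km_elem_def)
  moreover have "evw w \<noteq> \<zero>\<^bsub>V\<^esub>" using w(1) by (simp add: kernel_def)
  ultimately show "\<mu> \<in> weights D V act" by (auto simp: weights_def)
next
  fix \<mu> assume "\<mu> \<in> weights D V act"
  moreover have "\<zero>\<^bsub>V\<^esub> \<in> weight_space D V act \<mu>"
    by (simp add: weight_space_def km_elem_def act_zero_right M.V.smult_r_null[simplified])
  ultimately obtain v
    where v: "v \<in> weight_space D V act \<mu>" "v \<noteq> \<zero>\<^bsub>V\<^esub>" by (auto simp: weights_def)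
  then obtain t where t: "v = ev t" using range_ev by (auto simp: weight_space_def)
  have "\<exists>w. word w \<notin> kernel \<and> wt \<Lambda> (mset w) = \<mu>"
  proof (rule extract_weight[OF K.subspace_N])
    show "diag (\<lambda>w. wt \<Lambda> (mset w) h) x \<in> kernel" if "x \<in> kernel" for h x
      using that by (simp add: kernel_def ev_diag act_zero_right)
    show "t \<notin> kernel" using v t by (simp add: kernel_def)
    show "diag (\<lambda>w. wt \<Lambda> (mset w) h) t - scl (\<mu> h) t \<in> kernel" for h
      using v(1) t
        by (simp add: kernel_def ev_diff ev_diag weight_space_def km_elem_def a_minus_def M.V.M.r_neg)
  qed
  then show "\<mu> \<in> wt \<Lambda> ` K.wts" by (auto simp: K.wts_def)
qed

end

section \<open>Modules defined by ideals\<close>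

lemma sequences_inject_complex: "\<exists>f :: (nat \<Rightarrow> complex) \<Rightarrow> complex. inj f"
proof -
  obtain b :: "nat set \<Rightarrow> real" where b: "bij b"
    using nat_sets_eqpoll_reals by (auto simp: eqpoll_def)
  define a where "a = inv_into UNIV b"
  have a: "a x = a y \<longleftrightarrow> x = y" for x y
    using b unfolding a_def by (metis bij_betw_def inv_into_injective surjD surj_f_inv_f)
  \<comment> \<open>A sequence is coded by one set of naturals: \<open>n\<close> marks the entry,
    the tags 0 and 1 its real and imaginary part.\<close>
  define S :: "(nat \<Rightarrow> complex) \<Rightarrow> nat set" where
    "S f = {prod_encode (n, prod_encode (0, m)) | n m. m \<in> a (Re (f n))}
      \<union> {prod_encode (n, prod_encode (1, m)) | n m. m \<in> a (Im (f n))}" for f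
  have S: "prod_encode (n, prod_encode (0, m)) \<in> S f \<longleftrightarrow> m \<in> a (Re (f n))"
    "prod_encode (n, prod_encode (1, m)) \<in> S f \<longleftrightarrow> m \<in> a (Im (f n))" for n m f
    by (auto simp: S_def)
  have "f = g" if e: "S f = S g" for f g
  proof
    fix n
    have "a (Re (f n)) = a (Re (g n))" "a (Im (f n)) = a (Im (g n))"
      using S e by blast+
    then show "f n = g n" by (simp add: a complex_eq_iff)
  qed
  then have "inj S" by (rule injI)
  then have "inj (complex_of_real \<circ> b \<circ> S)"
    using b by (intro inj_compose) (auto simp: bij_def inj_on_def)
  then show ?thesis by blast
qed

context verma_ideal
begin

text \<open>Every coset has a representative supported on the countably many words over the finite
  set \<open>I\<close>. Its coefficients form a sequence, which is coded by a complex number and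
  then by an element of the target type.\<close>

lemma quotient_map:
  assumes I: "finite I" and large: "large_type TYPE('v)"
  obtains q :: "('i list \<Rightarrow>\<^sub>0 complex) \<Rightarrow> 'v"
    where "\<And>x y. q x = q y \<longleftrightarrow> x - y \<in> N"
proof -
  obtain \<iota> :: "complex \<Rightarrow> 'v" where \<iota>: "inj \<iota>" using large
    by (auto simp: large_type_def)
  obtain \<kappa> :: "(nat \<Rightarrow> complex) \<Rightarrow> complex"
    where \<kappa>: "inj \<kappa>" using sequences_inject_complex by blast
  define coeffs where "coeffs x n = lookup x (from_nat_into (lists I) n)"
    for x :: "'i list \<Rightarrow>\<^sub>0 complex" and n
  have coeffs: "x = y"
    if "keys x \<subseteq> lists I" "keys y \<subseteq> lists I" "coeffs x = coeffs y" for x y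
  proof (rule poly_mapping_eqI)
    fix w
    have "countable (lists I)" using I by (intro countable_lists countable_finite)
    then show "lookup x w = lookup y w"
      using that fun_cong[OF that(3)] unfolding coeffs_def
      by (cases "w \<in> lists I") (metis from_nat_into_surj, metis in_keys_iff subsetD)
  qed
  have ex: "\<exists>y. keys y \<subseteq> lists I \<and> y - x \<in> N" for x
  proof (induction x rule: words_induct)
    case (word w)
    show ?case
    proof (cases "set w \<subseteq> I")
      case True
      then show ?thesis by (intro exI[of _ "word w"]) auto
    next
      case False
      then have "scl (- 1) (word w) \<in> N" by (intro N_scl word_bad_N)
      then show ?thesis by (intro exI[of _ 0]) simp
    qed
  next
    case (scl c x)
    then obtain y where "keys y \<subseteq> lists I" "y - x \<in> N" by blast
    then show ?case
      using N_scl[of "y - x" c] keys_scl[of c y]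
      by (intro exI[of _ "scl c y"]) (auto simp: pm.scale_right_diff_distrib)
  next
    case (add x1 x2)
    then obtain y1 y2
      where y: "keys y1 \<subseteq> lists I" "y1 - x1 \<in> N" "keys y2 \<subseteq> lists I" "y2 - x2 \<in> N" by blast
    have "y1 + y2 - (x1 + x2) = (y1 - x1) + (y2 - x2)" by simp
    then have "y1 + y2 - (x1 + x2) \<in> N" using N_add y by metis
    then show ?case using keys_add[of y1 y2] y by (intro exI[of _ "y1 + y2"]) blast
  qed
  define rep where "rep x = (SOME y. keys y \<subseteq> lists I \<and> y - x \<in> N)" for x
  have rep: "keys (rep x) \<subseteq> lists I" "rep x - x \<in> N" for x
    using someI_ex[OF ex[of x]] by (simp_all add: rep_def)
  have sym: "a - b \<in> N" if "b - a \<in> N" for a b using N_scl[OF that, of "- 1"] by simp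
  have trans: "a - c \<in> N" if "a - b \<in> N" "b - c \<in> N" for a b c using N_add[OF that]
    by simp
  have "rep x = rep y \<longleftrightarrow> x - y \<in> N" for x y
  proof
    assume "rep x = rep y"
    then show "x - y \<in> N" using rep(2)[of x] rep(2)[of y] sym trans by metis
  next
    assume "x - y \<in> N"
    \<comment> \<open>The two choice predicates coincide, so the same representative is
      chosen.\<close>
    then have "z - x \<in> N \<longleftrightarrow> z - y \<in> N" for z using sym trans by blast
    then show "rep x = rep y" by (simp add: rep_def)
  qed
  moreover have "coeffs (rep x) = coeffs (rep y) \<longleftrightarrow> rep x = rep y" for x y
    using coeffs[OF rep(1) rep(1), of x y] by auto
  ultimately show thesis
    using \<iota> \<kappa>
      by (intro that[of "\<lambda>x. \<iota> (\<kappa> (coeffs (rep x)))"]) (simp add: inj_eq)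
qed

end

section \<open>The Serre relations for the \<open>e_i\<close>\<close>

context km_matrix
begin

text \<open>The operator \<open>(ad e_i)^n e_j\<close>; its commutation with the \<open>f_k\<close>
  mirrors that of \<open>serre\<close> with the \<open>e_k\<close>.\<close>

primrec eserre :: "nat \<Rightarrow> 'i \<Rightarrow> 'i \<Rightarrow> ('i list \<Rightarrow>\<^sub>0 complex) \<Rightarrow> ('i list \<Rightarrow>\<^sub>0 complex)" where
  "eserre 0 i j x = eop j x"
| "eserre (Suc n) i j x = eop i (eserre n i j x) - eserre n i j (eop i x)"

lemma eserre_linear [simp]:
  "eserre n i j (x + y) = eserre n i j x + eserre n i j y"
  "eserre n i j (scl c x) = scl c (eserre n i j x)"
  by (induction n arbitrary: x y) (simp_all add: pm.scale_right_diff_distrib)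

lemmas eserre_zero_diff [simp] = additive_zero_diff[of "eserre n i j" for n i j, OF eserre_linear(1)]

lemma hop_eserre:
  assumes "A i i = 2"
  shows "hop i (eserre n i j x) = eserre n i j (hop i x) + scl (of_int (2 * int n + A i j)) (eserre n i j x)"
proof (induction n arbitrary: x)
  case (Suc n)
  have "hop i (eserre (Suc n) i j x) =
    eop i (hop i (eserre n i j x)) + scl 2 (eop i (eserre n i j x)) - hop i (eserre n i j (eop i x))"
    using assms by (simp add: hop_eop)
  also have "\<dots> = eserre (Suc n) i j (hop i x)
    + (scl (of_int (2 * int n + A i j)) (eserre (Suc n) i j x) + scl 2 (eserre (Suc n) i j x))"
    unfolding Suc.IH using assms by (simp add: hop_eop pm.scale_right_diff_distrib)
  also have "\<dots> = eserre (Suc n) i j (hop i x)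
    + scl (of_int (2 * int (Suc n) + A i j)) (eserre (Suc n) i j x)"
    unfolding pm.scale_left_distrib[symmetric] by (simp add: algebra_simps)
  finally show ?case .
qed (simp add: hop_eop)

lemma eserre_fop_other:
  assumes "k \<noteq> i" "k \<noteq> j"
  shows "eserre n i j (fop k x) = fop k (eserre n i j x)"
  using assms by (induction n arbitrary: x) (auto simp: eop_fop)

lemma eserre_fop_right:
  assumes "i \<noteq> j"
  shows "eserre n i j (fop j x) = fop j (eserre n i j x)
    + (if n = 0 then hop j x else if n = 1 then - scl (of_int (A j i)) (eop i x) else 0)"
  using assms by (induction n arbitrary: x) (auto simp: eop_fop hop_eop)

lemma eserre_fop_left:
  assumes "A i i = 2" "i \<noteq> j"
  shows "eserre n i j (fop i x) = fop i (eserre n i j x)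
    + scl (of_int (int n * (A i j + int n - 1))) (eserre (n - 1) i j x)"
proof (induction n arbitrary: x)
  case 0
  then show ?case using assms by (simp add: eop_fop)
next
  case (Suc n)
  define c where "c = (of_int (int n * (A i j + int n - 1)) :: complex)"
  have low: "scl c (eop i (eserre (n - 1) i j x)) - scl c (eserre (n - 1) i j (eop i x)) = scl c (eserre n i j x)"
    by (cases n) (simp_all add: c_def pm.scale_right_diff_distrib)
  have "eserre (Suc n) i j (fop i x) =
    eop i (eserre n i j (fop i x)) - eserre n i j (fop i (eop i x)) - eserre n i j (hop i x)"
    by (simp add: eop_fop)
  also have "\<dots> = fop i (eserre (Suc n) i j x)
    + (scl c (eop i (eserre (n - 1) i j x)) - scl c (eserre (n - 1) i j (eop i x)))
    + (hop i (eserre n i j x) - eserre n i j (hop i x))"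
    unfolding Suc.IH c_def[symmetric] by (simp add: eop_fop)
  also have "\<dots> = fop i (eserre (Suc n) i j x)
    + (scl c (eserre n i j x) + scl (of_int (2 * int n + A i j)) (eserre n i j x))"
    unfolding low hop_eserre[of i, OF assms(1)] by simp
  also have "\<dots> = fop i (eserre (Suc n) i j x)
    + scl (of_int (int (Suc n) * (A i j + int (Suc n) - 1))) (eserre (Suc n - 1) i j x)"
    unfolding pm.scale_left_distrib[symmetric] by (simp add: c_def algebra_simps)
  finally show ?case .
qed

lemma eserre_fop:
  assumes "i \<in> I" "j \<in> I" "i \<noteq> j"
  shows "eserre (nat (1 - A i j)) i j (fop k x) = fop k (eserre (nat (1 - A i j)) i j x)"
proof -
  have a: "A i j \<le> 0" using A_off assms by blast
  consider "k = i" | "k = j" "k \<noteq> i" | "k \<noteq> i" "k \<noteq> j" by blast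
  then show ?thesis
  proof cases
    case 1
    then show ?thesis using eserre_fop_left[OF A_diag] assms a by simp
  next
    case 2
    then show ?thesis using eserre_fop_right[of i j] assms a A_zero_sym[of i j]
      by (auto simp: nat_eq_iff)
  qed (rule eserre_fop_other)
qed

text \<open>The Serre relations for the \<open>e\<^sub>i\<close> hold already in the free Verma module, since the Serre
  elements commute with all \<open>f\<^sub>k\<close> and kill the highest weight vector.\<close>

lemma eserre_zero:
  assumes "i \<in> I" "j \<in> I" "i \<noteq> j"
  shows "eserre (nat (1 - A i j)) i j x = 0"
proof (induction x rule: words_induct)
  case (word w)
  show ?case
  proof (induction w)
    case Nil
    have "eserre n i j (word []) = 0" for n by (induction n) auto
    then show ?case .
  next
    case (Cons k w)
    then show ?case using eserre_fop[OF assms, of k "word w"] by simp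
  qed
qed auto

end

text \<open>\<open>q\<close> plays the role of the projection onto the quotient by \<open>N\<close>.
  Stability under \<open>e_i\<close> and \<open>f_i\<close> gives stability under the coroots;
  \<open>diag_N\<close> extends it to the whole Cartan subalgebra.\<close>

locale quotient_module = kac_moody D + verma_ideal "gcm D" "\<lambda>i. \<Lambda> (coroot D i)" "ind D" N
  for D :: "('i, 'h::ab_group_add) km_data" and \<Lambda> :: "'h \<Rightarrow> complex" and N +
  fixes q :: "('i list \<Rightarrow>\<^sub>0 complex) \<Rightarrow> 'v"
  assumes dual: "\<Lambda> \<in> hdual D"
    and diag_N: "x \<in> N \<Longrightarrow> diag (\<lambda>w. wt \<Lambda> (mset w) h) x \<in> N"
    and q_eq: "q x = q y \<longleftrightarrow> x - y \<in> N"
begin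

abbreviation dg :: "'h \<Rightarrow> ('i list \<Rightarrow>\<^sub>0 complex) \<Rightarrow> ('i list \<Rightarrow>\<^sub>0 complex)" where
  "dg h \<equiv> diag (\<lambda>w. wt \<Lambda> (mset w) h)"

text \<open>\<open>E i\<close> with \<open>i\<close> outside \<open>ind D\<close> gets the default
  0, which keeps \<open>N\<close> stable under every operator.\<close>

fun gen_op :: "('i, 'h) km_gen \<Rightarrow> ('i list \<Rightarrow>\<^sub>0 complex) \<Rightarrow> ('i list \<Rightarrow>\<^sub>0 complex)" where
  "gen_op (H h) x = dg h x"
| "gen_op (E i) x = (if i \<in> ind D then eop i x else 0)"
| "gen_op (F i) x = fop i x"

primrec term_op :: "('i, 'h) km_gen lie_term \<Rightarrow> ('i list \<Rightarrow>\<^sub>0 complex) \<Rightarrow> ('i list \<Rightarrow>\<^sub>0 complex)" where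
  "term_op (Gen g) x = gen_op g x"
| "term_op Zero x = 0"
| "term_op (Add s t) x = term_op s x + term_op t x"
| "term_op (Scale c t) x = scl c (term_op t x)"
| "term_op (Brk s t) x = term_op s (term_op t x) - term_op t (term_op s x)"

lemma term_op_linear [simp]:
  "term_op t (x + y) = term_op t x + term_op t y" "term_op t (scl c x) = scl c (term_op t x)"
proof (induction t arbitrary: x y)
  case (Gen g)
  { case 1 show ?case by (cases g) auto }
  { case 2 show ?case by (cases g) auto }
qed (auto simp: algebra_simps pm.scale_right_distrib pm.scale_right_diff_distrib mult.commute)

lemmas term_op_zero_diff [simp] = additive_zero_diff[of "term_op t" for t, OF term_op_linear(1)]

lemma term_op_N: "x \<in> N \<Longrightarrow> term_op t x \<in> N"
proof (induction t arbitrary: x)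
  case (Gen g)
  then show ?case by (cases g) (auto intro: diag_N eop_N fop_N)
qed (auto intro: N_add N_scl N_diff)

text \<open>Words with a letter outside \<open>ind D\<close> lie in \<open>N\<close>, which
  \<open>T\<close> preserves, so only the other words remain to be checked.\<close>

lemma words_N_induct:
  assumes "\<And>w. set w \<subseteq> ind D \<Longrightarrow> T (word w) \<in> N" "\<And>x. x \<in> N \<Longrightarrow> T x \<in> N"
    "\<And>x y. T (x + y) = T x + T y" "\<And>c x. T (scl c x) = scl c (T x)"
  shows "T x \<in> N"
proof (induction x rule: words_induct)
  case (word w)
  then show ?case using assms(1,2) word_bad_N by blast
qed (simp_all add: assms(3,4) N_add N_scl)

lemma root_linear:
  assumes "f \<in> hdual D"
  shows "f (h + k) = f h + f k" "f (hscale D c h) = c * f h"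
proof -
  interpret f: Vector_Spaces.linear "hscale D" "(*)" f using assms by (simp add: hdual_def)
  show "f (h + k) = f h + f k" "f (hscale D c h) = c * f h" by (rule f.add, rule f.scale)
qed

lemma dg_fop: "dg h (fop i x) = fop i (dg h x) - scl (root D i h) (fop i x)"
proof (induction x rule: words_induct)
  case (scl c x)
  then show ?case by (simp add: pm.scale_right_diff_distrib mult.commute)
qed (simp_all add: wt_def pm.scale_left_diff_distrib pm.scale_right_distrib pm.scale_left_distrib)

lemma dg_eop: "dg h (eop i x) = eop i (dg h x) + scl (root D i h) (eop i x)"
proof (induction x rule: words_induct)
  case (word w)
  show ?case
  proof (cases "i \<in> set w")
    case True
    have "wt \<Lambda> (add_mset i M) h = wt \<Lambda> M h - root D i h" for M by (simp add: wt_def)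
    from this[of "mset w - {#i#}"] have "wt \<Lambda> (mset w - {#i#}) h = wt \<Lambda> (mset w) h + root D i h"
      using True by simp
    moreover have "dg h (ew i w) = scl (wt \<Lambda> (mset w - {#i#}) h) (ew i w)"
      using ew_cspace by (intro diag_cspace) blast
    ultimately show ?thesis by (simp add: pm.scale_left_distrib)
  qed (use ew_cspace in simp)
next
  case (scl c x)
  then show ?case by (simp add: pm.scale_right_distrib mult.commute)
qed (simp add: pm.scale_right_distrib)

lemma term_op_serre: "term_op ((Brk (Gen (F i)) ^^ n) (Gen (F j))) x = serre n i j x"
  by (induction n arbitrary: x) simp_all

lemma term_op_eserre:
  "i \<in> ind D \<Longrightarrow> j \<in> ind D \<Longrightarrow> term_op ((Brk (Gen (E i)) ^^ n) (Gen (E j))) x = eserre n i j x"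
  by (induction n arbitrary: x) simp_all

lemma term_op_rel:
  assumes "(s, t) \<in> km_rels D"
  shows "term_op s x - term_op t x \<in> N"
  using assms unfolding km_rels_def
proof (elim UnE CollectE exE conjE Pair_inject; clarify)
  fix h k
  \<comment> \<open>Linearity in \<open>h\<close> is available on words over \<open>ind D\<close>,
    where the weight belongs to the dual space.\<close>
  have "dg (h + k) x - (dg h x + dg k x) \<in> N"
  proof (rule words_N_induct[where T = "\<lambda>x. dg (h + k) x - (dg h x + dg k x)"])
    fix w assume "set w \<subseteq> ind D"
    then have "wt \<Lambda> (mset w) \<in> hdual D" using dual by (intro wt_hdual) auto
    then show "dg (h + k) (word w) - (dg h (word w) + dg k (word w)) \<in> N"
      by (simp add: root_linear pm.scale_left_distrib)
  qed (auto simp: pm.scale_right_distrib pm.scale_right_diff_distrib intro!: N_add N_diff diag_N)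
  then show "term_op (Gen (H (h + k))) x - term_op (Add (Gen (H h)) (Gen (H k))) x \<in> N" by simp
next
  fix c h
  have "dg (hscale D c h) x - scl c (dg h x) \<in> N"
  proof (rule words_N_induct[where T = "\<lambda>x. dg (hscale D c h) x - scl c (dg h x)"])
    fix w assume "set w \<subseteq> ind D"
    then have "wt \<Lambda> (mset w) \<in> hdual D" using dual by (intro wt_hdual) auto
    then show "dg (hscale D c h) (word w) - scl c (dg h (word w)) \<in> N"
      by (simp add: root_linear)
  qed (auto simp: pm.scale_right_distrib pm.scale_right_diff_distrib mult.commute intro!: N_scl N_diff diag_N)
  then show "term_op (Gen (H (hscale D c h))) x - term_op (Scale c (Gen (H h))) x \<in> N" by simp
next
  fix h k
  have "dg h (dg k x) = dg k (dg h x)"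
    by (induction x rule: words_induct) (simp_all add: mult.commute)
  then show "term_op (Brk (Gen (H h)) (Gen (H k))) x - term_op Zero x \<in> N" by simp
next
  fix h i assume "i \<in> ind D"
  then show "term_op (Brk (Gen (H h)) (Gen (E i))) x - term_op (Scale (root D i h) (Gen (E i))) x \<in> N"
    by (simp add: dg_eop)
next
  fix h i
  show "term_op (Brk (Gen (H h)) (Gen (F i))) x - term_op (Scale (- root D i h) (Gen (F i))) x \<in> N"
    by (simp add: dg_fop)
next
  fix i j assume ij: "i \<in> ind D" "j \<in> ind D"
  have "hop i x - dg (coroot D i) x \<in> N"
  proof (rule words_N_induct[where T = "\<lambda>x. hop i x - dg (coroot D i) x"])
    fix w assume "set w \<subseteq> ind D"
    then show "hop i (word w) - dg (coroot D i) (word w) \<in> N"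
      using wt_coroot[OF ij(1), of "mset w" \<Lambda>] by simp
  next
    fix x assume "x \<in> N"
    \<comment> \<open>\<open>h_i\<close> preserves \<open>N\<close>, being the commutator of
      \<open>e_i\<close> and \<open>f_i\<close>.\<close>
    then have "eop i (fop i x) - fop i (eop i x) \<in> N" using ij
      by (intro N_diff eop_N fop_N) auto
    then have "hop i x \<in> N" by (simp add: eop_fop)
    then show "hop i x - dg (coroot D i) x \<in> N" using \<open>x \<in> N\<close>
      by (intro N_diff diag_N)
  qed (auto simp: pm.scale_right_diff_distrib)
  then show "term_op (Brk (Gen (E i)) (Gen (F j))) x - term_op (if i = j then Gen (H (coroot D i)) else Zero) x \<in> N"
    using ij by (auto simp: eop_fop)
next
  fix i j assume "i \<in> ind D" "j \<in> ind D" "i \<noteq> j"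
  then show "term_op ((Brk (Gen (E i)) ^^ nat (1 - gcm D i j)) (Gen (E j))) x - term_op Zero x \<in> N"
    by (simp add: term_op_eserre eserre_zero)
next
  fix i j assume "i \<in> ind D" "j \<in> ind D" "i \<noteq> j"
  then show "term_op ((Brk (Gen (F i)) ^^ nat (1 - gcm D i j)) (Gen (F j))) x - term_op Zero x \<in> N"
    by (simp add: term_op_serre serre_N)
qed

text \<open>The Lie algebra axioms hold exactly for operators, and the Kac-Moody relations hold
  modulo \<open>N\<close>. Congruence under brackets uses that operators preserve
  \<open>N\<close>.\<close>

lemma term_op_sound: "lie_eq (km_rels D) s t \<Longrightarrow> term_op s x - term_op t x \<in> N"
proof (induction arbitrary: x rule: lie_eq.induct)
  case (rel s t)
  then show ?case by (rule term_op_rel)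
next
  case (sym s t)
  then show ?case using N_scl[of "term_op s x - term_op t x" "- 1"] by simp
next
  case (trans s t u)
  from N_add[OF trans.IH(1)[of x] trans.IH(2)[of x]] show ?case by simp
next
  case (cong_Add s s' t t')
  from N_add[OF cong_Add.IH(1)[of x] cong_Add.IH(2)[of x]] show ?case by (simp add: algebra_simps)
next
  case (cong_Scale t t' c)
  from N_scl[OF cong_Scale.IH[of x], of c] show ?case by (simp add: pm.scale_right_diff_distrib)
next
  case (cong_Brk s s' t t')
  have "(term_op s (term_op t x) - term_op s' (term_op t x)) + term_op s' (term_op t x - term_op t' x) \<in> N"
    "(term_op t (term_op s x) - term_op t' (term_op s x)) + term_op t' (term_op s x - term_op s' x) \<in> N"
    by (intro N_add term_op_N cong_Brk.IH)+
  from N_diff[OF this] show ?case by (simp add: algebra_simps)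
qed (simp_all add: pm.scale_right_distrib pm.scale_left_distrib pm.scale_right_diff_distrib algebra_simps)

section \<open>The module structure on the quotient\<close>

definition rp :: "'v \<Rightarrow> 'i list \<Rightarrow>\<^sub>0 complex" where
  "rp a = (SOME x. q x = a)"

lemma q_rp: "q (rp (q x)) = q x"
  unfolding rp_def by (rule someI_ex) blast

definition V :: "(complex, 'v) module" where
  "V = \<lparr>carrier = range q, monoid.mult = undefined, one = undefined, zero = q 0,
    add = (\<lambda>a b. q (rp a + rp b)), smult = (\<lambda>c a. q (scl c (rp a)))\<rparr>"

definition act :: "('i, 'h) km_elt \<Rightarrow> 'v \<Rightarrow> 'v" where
  "act a v = q (term_op (SOME t. t \<in> a) (rp v))"

lemma rp_diff: "rp (q x) - x \<in> N"
  using q_rp q_eq by blast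

lemma carrier_V: "carrier V = range q"
  by (simp add: V_def)

lemma zero_V: "\<zero>\<^bsub>V\<^esub> = q 0"
  by (simp add: V_def)

lemma add_V: "q x \<oplus>\<^bsub>V\<^esub> q y = q (x + y)"
proof -
  have "(rp (q x) - x) + (rp (q y) - y) \<in> N" by (intro N_add rp_diff)
  then show ?thesis by (simp add: V_def q_eq algebra_simps)
qed

lemma smult_V: "c \<odot>\<^bsub>V\<^esub> q x = q (scl c x)"
proof -
  have "scl c (rp (q x) - x) \<in> N" by (intro N_scl rp_diff)
  then show ?thesis by (simp add: V_def q_eq pm.scale_right_diff_distrib)
qed

text \<open>A different choice of term or of preimage changes the result by an element of
  \<open>N\<close> only.\<close>

lemma act_V:
  assumes "ok t"
  shows "act (cls t) (q x) = q (term_op t x)"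
proof -
  define s where "s = (SOME s. s \<in> cls t)"
  have "t \<in> cls t" using assms by (simp add: lie_class_def lie_eq.refl)
  then have "s \<in> cls t" unfolding s_def by (rule someI)
  then have "lie_eq (km_rels D) s t" by (simp add: lie_class_def)
  then have "(term_op s x - term_op t x) + term_op s (rp (q x) - x) \<in> N"
    by (intro N_add term_op_sound term_op_N rp_diff)
  then show ?thesis by (simp add: act_def s_def[symmetric] q_eq)
qed

lemma module_V: "Module.module complex_field V"
proof (rule Module.moduleI[OF cring_complex_field])
  show "abelian_group V"
  proof (rule abelian_groupI)
    fix x assume "x \<in> carrier V"
    then obtain y where "x = q y" by (auto simp: carrier_V)
    then show "\<exists>y\<in>carrier V. y \<oplus>\<^bsub>V\<^esub> x = \<zero>\<^bsub>V\<^esub>"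
      by (intro bexI[of _ "q (- y)"]) (auto simp: add_V zero_V carrier_V)
  qed (auto simp: carrier_V add_V zero_V algebra_simps)
qed (auto simp: carrier_V add_V smult_V pm.scale_left_distrib pm.scale_right_distrib)

interpretation Vm: Module.module complex_field V
  by (rule module_V)

lemma minus_V: "q x \<ominus>\<^bsub>V\<^esub> q y = q (x - y)"
proof -
  have "\<ominus>\<^bsub>V\<^esub> q y = q (- y)"
    by (rule Vm.minus_equality) (auto simp: add_V zero_V carrier_V)
  then show ?thesis by (simp add: a_minus_def add_V)
qed

lemma cls_carrierE:
  assumes "a \<in> carrier (km_algebra D)"
  obtains t where "a = cls t" "ok t"
  using assms by (auto simp: km_algebra_def presented_lie_algebra_def)

lemma lie_module_V: "lie_module complex_field (km_algebra D) V act"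
proof (intro lie_module.intro lie_module_axioms.intro module_V)
  show "lie_algebra complex_field (km_algebra D)"
    unfolding km_algebra_def by (rule lie_algebra_presented)
qed (auto elim!: cls_carrierE simp: carrier_V add_V smult_V minus_V act_V
    cls_ops)

lemma act_gen: "g \<in> km_gens D \<Longrightarrow> act (km_elem D g) (q x) = q (gen_op g x)"
  using act_V[of "Gen g"] by (simp add: km_elem_def)

sublocale hw: hw_module D \<Lambda> V act "q (word [])"
proof (intro hw_module.intro hw_module_axioms.intro kac_moody_axioms)
  show "\<Lambda> \<in> hdual D" by (rule dual)
  show "lie_module complex_field (km_algebra D) V act" by (rule lie_module_V)
  show "q (word []) \<noteq> \<zero>\<^bsub>V\<^esub>" using one_N by (simp add: zero_V q_eq)
  show "q (word []) \<in> weight_space D V act \<Lambda>"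
    by (auto simp: weight_space_def carrier_V act_gen smult_V wt_def)
  show "act (km_elem D (E i)) (q (word [])) = \<zero>\<^bsub>V\<^esub>" if "i \<in> ind D" for i
    using that by (simp add: act_gen zero_V)
  show "S = carrier V"
    if S: "lie_submodule complex_field (km_algebra D) V act S" and v: "q (word []) \<in> S" for S
  proof -
    have sub: "submodule S complex_field V"
      and st: "\<And>a v. a \<in> carrier (km_algebra D) \<Longrightarrow> v \<in> S \<Longrightarrow> act a v \<in> S"
      using S by (auto simp: lie_submodule_def)
    note E = Vm.submoduleE[OF sub]
    have "q x \<in> S" for x
    proof (induction x rule: words_induct)
      case (word w)
      show ?case
      proof (induction w)
        case (Cons i w)
        show ?case
        proof (cases "i \<in> ind D")
          case True
          have "km_elem D (F i) \<in> carrier (km_algebra D)"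
            using True unfolding km_elem_def km_algebra_def
              by (intro lie_class_carrier) (auto simp: km_gens_def)
          from st[OF this Cons.IH] show ?thesis using True by (simp add: act_gen)
        next
          case False
          then have "q (word (i # w)) = q (scl 0 (word []))" using bad_N[of i "word w"]
            by (simp add: q_eq)
          also have "\<dots> \<in> S" using E(4)[of 0 "q (word [])"] v by (simp add: smult_V)
          finally show ?thesis .
        qed
      qed (rule v)
    next
      case (scl c x)
      then show ?case using E(4)[of c "q x"] by (simp add: smult_V)
    next
      case (add x y)
      then show ?case using E(5)[of "q x" "q y"] by (simp add: add_V)
    qed
    then show ?thesis using E(1) by (auto simp: carrier_V)
  qed
qed

text \<open>Evaluation at \<open>q (word [])\<close> is \<open>q\<close> itself, so the invariants
  of the module are those of \<open>N\<close>.\<close>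

lemma kernel_eq: "hw.kernel = N"
proof -
  have "hw.evw w = q (word w)" for w
  proof (induction w)
    case (Cons i w)
    show ?case
    proof (cases "i \<in> ind D")
      case True
      then show ?thesis using Cons.IH act_V[of "Gen (F i)" "word w"] by (simp add: km_gens_def)
    next
      case False
      then show ?thesis
        using bad_N[of i "word w"] q_eq[of 0 "word (i # w)"] N_scl[of "word (i # w)" "- 1"]
        by (simp add: zero_V)
    qed
  qed simp
  then have "hw.ev x = q x" for x
    by (induction x rule: words_induct) (simp_all add: add_V smult_V)
  then show ?thesis by (auto simp: hw.kernel_def zero_V q_eq)
qed

lemma highest_weight: "highest_weight_module D \<Lambda> V act"
  unfolding highest_weight_module_def
  using hw.lie_module hw.v0_nonzero hw.v0_weight hw.v0_E hw.v0_generates by blast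

lemma integrability_V: "integrability D V act = integ"
  using hw.integrability_eq by (simp add: kernel_eq)

lemma weights_V: "weights D V act = wt \<Lambda> ` wts"
  using hw.weights_eq by (simp add: kernel_eq)

end

section \<open>Passage between modules and ideals, and the two directions of the equivalence\<close>

lemma (in kac_moody) hw_moduleE:
  assumes "\<Lambda> \<in> hdual D" "highest_weight_module D \<Lambda> V act"
  obtains v0 where "hw_module D \<Lambda> V act v0"
proof -
  obtain v0 where "v0 \<noteq> \<zero>\<^bsub>V\<^esub>" "v0 \<in> weight_space D V act \<Lambda>"
    "\<forall>i\<in>ind D. act (km_elem D (E i)) v0 = \<zero>\<^bsub>V\<^esub>"
    "\<forall>N. lie_submodule complex_field (km_algebra D) V act N \<and> v0 \<in> N \<longrightarrow> N = carrier V"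
    and "lie_module complex_field (km_algebra D) V act"
    using assms(2) unfolding highest_weight_module_def by blast
  then have "hw_module D \<Lambda> V act v0"
    using assms(1) by (intro hw_module.intro hw_module_axioms.intro kac_moody_axioms) blast+
  then show thesis by (rule that)
qed

text \<open>The hypotheses are symmetric in the two modules, so exchanging them turns the inclusion
  into equality.\<close>

lemma (in kac_moody) weights_le:
  assumes \<Lambda>: "\<Lambda> \<in> hdual D"
    and V: "highest_weight_module D \<Lambda> V act" "integrability D V act = J"
    and V': "highest_weight_module D \<Lambda> V' act'" "integrability D V' act' = J"
    and complete: "\<And>i j. i \<in> dominant_ind D \<Lambda> - J \<Longrightarrow> j \<in> dominant_ind D \<Lambda> - J \<Longrightarrow> gcm D i j \<noteq> 0"
  shows "weights D V act \<subseteq> weights D V' act'"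
proof -
  obtain v where "hw_module D \<Lambda> V act v" using hw_moduleE[OF \<Lambda> V(1)] .
  then interpret M: hw_module D \<Lambda> V act v .
  obtain v' where "hw_module D \<Lambda> V' act' v'" using hw_moduleE[OF \<Lambda> V'(1)] .
  then interpret M': hw_module D \<Lambda> V' act' v' .
  have J: "M.K.integ = J" "M'.K.integ = J" using M.integrability_eq M'.integrability_eq V(2) V'(2)
    by simp_all
  interpret verma_ideal_pair "gcm D" "\<lambda>i. \<Lambda> (coroot D i)" "ind D" M.kernel M'.kernel
    by unfold_locales (use J complete in \<open>auto simp: dominant_ind_def\<close>)
  show ?thesis unfolding M.weights_eq M'.weights_eq using wts_le by blast
qed

lemma (in kac_moody) realize:
  assumes "\<Lambda> \<in> hdual D" "large_type TYPE('v)"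
    and "verma_ideal (gcm D) (\<lambda>i. \<Lambda> (coroot D i)) (ind D) N"
    and "\<And>h x. x \<in> N \<Longrightarrow> diag (\<lambda>w. wt \<Lambda> (mset w) h) x \<in> N"
  obtains V :: "(complex, 'v) module" and act where
    "highest_weight_module D \<Lambda> V act" "integrability D V act = verma_ideal.integ (ind D) N"
    "weights D V act = wt \<Lambda> ` verma_ideal.wts N"
proof -
  interpret verma_ideal "gcm D" "\<lambda>i. \<Lambda> (coroot D i)" "ind D" N by (rule assms(3))
  obtain q :: "('i list \<Rightarrow>\<^sub>0 complex) \<Rightarrow> 'v"
    where q: "\<And>x y. q x = q y \<longleftrightarrow> x - y \<in> N"
    using quotient_map[OF finite_ind assms(2)] by blast
  interpret quotient_module D \<Lambda> N q
    by unfold_locales (use assms q in auto)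
  show thesis by (rule that[OF highest_weight integrability_V weights_V])
qed

theorem theorem2p10:
  fixes D :: "('i, 'h::ab_group_add) km_data"
    and \<Lambda> :: "'h \<Rightarrow> complex"
    and J :: "'i set"
  assumes "kac_moody D"
    and "\<Lambda> \<in> hdual D"
    and "J \<subseteq> dominant_ind D \<Lambda>"
    and "large_type TYPE('v)"
  shows "(\<forall>(V :: (complex, 'v) module) act (V' :: (complex, 'v) module) act'.
            highest_weight_module D \<Lambda> V act \<and> integrability D V act = J \<and>
            highest_weight_module D \<Lambda> V' act' \<and> integrability D V' act' = J \<longrightarrow>
            weights D V act = weights D V' act')
         \<longleftrightarrow>
         (\<forall>i \<in> dominant_ind D \<Lambda> - J. \<forall>j \<in> dominant_ind D \<Lambda> - J. root D j (coroot D i) \<noteq> 0)"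
proof
  interpret kac_moody D by (rule assms(1))
  let ?l = "\<lambda>i. \<Lambda> (coroot D i)"
  have pair: "root D j (coroot D i) = 0 \<longleftrightarrow> gcm D i j = 0"
    if "i \<in> dominant_ind D \<Lambda>" "j \<in> dominant_ind D \<Lambda>" for i j
    using that pairing by (auto simp: dominant_ind_def)
  {
    assume complete: "\<forall>i \<in> dominant_ind D \<Lambda> - J. \<forall>j \<in> dominant_ind D \<Lambda> - J. root D j (coroot D i) \<noteq> 0"
    then have "gcm D i j \<noteq> 0"
      if "i \<in> dominant_ind D \<Lambda> - J" "j \<in> dominant_ind D \<Lambda> - J" for i j
      using that pair by blast
    then show "\<forall>(V :: (complex, 'v) module) act (V' :: (complex, 'v) module) act'.
            highest_weight_module D \<Lambda> V act \<and> integrability D V act = J \<and>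
            highest_weight_module D \<Lambda> V' act' \<and> integrability D V' act' = J \<longrightarrow>
            weights D V act = weights D V' act'"
      using weights_le[OF assms(2)] by (intro allI impI equalityI) blast+
  }
  assume same: "\<forall>(V :: (complex, 'v) module) act (V' :: (complex, 'v) module) act'.
            highest_weight_module D \<Lambda> V act \<and> integrability D V act = J \<and>
            highest_weight_module D \<Lambda> V' act' \<and> integrability D V' act' = J \<longrightarrow>
            weights D V act = weights D V' act'"
  show "\<forall>i \<in> dominant_ind D \<Lambda> - J. \<forall>j \<in> dominant_ind D \<Lambda> - J. root D j (coroot D i) \<noteq> 0"
  proof (intro ballI notI)
    fix a b assume ab: "a \<in> dominant_ind D \<Lambda> - J" "b \<in> dominant_ind D \<Lambda> - J" "root D b (coroot D a) = 0"
    interpret km_matrix "gcm D" ?l "ind D" by (rule km_matrix_gcm)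
    interpret incomplete_data "gcm D" ?l "ind D" J a b
      by unfold_locales (use assms(3) ab pair[of a b] in \<open>auto simp: dominant_ind_def\<close>)
    \<comment> \<open>The parabolic Verma module of \<open>J\<close>.\<close>
    obtain V1 :: "(complex, 'v) module" and act1
      where V1: "highest_weight_module D \<Lambda> V1 act1"
      "integrability D V1 act1 = J" "weights D V1 act1 = wt \<Lambda> ` N1.wts"
      using realize[OF assms(2,4) N1.verma_ideal_axioms N1.ideal_diag] unfolding integ1 by blast
    \<comment> \<open>Its quotient by the submodule generated by the singular vector
      \<open>ab_word\<close>.\<close>
    obtain V2 :: "(complex, 'v) module" and act2
      where V2: "highest_weight_module D \<Lambda> V2 act2"
      "integrability D V2 act2 = J" "weights D V2 act2 = wt \<Lambda> ` N2.wts"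
      using realize[OF assms(2,4) N2.verma_ideal_axioms N2.ideal_diag] unfolding integ2 by blast
    have "weights D V1 act1 = weights D V2 act2" using same V1(1,2) V2(1,2) by blast
    then have "wt \<Lambda> ab_content \<in> wt \<Lambda> ` N2.wts" using ab_content1 V1(3) V2(3)
      by blast
    then obtain M where M: "M \<in> N2.wts" "wt \<Lambda> ab_content = wt \<Lambda> M" by blast
    then have "ab_content = M"
      using wt_inj N1.wts_subset[OF ab_content1] N2.wts_subset by blast
    with M(1) ab_content2 show False by simp
  qed
qed

end
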